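(* Consider all pairs $(A,V)$ with $A$ a finite group of odd order acting $\mathbf F_2$-linearly on a finite $\mathbf F_2$-space $V$ with $C_V(A)=0$, together with the associated coprime actions of $A$ on $G=B\rtimes V$. Then: the least dimension $\dim V$ of a balanced pair $(A,V)$ is $7$; the least order of a group $G$ in this family for which $|N_A(G)|\ne|C_G(A)/C_G(A)'|$ is $2^{135}$; and the least order of a group $A$ occurring in a balanced pair $(A,V)$ is $|A|=15$, attained at $\dim V=8$.
   Context: $(A,V)$ is balanced if $V$ has an $A$-stable subset of size $|V|/2$. $C_V(A)$ is the subspace of vectors fixed by all of $A$. $B$ is the additive group of all functions $V\to\mathbf F_2$; $(\tau_tf)(x)=f(x+t)$; $G=B\rtimes V$ has multiplication $(f,t)(g,s)=(f+\tau_tg,\,t+s)$; $A$ acts on $G$ by $a\cdot(f,t)=(f\circ a^{-1},a\cdot t)$. $C_G(A)$ is the subgroup of $A$-fixed elements of $G$, $C_G(A)'$ its derived subgroup, $\operatorname{Irr}_A(G)$ the set of $A$-invariant irreducible complex characters of $G$, and $N_A(G)=\{\chi\in\operatorname{Irr}_A(G):\chi(c)\ne0\ \forall c\in C_G(A)\}$. *)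

theory Defs
  imports
    "HOL-Library.Z2"
    "HOL-Algebra.Group_Action"
    "HOL-Algebra.Generated_Groups"
    "HOL-Analysis.Cartesian_Space"
    "Jordan_Normal_Form.VS_Connect"
begin

section \<open>Complex characters of a group\<close>

text \<open>The representation space of \<open>\<rho>\<close> is \<open>carrier_vec n\<close>; the target group is
  \<open>GL\<^sub>n\<close> over the complex numbers. The notion of subspace is the one of \<open>VectorSpace\<close>.\<close>

definition matrix_rep :: "'g monoid \<Rightarrow> nat \<Rightarrow> ('g \<Rightarrow> complex mat) \<Rightarrow> bool" where
  "matrix_rep G n \<rho> \<longleftrightarrow> \<rho> \<in> hom G (units_of (ring_mat TYPE(complex) n ()))"

definition invariant_subspace ::
    "'g monoid \<Rightarrow> nat \<Rightarrow> ('g \<Rightarrow> complex mat) \<Rightarrow> complex vec set \<Rightarrow> bool" where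
  "invariant_subspace G n \<rho> W \<longleftrightarrow>
     VectorSpace.subspace class_ring W (module_vec TYPE(complex) n) \<and>
     (\<forall>g\<in>carrier G. \<forall>w\<in>W. \<rho> g *\<^sub>v w \<in> W)"

definition irreducible_rep :: "'g monoid \<Rightarrow> nat \<Rightarrow> ('g \<Rightarrow> complex mat) \<Rightarrow> bool" where
  "irreducible_rep G n \<rho> \<longleftrightarrow>
     matrix_rep G n \<rho> \<and> 0 < n \<and>
     (\<forall>W. invariant_subspace G n \<rho> W \<longrightarrow> W = {0\<^sub>v n} \<or> W = carrier_vec n)"

text \<open>Characters are made extensional (\<open>undefined\<close> off the carrier), so that
  distinct elements of \<open>irr_chars G\<close> are distinct as functions on the group.\<close>

definition rep_character :: "'g monoid \<Rightarrow> nat \<Rightarrow> ('g \<Rightarrow> complex mat) \<Rightarrow> 'g \<Rightarrow> complex" where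
  "rep_character G n \<rho> = (\<lambda>g\<in>carrier G. \<Sum>i<n. \<rho> g $$ (i, i))"

definition irr_chars :: "'g monoid \<Rightarrow> ('g \<Rightarrow> complex) set" where
  "irr_chars G = {rep_character G n \<rho> | n \<rho>. irreducible_rep G n \<rho>}"


section \<open>A group acting on a group\<close>

text \<open>Here \<open>\<alpha> a\<close> is the permutation of \<open>carrier G\<close> given by \<open>a \<in> carrier A\<close>.\<close>

definition fixed_subgroup :: "'a monoid \<Rightarrow> 'g monoid \<Rightarrow> ('a \<Rightarrow> 'g \<Rightarrow> 'g) \<Rightarrow> 'g set" where
  "fixed_subgroup A G \<alpha> = {g \<in> carrier G. \<forall>a\<in>carrier A. \<alpha> a g = g}"

definition invariant_irr_chars ::
    "'a monoid \<Rightarrow> 'g monoid \<Rightarrow> ('a \<Rightarrow> 'g \<Rightarrow> 'g) \<Rightarrow> ('g \<Rightarrow> complex) set" where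
  "invariant_irr_chars A G \<alpha> =
     {\<psi> \<in> irr_chars G. \<forall>a\<in>carrier A. \<forall>g\<in>carrier G. \<psi> (\<alpha> a g) = \<psi> g}"

definition nonvanishing_chars ::
    "'a monoid \<Rightarrow> 'g monoid \<Rightarrow> ('a \<Rightarrow> 'g \<Rightarrow> 'g) \<Rightarrow> ('g \<Rightarrow> complex) set" where
  "nonvanishing_chars A G \<alpha> =
     {\<psi> \<in> invariant_irr_chars A G \<alpha>. \<forall>c\<in>fixed_subgroup A G \<alpha>. \<psi> c \<noteq> 0}"

definition fixed_abelianization ::
    "'a monoid \<Rightarrow> 'g monoid \<Rightarrow> ('a \<Rightarrow> 'g \<Rightarrow> 'g) \<Rightarrow> 'g set monoid" where
  "fixed_abelianization A G \<alpha> =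
     (G\<lparr>carrier := fixed_subgroup A G \<alpha>\<rparr>) Mod derived G (fixed_subgroup A G \<alpha>)"


section \<open>Pairs \<open>(A, V)\<close> and the associated groups \<open>G\<close>\<close>

text \<open>The finite \<open>\<F>\<^sub>2\<close>-space \<open>V\<close> is the whole type \<open>'v\<close> with scalar multiplication
  \<open>scale\<close>; \<open>A\<close> need not act faithfully.\<close>

locale F2_pair =
  vector_space scale + group_action A "UNIV :: 'v set" \<phi>
  for scale :: "bit \<Rightarrow> 'v::ab_group_add \<Rightarrow> 'v"
    and A :: "'a monoid"
    and \<phi> :: "'a \<Rightarrow> 'v \<Rightarrow> 'v" +
  assumes finite_V: "finite (UNIV :: 'v set)"
    and finite_A: "finite (carrier A)"
    and odd_A: "odd (Coset.order A)"
    and linear_action: "a \<in> carrier A \<Longrightarrow> Vector_Spaces.linear scale scale (\<phi> a)"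
    and fixed_points_trivial: "{v. \<forall>a\<in>carrier A. \<phi> a v = v} = {0}"

definition balanced :: "'a monoid \<Rightarrow> ('a \<Rightarrow> 'v \<Rightarrow> 'v) \<Rightarrow> bool" where
  "balanced A \<phi> \<longleftrightarrow>
     (\<exists>S. (\<forall>a\<in>carrier A. \<phi> a ` S \<subseteq> S) \<and> 2 * card S = card (UNIV :: 'v set))"

definition translate :: "'v::ab_group_add \<Rightarrow> ('v \<Rightarrow> bit) \<Rightarrow> 'v \<Rightarrow> bit" where
  "translate t f = (\<lambda>x. f (x + t))"

text \<open>\<open>B \<rtimes> V\<close>; the element \<open>(f, t)\<close> has \<open>f\<close> in the base group \<open>B\<close> of all functions.\<close>

definition semidirect_group :: "(('v::ab_group_add \<Rightarrow> bit) \<times> 'v) monoid" where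
  "semidirect_group =
     \<lparr>carrier = UNIV,
      mult = (\<lambda>(f, t) (g, s). ((\<lambda>x. f x + translate t g x), t + s)),
      one = ((\<lambda>x. 0), 0)\<rparr>"

definition induced_action ::
    "'a monoid \<Rightarrow> ('a \<Rightarrow> 'v \<Rightarrow> 'v) \<Rightarrow> 'a \<Rightarrow> ('v \<Rightarrow> bit) \<times> 'v \<Rightarrow> ('v \<Rightarrow> bit) \<times> 'v" where
  "induced_action A \<phi> a = (\<lambda>(f, t). (f \<circ> \<phi> (inv\<^bsub>A\<^esub> a), \<phi> a t))"

end

theory Submission
  imports Defs "HOL-Number_Theory.Cong" "HOL-Algebra.Sylow"
begin

text \<open>By Clifford theory an irreducible character of \<open>G = B \<rtimes> V\<close> is induced from an extension of a
  linear character of \<open>B\<close>, that is, of a subset of \<open>V\<close> up to translation. Since \<open>A\<close> has odd order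
  and \<open>C\<^sub>V(A) = 0\<close>, averaging over \<open>A\<close> shows that the \<open>A\<close>-invariant ones correspond bijectively to
  the \<open>A\<close>-stable subsets \<open>S\<close>, and so do the elements of the abelian group \<open>C\<^sub>G(A)\<close>. Up to a positive
  factor the value at the element given by \<open>F\<close> is \<open>|V| - 2 |D|\<close>, where \<open>D\<close> is the stable set of all \<open>v\<close>
  with \<open>|F \<inter> (S + v)|\<close> odd; for \<open>F = {0}\<close> this set is \<open>S\<close>. Hence \<open>|N\<^sub>A(G)|\<close> differs from
  \<open>|C\<^sub>G(A)|\<close> exactly when the pair is balanced.

  For a Sylow \<open>p\<close>-subgroup \<open>P\<close> of \<open>A\<close>, a stable set and its intersection with the fixed space of \<open>P\<close>
  have congruent sizes modulo \<open>p\<close>. This excludes balanced pairs with \<open>|A|\<close> a prime power, hence with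
  \<open>|A| < 15\<close>. In dimension at most 6 it excludes the primes 31, 5 and 7 one after the other from the
  orbit sizes, so that all of them are powers of 3.

  The cyclic group of order 21 acts on \<open>\<F>\<^sub>8 \<oplus> \<F>\<^sub>4 \<oplus> \<F>\<^sub>4\<close>, where \<open>0\<close> and the vectors without zero
  coordinate form a stable set of size \<open>1 + 7 \<cdot> 3 \<cdot> 3 = 64\<close>; the cyclic group of order 15 acts on
  \<open>\<F>\<^sub>1\<^sub>6 \<oplus> \<F>\<^sub>4 \<oplus> \<F>\<^sub>4\<close>, through an element of order 5 on \<open>\<F>\<^sub>1\<^sub>6\<close>, with a stable set of size
  \<open>10 \<cdot> 4 \<cdot> 3 + 3 + 5 = 128\<close>.\<close>

section \<open>Orbits of a finite group and Sylow subgroups\<close>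

text \<open>A stable set is the disjoint union of the orbits of its points.\<close>

lemma (in group_action) dvd_card_stable:
  assumes "finite X" "X \<subseteq> E" "\<And>g x. g \<in> carrier G \<Longrightarrow> x \<in> X \<Longrightarrow> \<phi> g x \<in> X"
    and "\<And>x. x \<in> X \<Longrightarrow> n dvd card (orbit G \<phi> x)"
  shows "n dvd card X"
proof -
  have U: "\<Union> (orbit G \<phi> ` X) = X"
    using orbit_refl assms(2,3) by (auto simp: orbit_def subset_iff)
  have "n dvd card (\<Union> (orbit G \<phi> ` X))"
  proof (rule dvd_partition)
    show "finite (\<Union> (orbit G \<phi> ` X))" using U assms(1) by simp
    show "\<forall>c\<in>orbit G \<phi> ` X. n dvd card c" using assms(4) by auto
    show "\<forall>c1\<in>orbit G \<phi> ` X. \<forall>c2\<in>orbit G \<phi> ` X. c1 \<noteq> c2 \<longrightarrow> c1 \<inter> c2 = {}"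
      using disjoint_union assms(2) unfolding orbits_def by blast
  qed
  then show ?thesis using U by simp
qed

text \<open>A nontrivial orbit of a \<open>p\<close>-group has size divisible by \<open>p\<close>,
  so the points that are not fixed contribute nothing modulo \<open>p\<close>.\<close>

lemma (in group_action) card_cong_fixed:
  assumes "prime p" "Coset.order G = p ^ a"
    and "finite X" "X \<subseteq> E" "\<And>g x. g \<in> carrier G \<Longrightarrow> x \<in> X \<Longrightarrow> \<phi> g x \<in> X"
  shows "[card X = card {x \<in> X. \<forall>g\<in>carrier G. \<phi> g x = x}] (mod p)"
proof -
  let ?F = "{x \<in> X. \<forall>g\<in>carrier G. \<phi> g x = x}"
  have "p dvd card (X - ?F)"
  proof (rule dvd_card_stable)
    fix g x assume g: "g \<in> carrier G" and x: "x \<in> X - ?F"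
    \<comment> \<open>If \<open>\<phi> g x\<close> is fixed by all of \<open>G\<close>, then by
      \<open>inv g\<close> in particular; hence it equals \<open>x\<close>, and \<open>x\<close> is
      fixed too.\<close>
    have "x \<in> ?F" if "\<forall>h\<in>carrier G. \<phi> h (\<phi> g x) = \<phi> g x"
    proof -
      interpret group G using group_hom group_hom.axioms(1) by auto
      have xE: "x \<in> E" using x assms(4) by auto
      have "\<phi> (inv g) (\<phi> g x) = x" using orbit_sym_aux[OF g xE refl] .
      moreover have "\<phi> (inv g) (\<phi> g x) = \<phi> g x" using that g by simp
      ultimately have "\<phi> g x = x" by simp
      then show ?thesis using that x by auto
    qed
    moreover have "\<phi> g x \<in> X" using x by (intro assms(5)[OF g]) simp
    ultimately show "\<phi> g x \<in> X - ?F" using x by blast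
  next
    fix x assume x: "x \<in> X - ?F"
    then have xE: "x \<in> E" using assms(4) by auto
    have fin: "finite (orbit G \<phi> x)"
    proof (rule finite_subset[OF _ assms(3)])
      show "orbit G \<phi> x \<subseteq> X" using x assms(5) unfolding orbit_def by blast
    qed
    have "card (orbit G \<phi> x) dvd p ^ a"
      using orbit_stabilizer_theorem[OF xE] assms(2) by (metis dvd_triv_left)
    moreover have "card (orbit G \<phi> x) \<noteq> 1"
    proof
      assume "card (orbit G \<phi> x) = 1"
      then have "orbit G \<phi> x = {x}" using orbit_refl[OF xE] by (metis card_1_singletonE singletonD)
      then show False using x by (auto simp: orbit_def)
    qed
    ultimately show "p dvd card (orbit G \<phi> x)"
      using assms(1) by (metis divides_primepow_nat dvd_power gr0I power_0)
  qed (use assms(3,4) in auto)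
  moreover have "card X = card (X - ?F) + card ?F"
    using assms(3) by (subst card_Un_disjoint[symmetric]) (auto intro!: arg_cong[where f = card])
  ultimately show ?thesis
    by (auto simp: cong_def elim!: dvdE)
qed

text \<open>\<open>P\<close> acts on the right cosets of \<open>Q\<close> by \<open>R \<mapsto> R x\<^sup>-\<^sup>1\<close>; the number of
  cosets is prime to \<open>p\<close>, so there is a fixed coset \<open>Q g\<close>.\<close>

lemma (in group) sylow_conjugate:
  assumes "prime p" "finite (carrier G)" "subgroup P G" "subgroup Q G"
    and "card P = p ^ a" "card Q = p ^ a" "Coset.order G = p ^ a * m" "\<not> p dvd m"
  shows "\<exists>g\<in>carrier G. \<forall>x\<in>P. g \<otimes> x \<otimes> inv g \<in> Q"
proof -
  \<comment> \<open>The action is set up on all subsets of \<open>carrier G\<close>; the cosets of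
    \<open>Q\<close> are then a stable family inside.\<close>
  define E where "E = {X. X \<subseteq> carrier G}"
  define \<psi> where "\<psi> = (\<lambda>g. \<lambda>X\<in>E. X #> inv g)"
  have inE: "X #> g \<in> E" if "X \<in> E" "g \<in> carrier G" for X g
    using that unfolding E_def by (simp add: r_coset_subset_G)
  have bij: "\<psi> g \<in> Bij E" if g: "g \<in> carrier G" for g
  proof -
    have "bij_betw (\<psi> g) E E"
      by (rule bij_betw_byWitness[where f' = "\<lambda>X. X #> g"])
         (use g inE in \<open>auto simp: \<psi>_def E_def coset_mult_assoc\<close>)
    then show ?thesis by (auto simp: Bij_def \<psi>_def)
  qed
  interpret act: group_action G E \<psi>
  proof (unfold group_action_def group_hom_def group_hom_axioms_def, intro conjI group_axioms group_BijGroup homI)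
    fix g h assume g: "g \<in> carrier G" and h: "h \<in> carrier G"
    have "\<psi> (g \<otimes> h) = compose E (\<psi> g) (\<psi> h)"
      using g h inE by (intro ext) (auto simp: \<psi>_def compose_def E_def coset_mult_assoc inv_mult_group)
    then show "\<psi> (g \<otimes> h) = \<psi> g \<otimes>\<^bsub>BijGroup E\<^esub> \<psi> h"
      using bij g h by (simp add: BijGroup_def)
  qed (use bij in \<open>auto simp: BijGroup_def\<close>)
  interpret actP: group_action "G\<lparr>carrier := P\<rparr>" E \<psi>
    by (rule act.induced_action[OF assms(3)])
  have Psub: "P \<subseteq> carrier G" and Qsub: "Q \<subseteq> carrier G"
    using assms(3,4) by (auto simp: subgroup.subset)
  have sub: "rcosets Q \<subseteq> E"
    using Qsub by (auto simp: E_def RCOSETS_def r_coset_def)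
  have "[card (rcosets Q) = card {R \<in> rcosets Q. \<forall>g\<in>carrier (G\<lparr>carrier := P\<rparr>). \<psi> g R = R}] (mod p)"
  proof (rule actP.card_cong_fixed[OF assms(1) _ _ sub])
    show "Coset.order (G\<lparr>carrier := P\<rparr>) = p ^ a" using assms(5) by (simp add: Coset.order_def)
    show "finite (rcosets Q)"
      by (rule finite_subset[OF sub]) (use assms(2) in \<open>simp add: E_def\<close>)
    fix g R assume g: "g \<in> carrier (G\<lparr>carrier := P\<rparr>)" and R: "R \<in> rcosets Q"
    from R obtain h where h: "h \<in> carrier G" "R = Q #> h" by (auto simp: RCOSETS_def)
    have "\<psi> g R = Q #> (h \<otimes> inv g)"
      using g h sub R Psub Qsub by (auto simp: \<psi>_def coset_mult_assoc subset_iff)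
    then show "\<psi> g R \<in> rcosets Q"
      using g h Psub by (auto simp: RCOSETS_def subset_iff intro!: bexI[of _ "h \<otimes> inv g"])
  qed
  moreover have "card (rcosets Q) = m"
    using lagrange[OF assms(4)] assms(1,6,7) by (simp add: mult.commute prime_gt_0_nat)
  ultimately have "[m = card {R \<in> rcosets Q. \<forall>g\<in>P. \<psi> g R = R}] (mod p)"
    by simp
  then have "{R \<in> rcosets Q. \<forall>g\<in>P. \<psi> g R = R} \<noteq> {}"
    using assms(8) by (metis card.empty cong_0_iff)
  then obtain R where R: "R \<in> rcosets Q" "\<forall>g\<in>P. \<psi> g R = R" by blast
  from R(1) obtain g where g: "g \<in> carrier G" "R = Q #> g" by (auto simp: RCOSETS_def)
  have "g \<otimes> x \<otimes> inv g \<in> Q" if x: "x \<in> P" for x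
  proof -
    have xc: "x \<in> carrier G" and ix: "inv x \<in> P"
      using x Psub assms(3) by (auto simp: subgroup.m_inv_closed)
    \<comment> \<open>\<open>inv x\<close> acts as right multiplication by \<open>x\<close>, so the
      fixed coset satisfies \<open>Q g x = Q g\<close>.\<close>
    have "\<psi> (inv x) R = R" using R(2) ix by blast
    then have "Q #> (g \<otimes> x) = Q #> g"
      using R(1) sub g xc Qsub by (auto simp: \<psi>_def coset_mult_assoc subset_iff)
    then have "Q #> (g \<otimes> x \<otimes> inv g) = Q"
      using g xc Qsub by (metis coset_mult_assoc coset_mult_one inv_closed m_closed r_inv)
    then show ?thesis
      using rcos_self[OF _ assms(4), of "g \<otimes> x \<otimes> inv g"] g xc by simp
  qed
  then show ?thesis using g(1) by blast
qed

text \<open>With \<open>v = \<phi> g u\<close>, both \<open>P\<close> and its conjugate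
  \<open>Q\<close> by \<open>g\<close> are Sylow subgroups of the stabilizer of \<open>v\<close>.
  Some \<open>h\<close> in this stabilizer conjugates \<open>Q\<close> into \<open>P\<close>, and
  \<open>n = h g\<close> has both properties.\<close>

lemma (in group_action) sylow_fixed_points_conjugate:
  assumes "prime p" "finite (carrier G)" "subgroup P G"
    and "card P = p ^ a" "Coset.order G = p ^ a * m" "\<not> p dvd m"
    and "u \<in> E" "\<forall>x\<in>P. \<phi> x u = u" "g \<in> carrier G" "\<forall>x\<in>P. \<phi> x (\<phi> g u) = \<phi> g u"
  shows "\<exists>n\<in>carrier G. (\<forall>x\<in>P. n \<otimes> x \<otimes> inv n \<in> P) \<and> \<phi> n u = \<phi> g u"
proof -
  interpret group G using group_hom group_hom.axioms(1) by auto
  define v where "v = \<phi> g u"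
  define H where "H = stabilizer G \<phi> v"
  define Q where "Q = g <# P #> inv g"
  have v: "v \<in> E" using assms(7,9) element_image v_def by blast
  have H: "subgroup H G" unfolding H_def by (rule stabilizer_subgroup[OF v])
  have Psub: "P \<subseteq> carrier G" using assms(3) by (simp add: subgroup.subset)
  have Q: "subgroup Q G"
    unfolding Q_def using subgroup_conjugation_is_surj2[OF assms(9,3)] .
  have Qeq: "Q = (\<lambda>x. g \<otimes> x \<otimes> inv g) ` P"
    unfolding Q_def l_coset_def r_coset_def by auto
  have cQ: "card Q = p ^ a"
    unfolding Qeq assms(4)[symmetric]
    by (rule card_image) (use Psub assms(9) in \<open>auto simp: inj_on_def subset_iff\<close>)
  have PH: "P \<subseteq> H" using assms(10) Psub by (auto simp: H_def v_def stabilizer_def)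
  have QH: "Q \<subseteq> H"
  proof
    fix y assume "y \<in> Q"
    then obtain x where x: "x \<in> P" "y = g \<otimes> x \<otimes> inv g" unfolding Qeq by blast
    have xc: "x \<in> carrier G" using x Psub by auto
    have "\<phi> (inv g) v = u" using orbit_sym_aux[OF assms(9,7)] by (simp add: v_def)
    then have "\<phi> y v = v"
      using x xc v assms(7,8,9) by (simp add: composition_rule v_def)
    then show "y \<in> H" using x xc assms(9) by (simp add: H_def stabilizer_def)
  qed
  let ?H = "G\<lparr>carrier := H\<rparr>"
  interpret H: group ?H by (rule subgroup_imp_group[OF H])
  have PsH: "subgroup P ?H" and QsH: "subgroup Q ?H"
    using subgroup_incl[OF assms(3) H PH] subgroup_incl[OF Q H QH] by auto
  \<comment> \<open>\<open>p ^ a\<close> is the exact power of \<open>p\<close> in the order of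
    \<open>H\<close>: it divides that order, which in turn divides the order of
    \<open>G\<close>.\<close>
  have "p ^ a dvd Coset.order ?H"
    using H.lagrange[OF PsH] assms(4) by (metis dvd_triv_right)
  then obtain k where k: "Coset.order ?H = p ^ a * k" by (auto simp: dvd_def)
  have "Coset.order ?H dvd Coset.order G"
    using dvd_triv_right[of "card H" "card (rcosets H)"] lagrange[OF H] by (simp add: Coset.order_def)
  then have "k dvd m"
    using k assms(1,5) by (simp add: prime_gt_0_nat)
  then have nk: "\<not> p dvd k" using assms(6) dvd_trans by blast
  have fH: "finite (carrier ?H)"
    using finite_subset[OF subgroup.subset[OF H] assms(2)] by simp
  obtain h where h: "h \<in> H" "\<forall>x\<in>Q. h \<otimes>\<^bsub>?H\<^esub> x \<otimes>\<^bsub>?H\<^esub> inv\<^bsub>?H\<^esub> h \<in> P"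
    using H.sylow_conjugate[OF assms(1) fH QsH PsH cQ assms(4) k nk] by auto
  have hc: "h \<in> carrier G" using h(1) H by (meson subgroup.mem_carrier)
  have h2: "h \<otimes> x \<otimes> inv h \<in> P" if "x \<in> Q" for x
    using h that m_inv_consistent[OF H] by simp
  have "(h \<otimes> g) \<otimes> x \<otimes> inv (h \<otimes> g) \<in> P" if x: "x \<in> P" for x
  proof -
    have "h \<otimes> (g \<otimes> x \<otimes> inv g) \<otimes> inv h \<in> P" using h2 x unfolding Qeq by blast
    moreover have "x \<in> carrier G" using x Psub by auto
    ultimately show ?thesis using hc assms(9) by (simp add: m_assoc inv_mult_group)
  qed
  moreover have "\<phi> (h \<otimes> g) u = v"
    using h(1) hc assms(7,9) by (simp add: composition_rule H_def stabilizer_def v_def)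
  ultimately show ?thesis using hc assms(9) v_def by blast
qed

text \<open>The fixed points of a Sylow subgroup on one orbit form a single orbit of its normalizer.\<close>

lemma (in group_action) card_orbit_Int_sylow_fixed_dvd:
  assumes "prime p" "finite (carrier G)" "subgroup P G"
    and "card P = p ^ a" "Coset.order G = p ^ a * m" "\<not> p dvd m"
    and "u \<in> E" "\<forall>x\<in>P. \<phi> x u = u"
  shows "card (orbit G \<phi> u \<inter> {v. \<forall>x\<in>P. \<phi> x v = v}) dvd Coset.order G"
proof -
  interpret group G using group_hom group_hom.axioms(1) by auto
  \<comment> \<open>The normalizer of \<open>P\<close>, with a two-sided condition that passes to
    inverses directly; since \<open>P\<close> is finite, \<open>NI\<close> recovers it from the
    one-sided condition.\<close>
  define N where "N = {n \<in> carrier G. \<forall>x\<in>carrier G. n \<otimes> x \<otimes> inv n \<in> P \<longleftrightarrow> x \<in> P}"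
  have Psub: "P \<subseteq> carrier G" using assms(3) by (simp add: subgroup.subset)
  have N: "subgroup N G"
  proof (rule subgroupI)
    have "\<one> \<in> N" by (auto simp: N_def)
    then show "N \<noteq> {}" by blast
    show "inv n \<in> N" if n: "n \<in> N" for n
    proof -
      have nc: "n \<in> carrier G" using n by (simp add: N_def)
      have "inv n \<otimes> x \<otimes> inv (inv n) \<in> P \<longleftrightarrow> x \<in> P" if x: "x \<in> carrier G" for x
      proof -
        have "n \<otimes> (inv n \<otimes> x \<otimes> n) \<otimes> inv n = x"
          using nc x by (metis inv_closed inv_inv inv_solve_right m_assoc m_closed r_inv r_one l_one)
        moreover have "n \<otimes> (inv n \<otimes> x \<otimes> n) \<otimes> inv n \<in> P \<longleftrightarrow> inv n \<otimes> x \<otimes> n \<in> P"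
          using n nc x unfolding N_def by blast
        ultimately show ?thesis using nc by simp
      qed
      then show ?thesis using nc by (simp add: N_def)
    qed
    show "n \<otimes> k \<in> N" if n: "n \<in> N" and k: "k \<in> N" for n k
    proof -
      have nc: "n \<in> carrier G" "k \<in> carrier G" using n k by (auto simp: N_def)
      have "(n \<otimes> k) \<otimes> x \<otimes> inv (n \<otimes> k) \<in> P \<longleftrightarrow> x \<in> P" if x: "x \<in> carrier G" for x
      proof -
        have "(n \<otimes> k) \<otimes> x \<otimes> inv (n \<otimes> k) = n \<otimes> (k \<otimes> x \<otimes> inv k) \<otimes> inv n"
          using nc x by (simp add: m_assoc inv_mult_group)
        then show ?thesis using n k nc x by (simp add: N_def)
      qed
      then show ?thesis using nc by (simp add: N_def)
    qed
  qed (auto simp: N_def)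
  have fP: "finite P" using Psub assms(2) finite_subset by blast
  have NI: "n \<in> N" if n: "n \<in> carrier G" and nP: "\<forall>x\<in>P. n \<otimes> x \<otimes> inv n \<in> P" for n
  proof -
    have "inj_on (\<lambda>x. n \<otimes> x \<otimes> inv n) (carrier G)"
      using n by (auto simp: inj_on_def)
    then have "(\<lambda>x. n \<otimes> x \<otimes> inv n) ` P = P"
      using fP nP Psub by (intro endo_inj_surj) (auto intro: inj_on_subset)
    have "x \<in> P" if x: "x \<in> carrier G" "n \<otimes> x \<otimes> inv n \<in> P" for x
    proof -
      obtain y where y: "y \<in> P" "n \<otimes> x \<otimes> inv n = n \<otimes> y \<otimes> inv n"
        using \<open>(\<lambda>x. n \<otimes> x \<otimes> inv n) ` P = P\<close> x(2) by blast
      then have "x = y" using x(1) Psub n by auto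
      then show ?thesis using y by simp
    qed
    then show ?thesis using n nP unfolding N_def by blast
  qed
  interpret actN: group_action "G\<lparr>carrier := N\<rparr>" E \<phi>
    by (rule induced_action[OF N])
  \<comment> \<open>Points of the orbit fixed by \<open>P\<close> are reached from \<open>u\<close>
    inside the normalizer by the conjugacy lemma; conversely the normalizer preserves the fixed
    points of \<open>P\<close>.\<close>
  have "orbit G \<phi> u \<inter> {v. \<forall>x\<in>P. \<phi> x v = v} = orbit (G\<lparr>carrier := N\<rparr>) \<phi> u" (is "?L = ?R")
  proof
    show "?L \<subseteq> ?R"
    proof
      fix v assume v: "v \<in> ?L"
      then obtain g where g: "g \<in> carrier G" "v = \<phi> g u"
        unfolding orbit_def by blast
      have gv: "\<forall>x\<in>P. \<phi> x (\<phi> g u) = \<phi> g u" using v g(2) by simp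
      then obtain n where n: "n \<in> carrier G" "\<forall>x\<in>P. n \<otimes> x \<otimes> inv n \<in> P" "\<phi> n u = v"
        using sylow_fixed_points_conjugate[OF assms(1-8) g(1) gv] g(2) by blast
      then have "n \<in> N" using NI by blast
      then show "v \<in> ?R" using n(3) unfolding orbit_def by auto
    qed
    show "?R \<subseteq> ?L"
    proof
      fix v assume "v \<in> ?R"
      then obtain n where n: "n \<in> N" "v = \<phi> n u" by (auto simp: orbit_def)
      have nc: "n \<in> carrier G" using n by (simp add: N_def)
      have "\<phi> x v = v" if x: "x \<in> P" for x
      proof -
        have xc: "x \<in> carrier G" using x Psub by auto
        define y where "y = inv n \<otimes> x \<otimes> n"
        have "inv n \<in> N" using n N by (simp add: subgroup.m_inv_closed)
        then have "y \<in> P" using x xc nc by (auto simp: N_def y_def)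
        then have yc: "y \<in> carrier G" and yu: "\<phi> y u = u" using Psub assms(8) by auto
        have "n \<otimes> y = n \<otimes> inv n \<otimes> (x \<otimes> n)" using nc xc by (simp only: y_def m_assoc inv_closed m_closed)
        then have "x \<otimes> n = n \<otimes> y" using nc xc by simp
        then have "\<phi> x (\<phi> n u) = \<phi> n (\<phi> y u)"
          using composition_rule[OF assms(7)] nc xc yc by metis
        then show ?thesis using n yu by simp
      qed
      then show "v \<in> ?L" using n nc unfolding orbit_def by blast
    qed
  qed
  moreover have "card (orbit (G\<lparr>carrier := N\<rparr>) \<phi> u) dvd Coset.order (G\<lparr>carrier := N\<rparr>)"
    using actN.orbit_stabilizer_theorem[OF assms(7)] by (metis dvd_triv_left)
  moreover have "Coset.order (G\<lparr>carrier := N\<rparr>) dvd Coset.order G"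
    using dvd_triv_right[of "card N" "card (rcosets N)"] lagrange[OF N] by (simp add: Coset.order_def)
  ultimately show ?thesis by (metis dvd_trans)
qed

section \<open>Lower bounds for balanced pairs\<close>

lemma odd_ge_3: "odd n \<Longrightarrow> n \<noteq> 1 \<Longrightarrow> 3 \<le> n" for n :: nat
  by presburger

context F2_pair
begin

section \<open>Counting in spaces over \<open>bit\<close> and sizes of orbits\<close>

lemma add_self: "v + v = (0 :: 'v)"
proof -
  have "scale (1 + 1) v = scale 1 v + scale 1 v" by (rule scale_left_distrib)
  then show ?thesis by simp
qed

lemma finite_set_V [simp]: "finite (S :: 'v set)"
  by (rule finite_subset[OF subset_UNIV finite_V])

lemma action_add: "a \<in> carrier A \<Longrightarrow> \<phi> a (v + w) = \<phi> a v + \<phi> a w"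
  using linear_action by (simp add: Vector_Spaces.linear_iff)

lemma action_zero: "a \<in> carrier A \<Longrightarrow> \<phi> a 0 = 0"
  using action_add[of a 0 0] by simp

lemma action_inv: "a \<in> carrier A \<Longrightarrow> \<phi> (inv\<^bsub>A\<^esub> a) (\<phi> a v) = v"
  using orbit_sym_aux by blast

lemma group_A: "group A"
  using group_hom group_hom.axioms(1) by blast

text \<open>The only nonzero scalar is 1, so a new independent vector \<open>b\<close> adds exactly
  the disjoint coset \<open>b + span B\<close> and doubles the span.\<close>

lemma card_span: "finite B \<Longrightarrow> independent B \<Longrightarrow> card (span B) = 2 ^ card B"
proof (induction B rule: finite_induct)
  case empty
  then show ?case by simp
next
  case (insert b B)
  have nb: "b \<notin> span B" and ind: "independent B"
    using insert.prems insert.hyps by (auto simp: independent_insert)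
  have eq1: "x - scale k b \<in> span B \<longleftrightarrow> (if k = 0 then x \<in> span B else x - b \<in> span B)" for x k
    by (cases k) auto
  have eq: "span (insert b B) = span B \<union> (+) b ` span B"
  proof (rule equalityI; rule subsetI)
    fix x assume "x \<in> span (insert b B)"
    then have "x \<in> span B \<or> x - b \<in> span B" using eq1 by (auto simp: span_insert split: if_splits)
    moreover have "x = b + (x - b)" by simp
    ultimately show "x \<in> span B \<union> (+) b ` span B" by blast
  next
    fix x assume "x \<in> span B \<union> (+) b ` span B"
    then show "x \<in> span (insert b B)"
      by (auto intro: span_add span_base span_mono[THEN subsetD, of B "insert b B"])
  qed
  have "span B \<inter> (+) b ` span B = {}"
    using nb by (auto dest: span_diff)
  then have "card (span (insert b B)) = card (span B) + card ((+) b ` span B)"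
    unfolding eq by (intro card_Un_disjoint) auto
  also have "card ((+) b ` span B) = card (span B)"
    by (intro card_image) auto
  finally show ?case using insert.IH[OF ind] insert.hyps by simp
qed

lemma card_subspace:
  assumes "subspace W"
  shows "card W = 2 ^ dim W"
proof -
  obtain B where B: "B \<subseteq> W" "independent B" "W \<subseteq> span B" "card B = dim W"
    using basis_exists by blast
  then have "span B = W" using span_minimal[OF B(1) assms] by auto
  then show ?thesis using card_span[of B] B by simp
qed

lemma card_V: "card (UNIV :: 'v set) = 2 ^ dim UNIV"
  by (rule card_subspace) simp

lemma subspace_fixed:
  assumes "P \<subseteq> carrier A"
  shows "subspace {v. \<forall>x\<in>P. \<phi> x v = v}"
proof (rule subspaceI)
  have P: "x \<in> carrier A" if "x \<in> P" for x using assms that by blast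
  show "0 \<in> {v. \<forall>x\<in>P. \<phi> x v = v}" using P action_zero by simp
  show "v + w \<in> {v. \<forall>x\<in>P. \<phi> x v = v}"
    if "v \<in> {v. \<forall>x\<in>P. \<phi> x v = v}" "w \<in> {v. \<forall>x\<in>P. \<phi> x v = v}" for v w
    using that P by (simp add: action_add)
  show "scale c v \<in> {v. \<forall>x\<in>P. \<phi> x v = v}" if v: "v \<in> {v. \<forall>x\<in>P. \<phi> x v = v}" for c v
  proof (cases "c = 0")
    case True
    then show ?thesis using P action_zero by simp
  next
    case False
    then show ?thesis using v by simp
  qed
qed

lemma card_orbit_dvd: "card (orbit A \<phi> v) dvd Coset.order A"
  using orbit_stabilizer_theorem[of v] by (metis UNIV_I dvd_triv_left)

lemma odd_card_orbit: "odd (card (orbit A \<phi> v))"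
  using card_orbit_dvd[of v] odd_A by (metis dvd_trans)

lemma orbit_nontrivial:
  assumes "v \<noteq> 0"
  shows "card (orbit A \<phi> v) \<noteq> 1"
proof
  assume "card (orbit A \<phi> v) = 1"
  moreover have "v \<in> orbit A \<phi> v" by (rule orbit_refl) simp
  ultimately have "orbit A \<phi> v = {v}" by (metis card_1_singletonE singletonD)
  then have "\<forall>a\<in>carrier A. \<phi> a v = v" by (auto simp: orbit_def)
  then show False using fixed_points_trivial assms by auto
qed

lemma orbit_subset:
  assumes "\<forall>a\<in>carrier A. \<phi> a ` S \<subseteq> S" "v \<in> S"
  shows "orbit A \<phi> v \<subseteq> S"
  using assms by (auto simp: orbit_def)

text \<open>The complement of a stable half is again a stable half, and one of the two misses
  0.\<close>

lemma balanced_half: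
  assumes "balanced A \<phi>"
  obtains S where "\<forall>a\<in>carrier A. \<phi> a ` S \<subseteq> S" "0 \<notin> S" "2 * card S = card (UNIV :: 'v set)"
proof -
  obtain S where S: "\<forall>a\<in>carrier A. \<phi> a ` S \<subseteq> S" "2 * card S = card (UNIV :: 'v set)"
    using assms unfolding balanced_def by blast
  show ?thesis
  proof (cases "0 \<in> S")
    case True
    have "\<phi> a v \<in> - S" if "a \<in> carrier A" "v \<in> - S" for a v
    proof
      assume "\<phi> a v \<in> S"
      then have "\<phi> (inv\<^bsub>A\<^esub> a) (\<phi> a v) \<in> S"
        using S(1) group.inv_closed[OF group_A that(1)] by blast
      then show False using action_inv that by auto
    qed
    moreover have "2 * card (- S) = card (UNIV :: 'v set)"
      using S(2) card_Diff_subset[of S UNIV] by (simp add: Compl_eq_Diff_UNIV)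
    ultimately show ?thesis using that[of "- S"] True by auto
  next
    case False
    then show ?thesis using that S by blast
  qed
qed

text \<open>A stable half without 0 would have size divisible by \<open>p\<close>, yet twice its
  size is a power of 2.\<close>

lemma orbits_not_all_dvd:
  assumes "prime p" "\<And>v. v \<noteq> 0 \<Longrightarrow> p dvd card (orbit A \<phi> v)" "balanced A \<phi>"
  shows "p = 2"
proof -
  obtain S where S: "\<forall>a\<in>carrier A. \<phi> a ` S \<subseteq> S" "0 \<notin> S" "2 * card S = card (UNIV :: 'v set)"
    using balanced_half assms(3) by blast
  have "p dvd card S"
  proof (rule dvd_card_stable)
    show "p dvd card (orbit A \<phi> v)" if "v \<in> S" for v
      using assms(2)[of v] S(2) that by metis
  qed (use S(1) in auto)
  then have "p dvd 2 ^ dim UNIV"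
    using S(3) card_V by (metis dvd_mult)
  then show ?thesis
    using assms(1) prime_dvd_power by (metis two_is_prime_nat primes_dvd_imp_eq)
qed

text \<open>All nonzero orbits of a \<open>p\<close>-group have size divisible by \<open>p\<close>, hence so has an invariant
  half of \<open>V\<close> avoiding \<open>0\<close>.\<close>

lemma balanced_not_prime_power:
  assumes "balanced A \<phi>" "prime p"
  shows "Coset.order A \<noteq> p ^ a"
proof
  assume ord: "Coset.order A = p ^ a"
  have "p dvd card (orbit A \<phi> v)" if "v \<noteq> 0" for v
    using orbit_nontrivial[OF that] card_orbit_dvd[of v] ord assms(2)
    by (metis divides_primepow_nat dvd_power gr0I power_0)
  then have p2: "p = 2" using orbits_not_all_dvd assms by blast
  then have "a = 0" using ord odd_A by auto
  \<comment> \<open>Only the trivial group is left. It has no nonzero vector to act on, so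
    divisibility by 3 holds vacuously and gives the contradiction.\<close>
  then have "Coset.order A = 3 ^ 0" using ord by simp
  moreover have "prime (3 :: nat)" by simp
  ultimately have "3 dvd card (orbit A \<phi> v)" if "v \<noteq> 0" for v
    using orbit_nontrivial[OF that] card_orbit_dvd[of v] by simp
  then have "(3 :: nat) = 2" using orbits_not_all_dvd[OF \<open>prime 3\<close>] assms(1) by blast
  then show False by simp
qed

text \<open>15 is the least odd number that is not a prime power; order 1 is covered as
  \<open>p ^ 0\<close>.\<close>

lemma order_ge_15:
  assumes "balanced A \<phi>"
  shows "15 \<le> Coset.order A"
proof (rule ccontr)
  assume lt: "\<not> 15 \<le> Coset.order A"
  have "n = 1 \<or> n = 3 \<or> n = 5 \<or> n = 7 \<or> n = 9 \<or> n = 11 \<or> n = 13"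
    if "\<not> 15 \<le> n" "odd n" for n :: nat
    using that by presburger
  note cases = this[OF lt odd_A]
  have "prime (3::nat)" "prime (5::nat)" "prime (7::nat)" "prime (11::nat)" "prime (13::nat)"
    by simp_all
  note pp = this[THEN balanced_not_prime_power[OF assms]]
  have "Coset.order A \<noteq> 1" "Coset.order A \<noteq> 3" "Coset.order A \<noteq> 5" "Coset.order A \<noteq> 7"
    "Coset.order A \<noteq> 9" "Coset.order A \<noteq> 11" "Coset.order A \<noteq> 13"
    using pp(1)[of 0] pp(1)[of 1] pp(1)[of 2] pp(2)[of 1] pp(3)[of 1] pp(4)[of 1] pp(5)[of 1] by simp_all
  then show False using cases by auto
qed

section \<open>Fixed spaces of Sylow subgroups and the bound on the dimension\<close>

text \<open>\<open>C\<close> is the fixed space of a Sylow \<open>p\<close>-subgroup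
  \<open>P\<close>. A stable set is counted modulo \<open>p\<close> by its points in
  \<open>C\<close>. The orbit of a point of \<open>C\<close> meets \<open>C\<close> in an orbit of
  the normalizer of \<open>P\<close>, whose size divides the odd order of \<open>A\<close>.\<close>

lemma sylow_fixed_space:
  assumes "prime p" "p dvd card (orbit A \<phi> w)"
  obtains C k where
    "card C = 2 ^ k" "k < dim UNIV" "0 \<in> C" "[2 ^ dim UNIV = 2 ^ k] (mod p)"
    "\<And>S. \<forall>a\<in>carrier A. \<phi> a ` S \<subseteq> S \<Longrightarrow> [card S = card (S \<inter> C)] (mod p)"
    "\<And>u. u \<in> C \<Longrightarrow> odd (card (orbit A \<phi> u \<inter> C))"
proof -
  have "Coset.order A \<noteq> 0" using odd_A by (metis even_zero)
  then obtain a m where m: "Coset.order A = p ^ a * m" "\<not> p dvd m"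
    using assms(1) multiplicity_decompose'[of "Coset.order A" p] by (metis not_prime_unit)
  obtain P where P: "subgroup P A" "card P = p ^ a"
    using sylow_thm[OF assms(1) group_A m(1) finite_A] by blast
  have Psub: "P \<subseteq> carrier A" using P(1) by (simp add: subgroup.subset)
  interpret actP: group_action "A\<lparr>carrier := P\<rparr>" UNIV \<phi> by (rule induced_action[OF P(1)])
  define C where "C = {v. \<forall>x\<in>P. \<phi> x v = v}"
  have C: "subspace C" unfolding C_def by (rule subspace_fixed[OF Psub])
  have cong: "[card S = card (S \<inter> C)] (mod p)" if "\<forall>a\<in>carrier A. \<phi> a ` S \<subseteq> S" for S
  proof -
    have "[card S = card {x \<in> S. \<forall>g\<in>carrier (A\<lparr>carrier := P\<rparr>). \<phi> g x = x}] (mod p)"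
    proof (rule actP.card_cong_fixed[OF assms(1), where a = a])
      show "\<phi> g x \<in> S" if "g \<in> carrier (A\<lparr>carrier := P\<rparr>)" "x \<in> S" for g x
        using that Psub \<open>\<forall>a\<in>carrier A. \<phi> a ` S \<subseteq> S\<close> by auto
    qed (use P(2) in \<open>simp_all add: Coset.order_def\<close>)
    moreover have "{x \<in> S. \<forall>g\<in>carrier (A\<lparr>carrier := P\<rparr>). \<phi> g x = x} = S \<inter> C"
      by (auto simp: C_def)
    ultimately show ?thesis by simp
  qed
  \<comment> \<open>If \<open>P\<close> fixed all of \<open>V\<close>, it would lie in the
    stabilizer of \<open>w\<close>, and the size of the orbit of \<open>w\<close> would divide
    \<open>m\<close>, which is prime to \<open>p\<close>.\<close>
  have "dim C < dim UNIV"
  proof (rule ccontr)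
    assume "\<not> dim C < dim UNIV"
    then have "card (UNIV :: 'v set) \<le> card C" using card_subspace[OF C] card_V by simp
    then have "C = UNIV" by (simp add: card_seteq)
    then have PS: "P \<subseteq> stabilizer A \<phi> w" using Psub by (auto simp: C_def stabilizer_def)
    have st: "subgroup (stabilizer A \<phi> w) A" by (rule stabilizer_subgroup) simp
    have "subgroup P (A\<lparr>carrier := stabilizer A \<phi> w\<rparr>)"
      using group.subgroup_incl[OF group_A P(1) st PS] .
    then have "p ^ a dvd card (stabilizer A \<phi> w)"
      using group.lagrange[OF group.subgroup_imp_group[OF group_A st]] P(2)
      by (simp add: Coset.order_def) (metis dvd_triv_right)
    then obtain k where "card (stabilizer A \<phi> w) = p ^ a * k" by (auto simp: dvd_def)
    then have "card (orbit A \<phi> w) * k = m"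
      using orbit_stabilizer_theorem[of w] m(1) assms(1) by (simp add: prime_gt_0_nat)
    then show False using assms(2) m(2) by (metis dvd_mult2)
  qed
  moreover have "[2 ^ dim UNIV = 2 ^ dim C] (mod p)"
    using cong[of UNIV] card_subspace[OF C] card_V by simp
  moreover have "odd (card (orbit A \<phi> u \<inter> C))" if "u \<in> C" for u
  proof -
    have "card (orbit A \<phi> u \<inter> C) dvd Coset.order A"
      unfolding C_def
      by (rule card_orbit_Int_sylow_fixed_dvd[OF assms(1) finite_A P m]) (use that in \<open>auto simp: C_def\<close>)
    then show ?thesis using odd_A by (metis dvd_trans)
  qed
  ultimately show ?thesis
    using that[of C "dim C"] cong card_subspace[OF C] subspace_0[OF C] by blast
qed

text \<open>In dimension at most 6 the fixed space of a Sylow subgroup meets an invariant half of \<open>V\<close> in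
  1, 2 or 4 points; the orbits cut it into pieces of odd size, so one of the pieces is a point.\<close>

lemma isolated_fixed_point:
  assumes "prime p" "p dvd card (orbit A \<phi> w)" "p \<in> {5, 7, 31}"
    and "dim UNIV \<le> 6"
    and S: "\<forall>a\<in>carrier A. \<phi> a ` S \<subseteq> S" "0 \<notin> S" "2 * card S = card (UNIV :: 'v set)"
  obtains U where "U \<subseteq> S" "U \<noteq> {}" "p = 5 \<Longrightarrow> dim UNIV = 6 \<Longrightarrow> card U = 2"
    "\<And>u. u \<in> U \<Longrightarrow> [card (orbit A \<phi> u) = 1] (mod p)"
    "\<And>u v. u \<in> U \<Longrightarrow> v \<in> U \<Longrightarrow> u \<in> orbit A \<phi> v \<Longrightarrow> u = v"
proof -
  obtain C k where C: "card C = 2 ^ k" "k < dim UNIV" "0 \<in> C" "[2 ^ dim UNIV = 2 ^ k] (mod p)"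
    and cong: "\<And>S. \<forall>a\<in>carrier A. \<phi> a ` S \<subseteq> S \<Longrightarrow> [card S = card (S \<inter> C)] (mod p)"
    and odd: "\<And>u. u \<in> C \<Longrightarrow> odd (card (orbit A \<phi> u \<inter> C))"
    using sylow_fixed_space[OF assms(1,2)] by blast
  define d where "d = dim UNIV"
  define T where "T = S \<inter> C"
  have "T \<subset> C" using C(3) S(2) unfolding T_def by blast
  then have Tlt: "card T < 2 ^ k" using C(1) psubset_card_mono by (metis finite_set_V)
  have cS: "2 * card S = 2 ^ d" using S(3) card_V by (simp add: d_def)
  have cT: "[card S = card T] (mod p)" unfolding T_def by (rule cong[OF S(1)])
  have dk: "d \<le> 6" "k < d" "[2 ^ d = 2 ^ k] (mod p)" using C assms(4) by (simp_all add: d_def)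
  \<comment> \<open>The order of 2 modulo 5, 7, 31 is 4, 3, 5, and it divides \<open>d - k\<close>.
    Together with \<open>card T < 2 ^ k\<close> and \<open>card T\<close> congruent to
    \<open>2 ^ (d - 1)\<close> only these sizes survive.\<close>
  have "(p = 5 \<and> (d = 6 \<and> card T = 2 \<or> d < 6 \<and> card T = 1)) \<or> (p = 7 \<and> card T \<in> {1, 2, 4}) \<or> (p = 31 \<and> card T = 1)"
  proof -
    have "d \<in> {1,2,3,4,5,6}" "k \<in> {0,1,2,3,4,5}" using dk(1,2) by auto
    then show ?thesis
      using dk(2,3) assms(3) Tlt cS cT
      by (elim insertE emptyE; simp add: cong_def; presburger?)
  qed
  note cases = this
  have sub: "orbit A \<phi> u \<inter> C \<subseteq> T" if "u \<in> T" for u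
    using orbit_subset[OF S(1), of u] that by (auto simp: T_def)
  have self: "u \<in> orbit A \<phi> u" for u by (rule orbit_refl) simp
  \<comment> \<open>Otherwise every piece has at least 3 points. Then \<open>T\<close> has 4 points,
    one piece has 3 of them, and the piece of the remaining point does not fit.\<close>
  have one: "\<exists>u\<in>T. card (orbit A \<phi> u \<inter> C) = 1"
  proof (rule ccontr)
    assume none: "\<not> ?thesis"
    have ge3: "3 \<le> card (orbit A \<phi> u \<inter> C)" if "u \<in> T" for u
    proof -
      have "card (orbit A \<phi> u \<inter> C) \<noteq> 1" using none that by blast
      moreover have "odd (card (orbit A \<phi> u \<inter> C))" using odd that by (simp add: T_def)
      ultimately show ?thesis by (simp add: odd_ge_3)
    qed
    have "card T \<noteq> 0" "card T \<le> 4" using cases by auto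
    then obtain u where u: "u \<in> T" by fastforce
    define X where "X = orbit A \<phi> u \<inter> C"
    have X: "X \<subseteq> T" "3 \<le> card X" "odd (card X)"
      using sub[OF u] ge3[OF u] odd[of u] u by (simp_all add: X_def T_def)
    have "card X \<le> card T" using X(1) by (simp add: card_mono)
    moreover have "n = 3" if "odd n" "3 \<le> n" "n \<le> 4" for n :: nat
      using that by presburger
    ultimately have card: "card T = 4" "card X = 3" using X(2,3) cases \<open>card T \<le> 4\<close> by auto
    then have "X \<noteq> T" by auto
    then obtain v where v: "v \<in> T" "v \<notin> X" using X(1) by blast
    define Y where "Y = orbit A \<phi> v \<inter> C"
    have "X \<inter> Y = {}"
    proof (rule ccontr)
      assume "X \<inter> Y \<noteq> {}"
      then obtain x where "x \<in> orbit A \<phi> u" "x \<in> orbit A \<phi> v" by (auto simp: X_def Y_def)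
      then have "v \<in> orbit A \<phi> u" using orbit_sym orbit_trans by (metis UNIV_I)
      then show False using v by (simp add: X_def T_def)
    qed
    then have "card (X \<union> Y) = card X + card Y" by (simp add: card_Un_disjoint)
    moreover have "card (X \<union> Y) \<le> card T" using X(1) sub[OF v(1)] by (intro card_mono) (auto simp: Y_def)
    ultimately show False using card ge3[OF v(1)] by (simp add: Y_def)
  qed
  \<comment> \<open>The points that are alone in \<open>C\<close> on their orbit; by the congruence
    such an orbit has size 1 modulo \<open>p\<close>.\<close>
  define U where "U = {u \<in> T. card (orbit A \<phi> u \<inter> C) = 1}"
  show ?thesis
  proof (rule that[of U])
    show "U \<subseteq> S" "U \<noteq> {}" using one by (auto simp: U_def T_def)
    show "[card (orbit A \<phi> u) = 1] (mod p)" if u: "u \<in> U" for u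
    proof -
      have "\<phi> a ` orbit A \<phi> u \<subseteq> orbit A \<phi> u" if a: "a \<in> carrier A" for a
      proof
        fix x assume "x \<in> \<phi> a ` orbit A \<phi> u"
        then obtain y where y: "y \<in> orbit A \<phi> u" "x = \<phi> a y" by blast
        then have "x \<in> orbit A \<phi> y" using a unfolding orbit_def by blast
        then show "x \<in> orbit A \<phi> u" using orbit_trans[of u y x] y(1) by simp
      qed
      then show ?thesis using cong[of "orbit A \<phi> u"] u by (simp add: U_def)
    qed
    show "u = v" if "u \<in> U" "v \<in> U" "u \<in> orbit A \<phi> v" for u v
    proof -
      have "card (orbit A \<phi> v \<inter> C) = 1" "{u, v} \<subseteq> orbit A \<phi> v \<inter> C"
        using that self by (auto simp: U_def T_def)
      then show ?thesis by (metis card_1_singletonE insert_subset singletonD)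
    qed
    show "card U = 2" if "p = 5" "dim UNIV = 6"
    proof -
      have T2: "card T = 2" using that cases by (auto simp: d_def)
      have "card (orbit A \<phi> u \<inter> C) = 1" if u: "u \<in> T" for u
      proof -
        have "card (orbit A \<phi> u \<inter> C) \<le> 2" using sub[OF u] T2 by (metis card_mono finite_set_V)
        moreover have "odd (card (orbit A \<phi> u \<inter> C))" using odd u by (simp add: T_def)
        ultimately show ?thesis using odd_ge_3[of "card (orbit A \<phi> u \<inter> C)"] by linarith
      qed
      then have "U = T" by (auto simp: U_def)
      then show ?thesis using T2 by simp
    qed
  qed
qed

text \<open>As \<open>p\<close> is odd, cancelling \<open>2 ^ k\<close> leaves
  \<open>p dvd 2 ^ e - 1\<close> with \<open>1 \<le> e \<le> 6\<close>; the numbers 1, 3, 7, 15, 31,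
  63 have only the prime factors 3, 5, 7, 31.\<close>

lemma orbit_prime_cases:
  assumes "prime p" "p dvd card (orbit A \<phi> w)" "dim UNIV \<le> 6"
  shows "p \<in> {3, 5, 7, 31}"
proof -
  obtain k where k: "k < dim UNIV" "[2 ^ dim UNIV = 2 ^ k] (mod p)"
    using sylow_fixed_space[OF assms(1,2)] by metis
  define e where "e = dim UNIV - k"
  have e: "e \<in> {1,2,3,4,5,6}" using k(1) assms(3) by (auto simp: e_def)
  have "p \<noteq> 2" using odd_card_orbit[of w] assms(2) by auto
  have eq: "(2 :: nat) ^ dim UNIV = 2 ^ k * 2 ^ e" using k(1) by (simp add: e_def flip: power_add)
  have "[2 ^ k * 2 ^ e = 2 ^ k * 1] (mod p)" using k(2) eq by simp
  moreover have "coprime (2 ^ k) p"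
    using \<open>p \<noteq> 2\<close> assms(1) by (metis coprime_power_left_iff primes_coprime two_is_prime_nat)
  ultimately have "[2 ^ e = 1] (mod p)" using cong_mult_lcancel_nat by blast
  then have "[1 = 2 ^ e] (mod p)" by (rule cong_sym)
  then have dvd: "p dvd 2 ^ e - 1" using cong_altdef_nat[of 1 "2 ^ e" p] by (simp add: cong_sym_eq)
  have "p dvd 3 \<or> p dvd 5 \<or> p dvd 7 \<or> p dvd 31"
  proof -
    have f: "p dvd 15 \<longleftrightarrow> p dvd 3 \<or> p dvd 5" "p dvd 63 \<longleftrightarrow> p dvd 3 \<or> p dvd 7"
      using prime_dvd_mult_nat[OF assms(1), of 3 5] prime_dvd_mult_nat[OF assms(1), of 9 7]
        prime_dvd_mult_nat[OF assms(1), of 3 3] by auto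
    have "p \<noteq> 1" using assms(1) by auto
    then show ?thesis using e dvd f by auto
  qed
  moreover have "prime (3::nat)" "prime (5::nat)" "prime (7::nat)" "prime (31::nat)" by simp_all
  ultimately show ?thesis using assms(1) primes_dvd_imp_eq by blast
qed

text \<open>A stable half without 0 has at most 32 points, on orbits of odd size other than 1.
  Excluding 31, 5 and 7 in this order makes 3 a common divisor of all nonzero orbit sizes, which is
  impossible.\<close>

lemma balanced_dim_ge_7:
  assumes "balanced A \<phi>"
  shows "7 \<le> dim UNIV"
proof (rule ccontr)
  assume "\<not> 7 \<le> dim UNIV"
  then have d6: "dim UNIV \<le> 6" by simp
  obtain S where S: "\<forall>a\<in>carrier A. \<phi> a ` S \<subseteq> S" "0 \<notin> S" "2 * card S = card (UNIV :: 'v set)"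
    using balanced_half assms by blast
  have "2 * card S \<le> 2 ^ 6" using S(3) card_V d6 power_increasing[of "dim UNIV" 6 "2::nat"] by simp
  then have S32: "card S \<le> 32" by simp
  have orb: "odd (card (orbit A \<phi> u))" "card (orbit A \<phi> u) \<noteq> 1" "card (orbit A \<phi> u) \<le> 32" if "u \<in> S" for u
  proof -
    show "odd (card (orbit A \<phi> u))" by (rule odd_card_orbit)
    show "card (orbit A \<phi> u) \<noteq> 1" using orbit_nontrivial S(2) that by metis
    show "card (orbit A \<phi> u) \<le> 32" using orbit_subset[OF S(1) that] S32 card_mono[of S] by (meson finite_set_V le_trans)
  qed
  have no_prime: "\<not> p dvd card (orbit A \<phi> w)" if "prime p" "p \<notin> {3, 5, 7, 31}" for p w
    using orbit_prime_cases that d6 by blast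
  \<comment> \<open>Up to 32 only 1 and 32 are congruent to 1 modulo 31, and neither is an odd size
    other than 1.\<close>
  have no31: "\<not> 31 dvd card (orbit A \<phi> w)" for w
  proof
    assume w: "31 dvd card (orbit A \<phi> w)"
    have pr: "prime (31 :: nat)" by simp
    obtain U where U: "U \<subseteq> S" "U \<noteq> {}" "\<And>u. u \<in> U \<Longrightarrow> [card (orbit A \<phi> u) = 1] (mod 31)"
      by (rule isolated_fixed_point[OF pr w _ d6 S]) (simp, use that in blast)
    obtain u where "u \<in> U" using U(2) by blast
    then have u: "u \<in> S" "[card (orbit A \<phi> u) = 1] (mod 31)" using U(1,3) by auto
    have "False" if n: "odd n" "n \<noteq> 1" "n \<le> 32" "n mod 31 = 1" for n :: nat
    proof -
      obtain q where q: "n = 31 * q + 1" using n(4) by (metis mult_div_mod_eq)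
      then have "q = 0 \<or> q = 1" using n(3) by linarith
      then show ?thesis using q n(1,2) by auto
    qed
    then show False using orb[OF u(1)] u(2) by (simp add: cong_def)
  qed
  have no5: "\<not> 5 dvd card (orbit A \<phi> w)" for w
  proof
    assume w: "5 dvd card (orbit A \<phi> w)"
    have pr: "prime (5 :: nat)" by simp
    obtain U where U: "U \<subseteq> S" "U \<noteq> {}" "dim UNIV = 6 \<Longrightarrow> card U = 2"
      "\<And>u. u \<in> U \<Longrightarrow> [card (orbit A \<phi> u) = 1] (mod 5)"
      "\<And>u v. u \<in> U \<Longrightarrow> v \<in> U \<Longrightarrow> u \<in> orbit A \<phi> v \<Longrightarrow> u = v"
      by (rule isolated_fixed_point[OF pr w _ d6 S]) (simp, use that in blast)
    \<comment> \<open>The candidates are 11, 21 and 31; the primes 11 and 31 divide no orbit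
      size.\<close>
    have c21: "card (orbit A \<phi> u) = 21" if u: "u \<in> U" for u
    proof -
      have "\<not> 11 dvd card (orbit A \<phi> u)" by (rule no_prime) simp_all
      then have "card (orbit A \<phi> u) \<noteq> 11" "card (orbit A \<phi> u) \<noteq> 31" using no31[of u] by auto
      moreover have "card (orbit A \<phi> u) mod 5 = 1" using U(4)[OF u] by (simp add: cong_def)
      moreover have "u \<in> S" using U(1) u by blast
      note orb[OF this]
      moreover have "n = 11 \<or> n = 21 \<or> n = 31" if "odd n" "n \<noteq> 1" "n \<le> 32" "n mod 5 = 1" for n :: nat
        using that by presburger
      ultimately show ?thesis by blast
    qed
    obtain u where u: "u \<in> U" using U(2) by blast
    have "21 \<le> card S" using c21[OF u] orbit_subset[OF S(1), of u] u U(1)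
      by (metis card_mono finite_set_V subsetD)
    \<comment> \<open>A half with at least 21 points needs more than \<open>2 ^ 5\<close> vectors.
      In dimension 6 there is a second point in \<open>U\<close>, and two disjoint orbits of size 21
      exceed 32.\<close>
    then have "dim UNIV = 6"
    proof -
      have "2 ^ 5 < (2 :: nat) ^ dim UNIV" using \<open>21 \<le> card S\<close> S(3) card_V by simp
      then have "5 < dim UNIV" by (rule power_less_imp_less_exp[rotated]) simp
      then show ?thesis using d6 by simp
    qed
    then have "card U = 2" using U(3) by simp
    then obtain v where v: "v \<in> U" "v \<noteq> u" using u by (metis card_2_iff' )
    have "orbit A \<phi> u \<inter> orbit A \<phi> v = {}"
    proof (rule ccontr)
      assume "\<not> ?thesis"
      then obtain x where "x \<in> orbit A \<phi> u" "x \<in> orbit A \<phi> v" by blast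
      then have "v \<in> orbit A \<phi> u" using orbit_sym orbit_trans by (metis UNIV_I)
      then show False using U(5) u v by blast
    qed
    then have "card (orbit A \<phi> u \<union> orbit A \<phi> v) = 42" using c21 u v by (simp add: card_Un_disjoint)
    moreover have "orbit A \<phi> u \<union> orbit A \<phi> v \<subseteq> S" using orbit_subset[OF S(1)] u v(1) U(1) by blast
    then have "card (orbit A \<phi> u \<union> orbit A \<phi> v) \<le> card S" by (simp add: card_mono)
    ultimately show False using S32 by simp
  qed
  have no7: "\<not> 7 dvd card (orbit A \<phi> w)" for w
  proof
    assume w: "7 dvd card (orbit A \<phi> w)"
    have pr: "prime (7 :: nat)" by simp
    obtain U where U: "U \<subseteq> S" "U \<noteq> {}" "\<And>u. u \<in> U \<Longrightarrow> [card (orbit A \<phi> u) = 1] (mod 7)"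
      by (rule isolated_fixed_point[OF pr w _ d6 S]) (simp, use that in blast)
    obtain u where "u \<in> U" using U(2) by blast
    then have u: "u \<in> S" "[card (orbit A \<phi> u) = 1] (mod 7)" using U(1,3) by auto
    \<comment> \<open>Only 15 and 29 remain: the first is divisible by the excluded 5, the second is
      a prime outside the list.\<close>
    have "\<not> 29 dvd card (orbit A \<phi> u)" by (rule no_prime) simp_all
    then have "card (orbit A \<phi> u) \<noteq> 29" "card (orbit A \<phi> u) \<noteq> 15" using no5[of u] by auto
    moreover have "n = 29 \<or> n = 15" if "odd n" "n \<noteq> 1" "n \<le> 32" "n mod 7 = 1" for n :: nat
      using that by presburger
    moreover have "card (orbit A \<phi> u) mod 7 = 1" using u(2) by (simp add: cong_def)
    ultimately show False using orb[OF u(1)] by blast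
  qed
  have "3 dvd card (orbit A \<phi> v)" if v: "v \<noteq> 0" for v
  proof -
    obtain p where p: "prime p" "p dvd card (orbit A \<phi> v)"
      using prime_factor_nat[OF orbit_nontrivial[OF v]] by blast
    then have "p \<in> {3, 5, 7, 31}" using orbit_prime_cases d6 by blast
    then show ?thesis using p no31 no5 no7 by auto
  qed
  moreover have "prime (3 :: nat)" by simp
  ultimately have "(3 :: nat) = 2" using orbits_not_all_dvd assms by blast
  then show False by simp
qed

end

section \<open>Balanced pairs of dimensions 7 and 8\<close>

instance bit :: finite
proof
  have "(UNIV :: bit set) = {0, 1}" by (auto intro: bit.exhaust)
  then show "finite (UNIV :: bit set)" by (metis finite.emptyI finite.insertI)
qed

lemma card_bit [simp]: "CARD(bit) = 2"
proof -
  have "(UNIV :: bit set) = {0, 1}" by (auto intro: bit.exhaust)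
  then show ?thesis unfolding card_2_iff using zero_neq_one by blast
qed

section \<open>Cyclic groups acting by the powers of one linear map\<close>

definition cyclic :: "nat \<Rightarrow> nat monoid" where
  "cyclic n = \<lparr>carrier = {..<n}, monoid.mult = (\<lambda>a b. (a + b) mod n), one = 0\<rparr>"

lemma group_cyclic: "0 < n \<Longrightarrow> group (cyclic n)"
proof (rule groupI)
  fix x assume "0 < n" "x \<in> carrier (cyclic n)"
  then show "\<exists>y\<in>carrier (cyclic n). y \<otimes>\<^bsub>cyclic n\<^esub> x = \<one>\<^bsub>cyclic n\<^esub>"
    \<comment> \<open>The reduction modulo \<open>n\<close> matters for \<open>x = 0\<close>, where
      \<open>n - x\<close> is outside the carrier.\<close>
    by (intro bexI[of _ "(n - x) mod n"]) (auto simp: cyclic_def mod_simps)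
qed (auto simp: cyclic_def mod_simps add.assoc)

lemma funpow_mod: "f ^^ n = id \<Longrightarrow> f ^^ (m mod n) = f ^^ m"
proof -
  assume f: "f ^^ n = id"
  have "f ^^ m = f ^^ (n * (m div n) + m mod n)" by simp
  also have "\<dots> = (f ^^ n) ^^ (m div n) \<circ> f ^^ (m mod n)" by (simp only: funpow_add funpow_mult)
  also have "\<dots> = f ^^ (m mod n)" using f by simp
  finally show ?thesis by simp
qed

text \<open>With scalars 0 and 1 only, additivity already is linearity; and a vector fixed by the
  whole group is fixed by the generator \<open>g\<close>.\<close>

lemma F2_pair_cyclic:
  fixes g :: "bit ^ 'n \<Rightarrow> bit ^ 'n"
  assumes "odd n" "1 < n" "\<And>v w. g (v + w) = g v + g w" "g ^^ n = id" "\<And>v. g v = v \<Longrightarrow> v = 0"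
  shows "F2_pair (*s) (cyclic n) (\<lambda>a. g ^^ a)"
proof -
  have inverse: "g ^^ a \<circ> g ^^ (n - a) = id" "g ^^ (n - a) \<circ> g ^^ a = id" if "a < n" for a
    using that assms(4) by (simp_all flip: funpow_add)
  have Bij: "g ^^ a \<in> Bij UNIV" if "a < n" for a
    using inverse[OF that] by (simp add: Bij_def o_bij)
  have add: "(g ^^ a) (v + w) = (g ^^ a) v + (g ^^ a) w" for a v w
    by (induction a) (simp_all add: assms(3))
  have vs: "vector_space ((*s) :: bit \<Rightarrow> bit ^ 'n \<Rightarrow> bit ^ 'n)"
    by unfold_locales
  have "group_hom (cyclic n) (BijGroup UNIV) (\<lambda>a. g ^^ a)"
      unfolding group_hom_def group_hom_axioms_def
    proof (intro conjI group_cyclic group_BijGroup homI)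
      fix a b assume "a \<in> carrier (cyclic n)" "b \<in> carrier (cyclic n)"
      then show "g ^^ (a \<otimes>\<^bsub>cyclic n\<^esub> b) = g ^^ a \<otimes>\<^bsub>BijGroup UNIV\<^esub> g ^^ b"
        using Bij by (auto simp: cyclic_def BijGroup_def funpow_mod[OF assms(4)] funpow_add compose_def fun_eq_iff)
    qed (use assms(2) Bij in \<open>auto simp: cyclic_def BijGroup_def\<close>)
  then have action: "group_action (cyclic n) UNIV (\<lambda>a. g ^^ a)"
    by (simp add: group_action_def)
  show ?thesis
  proof (intro F2_pair.intro F2_pair_axioms.intro vs action)
    show "finite (UNIV :: (bit ^ 'n) set)" by simp
    show "finite (carrier (cyclic n))" "odd (Coset.order (cyclic n))"
      using assms(1) by (simp_all add: cyclic_def Coset.order_def)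
    show "Vector_Spaces.linear (*s) (*s) (g ^^ a)" for a
    proof -
      have "(g ^^ a) 0 = 0" using add[of a 0 0] by simp
      then have "(g ^^ a) (c *s v) = c *s (g ^^ a) v" for c v by (cases c) simp_all
      then show ?thesis using add by (simp add: Vector_Spaces.linear_iff vs)
    qed
    have "v = 0" if "\<forall>a\<in>carrier (cyclic n). (g ^^ a) v = v" for v
      using that[rule_format, of 1] assms(2,5) by (simp add: cyclic_def)
    moreover have "(g ^^ a) 0 = 0" for a using add[of a 0 0] by simp
    ultimately show "{v. \<forall>a\<in>carrier (cyclic n). (g ^^ a) v = v} = {0}" by auto
  qed
qed

text \<open>The pair is written down on a product of fields \<open>'w\<close> and moved to \<open>bit ^ 'n\<close>
  by means of the coordinates \<open>c\<close>.\<close>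

lemma cyclic_balanced_pair:
  fixes f :: "'w::{ab_group_add,finite} \<Rightarrow> 'w" and c :: "'w \<Rightarrow> nat \<Rightarrow> bit"
  assumes "odd n" "1 < n" "\<And>v w. f (v + w) = f v + f w" "f ^^ n = id" "\<And>v. f v = v \<Longrightarrow> v = 0"
    and "f ` S \<subseteq> S" "2 * card S = CARD('w)"
    and "\<And>v w k. k < CARD('n) \<Longrightarrow> c (v + w) k = c v k + c w k"
    and "\<And>v w. (\<And>k. k < CARD('n) \<Longrightarrow> c v k = c w k) \<Longrightarrow> v = w"
    and "CARD('w) = 2 ^ CARD('n)"
  shows "\<exists>(A :: nat monoid) (\<phi> :: nat \<Rightarrow> bit ^ 'n \<Rightarrow> bit ^ 'n).
    F2_pair (*s) A \<phi> \<and> balanced A \<phi> \<and> Coset.order A = n"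
proof -
  \<comment> \<open>An enumeration of the index type \<open>'n\<close> turns the numbered
    coordinates \<open>c v k\<close> into the components of a vector.\<close>
  obtain e where e: "bij_betw e {0..<CARD('n)} (UNIV :: 'n set)"
    using ex_bij_betw_nat_finite[of "UNIV :: 'n set"] by auto
  define e' where "e' = the_inv_into {0..<CARD('n)} e"
  have e': "bij_betw e' UNIV {0..<CARD('n)}"
    unfolding e'_def by (rule bij_betw_the_inv_into[OF e])
  define F :: "'w \<Rightarrow> bit ^ 'n" where "F v = (\<chi> i. c v (e' i))" for v
  have lt: "e' i < CARD('n)" for i using e' by (auto simp: bij_betw_def)
  have add: "F (v + w) = F v + F w" for v w
    by (simp add: F_def Finite_Cartesian_Product.vec_eq_iff assms(8) lt)
  have "inj F"
  proof (rule injI)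
    fix v w assume eq: "F v = F w"
    show "v = w"
    proof (rule assms(9))
      fix k assume "k < CARD('n)"
      then have "k \<in> range e'" using e' by (auto simp: bij_betw_def)
      then obtain i where "k = e' i" by blast
      then show "c v k = c w k" using eq by (simp add: F_def Finite_Cartesian_Product.vec_eq_iff)
    qed
  qed
  moreover have "CARD(bit ^ 'n) = CARD('w)" using assms(10) by simp
  ultimately have bij: "bij F"
    by (simp add: bij_betw_def card_subset_eq card_image)
  define g where "g = F \<circ> f \<circ> inv_into UNIV F"
  have invF [simp]: "inv_into UNIV F (F v) = v" "F (inv_into UNIV F u) = u" for u v
    using bij by (simp_all add: bij_is_inj bij_is_surj surj_f_inv_f)
  have pow: "g ^^ a = F \<circ> f ^^ a \<circ> inv_into UNIV F" for a
    by (induction a) (auto simp: g_def fun_eq_iff)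
  have "inv_into UNIV F (u + v) = inv_into UNIV F u + inv_into UNIV F v" for u v
    using add[of "inv_into UNIV F u" "inv_into UNIV F v"] by (metis invF)
  then have "g (u + v) = g u + g v" for u v
    by (simp add: g_def add assms(3))
  moreover have "g ^^ n = id" by (simp add: pow assms(4) fun_eq_iff)
  moreover have "v = 0" if "g v = v" for v
  proof -
    have "f (inv_into UNIV F v) = inv_into UNIV F v" using that by (metis g_def comp_apply invF(1))
    then have "inv_into UNIV F v = 0" by (rule assms(5))
    moreover have "F 0 = 0" using add[of 0 0] by simp
    ultimately show ?thesis by (metis invF(2))
  qed
  ultimately have pair: "F2_pair (*s) (cyclic n) (\<lambda>a. g ^^ a)"
    using assms(1,2) by (intro F2_pair_cyclic)
  have "(f ^^ a) ` S \<subseteq> S" for a using assms(6) by (induction a) auto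
  then have "(g ^^ a) ` (F ` S) \<subseteq> F ` S" for a by (force simp: pow)
  moreover have "2 * card (F ` S) = CARD(bit ^ 'n)"
    using assms(7,10) bij by (simp add: card_image bij_is_inj inj_on_subset[OF bij_is_inj])
  ultimately have "balanced (cyclic n) (\<lambda>a. g ^^ a)"
    unfolding balanced_def by blast
  moreover have "Coset.order (cyclic n) = n" by (simp add: cyclic_def Coset.order_def)
  ultimately show ?thesis using pair by blast
qed

text \<open>Multiplication by a generator of \<open>\<F>\<^sub>4\<close>, of \<open>\<F>\<^sub>8\<close>, and by an element of order 5 of
  \<open>\<F>\<^sub>1\<^sub>6\<close> (a cyclic shift of the vectors of even weight and length 5).\<close>

definition f4 :: "bit \<times> bit \<Rightarrow> bit \<times> bit" where "f4 = (\<lambda>(a, b). (b, a + b))"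
definition f8 :: "bit \<times> bit \<times> bit \<Rightarrow> bit \<times> bit \<times> bit" where "f8 = (\<lambda>(a, b, c). (b, c, a + b))"
definition f16 :: "bit \<times> bit \<times> bit \<times> bit \<Rightarrow> bit \<times> bit \<times> bit \<times> bit" where
  "f16 = (\<lambda>(a, b, c, d). (b, c, d, a + b + c + d))"

lemma f4_f8_f16_add:
  "f4 (v + w) = f4 v + f4 w" "f8 (x + y) = f8 x + f8 y" "f16 (s + t) = f16 s + f16 t"
  by (simp_all add: f4_def f8_def f16_def split_beta ac_simps del: add_bit_eq_xor)

lemma f4_f8_f16_pow: "f4 ^^ 3 = id" "f8 ^^ 7 = id" "f16 ^^ 5 = id"
proof -
  show "f4 ^^ 3 = id"
  proof (rule ext, clarify)
    fix a b show "(f4 ^^ 3) (a, b) = id (a, b)"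
      by (cases a; cases b; simp add: f4_def eval_nat_numeral)
  qed
  show "f8 ^^ 7 = id"
  proof (rule ext, clarify)
    fix a b c show "(f8 ^^ 7) (a, b, c) = id (a, b, c)"
      by (cases a; cases b; cases c; simp add: f8_def eval_nat_numeral)
  qed
  show "f16 ^^ 5 = id"
  proof (rule ext, clarify)
    fix a b c d show "(f16 ^^ 5) (a, b, c, d) = id (a, b, c, d)"
      by (cases a; cases b; cases c; cases d; simp add: f16_def eval_nat_numeral)
  qed
qed

lemma f4_f8_f16_fixed: "f4 v = v \<Longrightarrow> v = 0" "f8 x = x \<Longrightarrow> x = 0" "f16 s = s \<Longrightarrow> s = 0"
proof -
  show "f4 v = v \<Longrightarrow> v = 0"
    by (cases v; cases "fst v"; cases "snd v"; simp add: f4_def zero_prod_def)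
  show "f8 x = x \<Longrightarrow> x = 0"
  proof (cases x)
    fix a b c assume "f8 x = x" "x = (a, b, c)"
    then show ?thesis by (cases a; cases b; cases c; simp add: f8_def zero_prod_def)
  qed
  show "f16 s = s \<Longrightarrow> s = 0"
  proof (cases s)
    fix a b c d assume "f16 s = s" "s = (a, b, c, d)"
    then show ?thesis by (cases a; cases b; cases c; cases d; simp add: f16_def zero_prod_def)
  qed
qed

text \<open>An additive map with some power equal to the identity is injective.\<close>

lemma f4_f8_f16_zero_iff: "f4 v = 0 \<longleftrightarrow> v = 0" "f8 x = 0 \<longleftrightarrow> x = 0" "f16 s = 0 \<longleftrightarrow> s = 0"
proof -
  have *: "f z = 0 \<longleftrightarrow> z = 0" if "\<And>u w. f (u + w) = f u + f w" "f ^^ Suc n = id" for f :: "'a::ab_group_add \<Rightarrow> 'a" and n z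
  proof
    have z: "f 0 = 0" using that(1)[of 0 0] by simp
    then show "z = 0 \<Longrightarrow> f z = 0" by simp
    assume "f z = 0"
    moreover have "(f ^^ n) 0 = 0" using z by (induction n) simp_all
    ultimately have "(f ^^ Suc n) z = 0" by (simp only: funpow_Suc_right comp_apply)
    then show "z = 0" using that(2) by (metis id_apply)
  qed
  show "f4 v = 0 \<longleftrightarrow> v = 0" "f8 x = 0 \<longleftrightarrow> x = 0" "f16 s = 0 \<longleftrightarrow> s = 0"
    using *[of f4 2] *[of f8 6] *[of f16 4] f4_f8_f16_add f4_f8_f16_pow by (simp_all del: funpow.simps)
qed

lemma map_prod_funpow: "map_prod f g ^^ n = map_prod (f ^^ n) (g ^^ n)" for f :: "'a \<Rightarrow> 'a" and g :: "'b \<Rightarrow> 'b"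
  by (induction n) (auto simp: fun_eq_iff)

lemma funpow_eq_id_dvd: "f ^^ m = id \<Longrightarrow> m dvd n \<Longrightarrow> f ^^ n = id"
  by (auto simp flip: funpow_mult elim!: dvdE)

lemma lessThan_7_8: "k < 7 \<longleftrightarrow> k \<in> {0, 1, 2, 3, 4, 5, 6}" "k < 8 \<longleftrightarrow> k \<in> {0, 1, 2, 3, 4, 5, 6, 7}" for k :: nat
  by auto

section \<open>The two explicit pairs\<close>

lemma balanced_pair_7:
  "\<exists>(A :: nat monoid) (\<phi> :: nat \<Rightarrow> bit ^ 7 \<Rightarrow> bit ^ 7).
    F2_pair (*s) A \<phi> \<and> balanced A \<phi> \<and> Coset.order A = 21"
proof (rule cyclic_balanced_pair)
  let ?f = "map_prod f8 (map_prod f4 f4)"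
  let ?N = "(- {0 :: bit \<times> bit \<times> bit}) \<times> (- {0 :: bit \<times> bit}) \<times> (- {0 :: bit \<times> bit})"
  let ?c = "\<lambda>((a, b, c), (d, e), (h, k)) i. [a, b, c, d, e, h, k] ! i"
  show "?f (v + w) = ?f v + ?f w" for v w
    by (simp add: map_prod_def split_beta f4_f8_f16_add)
  show "?f ^^ 21 = id"
    using f4_f8_f16_pow(1,2)[THEN funpow_eq_id_dvd, of 21]
    by (simp only: map_prod_funpow) (simp add: map_prod.id)
  show "v = 0" if "?f v = v" for v
    using that f4_f8_f16_fixed by (auto simp: map_prod_def split_beta prod_eq_iff)
  have f0: "?f 0 = 0"
    by (simp add: zero_prod_def f4_def f8_def)
  \<comment> \<open>Each component map is injective, so nonzero coordinates stay nonzero.\<close>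
  have fN: "?f (x, y, z) \<in> ?N" if "(x, y, z) \<in> ?N" for x y z
    using that by (simp add: f4_f8_f16_zero_iff del: bit_not_zero_iff)
  show "?f ` (insert 0 ?N) \<subseteq> insert 0 ?N"
  proof (rule image_subsetI)
    fix v assume v: "v \<in> insert 0 ?N"
    show "?f v \<in> insert 0 ?N"
    proof (cases "v = 0")
      case True
      then show ?thesis using f0 by simp
    next
      case False
      obtain x y z where "v = (x, y, z)" by (metis surj_pair)
      then show ?thesis using v False fN[of x y z] by simp
    qed
  qed
  \<comment> \<open>Thus 0 is counted separately and completes 63 to 64, half of 128.\<close>
  have "0 \<notin> ?N" by (auto simp: zero_prod_def)
  then show "2 * card (insert 0 ?N) = CARD((bit \<times> bit \<times> bit) \<times> (bit \<times> bit) \<times> (bit \<times> bit))"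
    by (simp add: card_cartesian_product card_Diff_subset Compl_eq_Diff_UNIV)
  show "?c (v + w) k = ?c v k + ?c w k" if "k < CARD(7)" for v w k
    using that by (auto simp: lessThan_7_8 split_beta nth_Cons' simp del: add_bit_eq_xor)
  show "v = w" if eq: "\<And>k. k < CARD(7) \<Longrightarrow> ?c v k = ?c w k" for v w
  proof -
    obtain a b c d e h k where v: "v = ((a, b, c), (d, e), (h, k))" by (metis surj_pair)
    obtain a' b' c' d' e' h' k' where w: "w = ((a', b', c'), (d', e'), (h', k'))" by (metis surj_pair)
    show ?thesis using eq[of 0] eq[of 1] eq[of 2] eq[of 3] eq[of 4] eq[of 5] eq[of 6] by (simp add: v w)
  qed
qed simp_all

lemma balanced_pair_8:
  "\<exists>(A :: nat monoid) (\<phi> :: nat \<Rightarrow> bit ^ 8 \<Rightarrow> bit ^ 8).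
    F2_pair (*s) A \<phi> \<and> balanced A \<phi> \<and> Coset.order A = 15"
proof (rule cyclic_balanced_pair)
  let ?f = "map_prod f16 (map_prod f4 f4)"
  \<comment> \<open>With the sum of the four entries appended as a fifth, these are the words of
    weight 4, a single orbit of \<open>f16\<close>. The ten words of weight 2 are the other nonzero
    vectors.\<close>
  let ?X = "{(1,1,1,1), (1,1,1,0), (1,1,0,1), (1,0,1,1), (0,1,1,1)} :: (bit \<times> bit \<times> bit \<times> bit) set"
  let ?Z = "{0} :: (bit \<times> bit) set"
  \<comment> \<open>The three disjoint stable pieces have 120, 3 and 5 elements; the last two supply
    the 8 that the first lacks to half of 256.\<close>
  let ?S = "(- insert 0 ?X) \<times> UNIV \<times> (- ?Z) \<union> {0} \<times> (- ?Z) \<times> ?Z \<union> ?X \<times> ?Z \<times> ?Z"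
  let ?c = "\<lambda>((a, b, c, l), (d, e), (h, k)) i. [a, b, c, l, d, e, h, k] ! i"
  show "?f (v + w) = ?f v + ?f w" for v w
    by (simp add: map_prod_def split_beta f4_f8_f16_add)
  show "?f ^^ 15 = id"
    using f4_f8_f16_pow(1,3)[THEN funpow_eq_id_dvd, of 15]
    by (simp only: map_prod_funpow) (simp add: map_prod.id)
  show "v = 0" if "?f v = v" for v
    using that f4_f8_f16_fixed by (auto simp: map_prod_def split_beta prod_eq_iff)
  have X: "f16 x \<in> ?X \<longleftrightarrow> x \<in> ?X" for x
  proof (cases x)
    fix a b c d assume "x = (a, b, c, d)"
    then show ?thesis by (cases a; cases b; cases c; cases d; simp add: f16_def)
  qed
  have fS: "?f (x, y, z) \<in> ?S" if "(x, y, z) \<in> ?S" for x y z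
    using that X[of x] f4_f8_f16_zero_iff(1)[of y] f4_f8_f16_zero_iff(1)[of z] f4_f8_f16_zero_iff(3)[of x]
    \<comment> \<open>Only the outer \<open>insert 0\<close> is unfolded; membership in
      \<open>?X\<close> stays whole, so that the equivalence \<open>X\<close> applies to it.\<close>
    by (simp only: map_prod_simp mem_Times_iff fst_conv snd_conv Un_iff Compl_iff insert_iff[of _ 0] singleton_iff UNIV_I)
  show "?f ` ?S \<subseteq> ?S"
  proof (rule image_subsetI)
    fix v assume v: "v \<in> ?S"
    obtain x y z where "v = (x, y, z)" by (metis surj_pair)
    then show "?f v \<in> ?S" using v fS[of x y z] by (simp only:)
  qed
  have zX: "0 \<notin> ?X" by (simp add: zero_prod_def)
  then have "card (- insert 0 ?X) = 10"
    by (simp add: card_Diff_subset Compl_eq_Diff_UNIV)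
  then have "card ((- insert 0 ?X) \<times> (UNIV :: (bit \<times> bit) set) \<times> (- ?Z)) = 120"
    "card ({0 :: bit \<times> bit \<times> bit \<times> bit} \<times> (- ?Z) \<times> ?Z) = 3" "card (?X \<times> ?Z \<times> ?Z) = 5"
    by (simp_all add: card_cartesian_product card_Diff_subset Compl_eq_Diff_UNIV)
  moreover have "card (U \<union> V \<union> W) = card U + card V + card W"
    if "U \<inter> V = {}" "(U \<union> V) \<inter> W = {}" for U V W :: "((bit \<times> bit \<times> bit \<times> bit) \<times> (bit \<times> bit) \<times> (bit \<times> bit)) set"
    using that by (simp add: card_Un_disjoint)
  note this[of "(- insert 0 ?X) \<times> UNIV \<times> (- ?Z)" "{0} \<times> (- ?Z) \<times> ?Z" "?X \<times> ?Z \<times> ?Z"]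
  moreover have "(- insert 0 ?X) \<times> UNIV \<times> (- ?Z) \<inter> {0} \<times> (- ?Z) \<times> ?Z = {}"
    "((- insert 0 ?X) \<times> UNIV \<times> (- ?Z) \<union> {0} \<times> (- ?Z) \<times> ?Z) \<inter> ?X \<times> ?Z \<times> ?Z = {}"
    by blast+
  ultimately show "2 * card ?S = CARD((bit \<times> bit \<times> bit \<times> bit) \<times> (bit \<times> bit) \<times> (bit \<times> bit))"
    by simp
  show "?c (v + w) k = ?c v k + ?c w k" if "k < CARD(8)" for v w k
    using that by (auto simp: lessThan_7_8 split_beta nth_Cons' simp del: add_bit_eq_xor)
  show "v = w" if eq: "\<And>k. k < CARD(8) \<Longrightarrow> ?c v k = ?c w k" for v w
  proof -
    obtain a b c l d e h k where v: "v = ((a, b, c, l), (d, e), (h, k))" by (metis surj_pair)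
    obtain a' b' c' l' d' e' h' k' where w: "w = ((a', b', c', l'), (d', e'), (h', k'))" by (metis surj_pair)
    show ?thesis using eq[of 0] eq[of 1] eq[of 2] eq[of 3] eq[of 4] eq[of 5] eq[of 6] eq[of 7] by (simp add: v w)
  qed
qed simp_all

section \<open>Complex representations\<close>

unbundle no vec_syntax

lemma subspace_module_vec_iff:
  "VectorSpace.subspace class_ring W (module_vec TYPE(complex) n) \<longleftrightarrow>
    W \<subseteq> carrier_vec n \<and> 0\<^sub>v n \<in> W \<and> (\<forall>v\<in>W. \<forall>w\<in>W. v + w \<in> W) \<and> (\<forall>c. \<forall>v\<in>W. c \<cdot>\<^sub>v v \<in> W)"
  using vec_vs[of n] vec_module[of n]
  unfolding VectorSpace.subspace_def submodule_def by (auto simp: module_vec_simps)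

lemma rep_props:
  assumes "Group.group G" "matrix_rep G n \<rho>"
  shows "\<And>g. g \<in> carrier G \<Longrightarrow> \<rho> g \<in> carrier_mat n n"
    and "\<And>g h. g \<in> carrier G \<Longrightarrow> h \<in> carrier G \<Longrightarrow> \<rho> (g \<otimes>\<^bsub>G\<^esub> h) = \<rho> g * \<rho> h"
    and "\<rho> \<one>\<^bsub>G\<^esub> = 1\<^sub>m n"
proof -
  let ?R = "ring_mat TYPE(complex) n ()"
  have hom: "\<rho> \<in> hom G (units_of ?R)" using assms(2) by (simp add: matrix_rep_def)
  interpret R: ring ?R by (rule ring_mat)
  have "group_hom G (units_of ?R) \<rho>"
    unfolding group_hom_def group_hom_axioms_def using assms(1) R.units_group hom by blast
  from group_hom.hom_one[OF this] show "\<rho> \<one>\<^bsub>G\<^esub> = 1\<^sub>m n"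
    by (simp add: units_of_def ring_mat_simps)
  show "\<rho> g \<in> carrier_mat n n" if "g \<in> carrier G" for g
    using hom_in_carrier[OF hom that] by (auto simp: units_of_def Units_def ring_mat_simps)
  show "\<rho> (g \<otimes>\<^bsub>G\<^esub> h) = \<rho> g * \<rho> h" if "g \<in> carrier G" "h \<in> carrier G" for g h
    using hom_mult[OF hom that] by (simp add: units_of_def ring_mat_simps)
qed

text \<open>Invertibility follows from multiplicativity: the inverse matrix of
  \<open>\<rho> g\<close> is the value of \<open>\<rho>\<close> at the inverse of
  \<open>g\<close>.\<close>

lemma matrix_repI:
  assumes "Group.group G" "\<And>g. g \<in> carrier G \<Longrightarrow> \<rho> g \<in> carrier_mat n n"
    and "\<And>g h. g \<in> carrier G \<Longrightarrow> h \<in> carrier G \<Longrightarrow> \<rho> (g \<otimes>\<^bsub>G\<^esub> h) = \<rho> g * \<rho> h"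
    and "\<rho> \<one>\<^bsub>G\<^esub> = 1\<^sub>m n"
  shows "matrix_rep G n \<rho>"
  unfolding matrix_rep_def
proof (rule homI)
  interpret group G by (rule assms(1))
  show "\<rho> g \<in> carrier (units_of (ring_mat TYPE(complex) n ()))" if g: "g \<in> carrier G" for g
  proof -
    have "\<rho> g * \<rho> (inv\<^bsub>G\<^esub> g) = 1\<^sub>m n" "\<rho> (inv\<^bsub>G\<^esub> g) * \<rho> g = 1\<^sub>m n"
      using g assms(3)[of g "inv\<^bsub>G\<^esub> g"] assms(3)[of "inv\<^bsub>G\<^esub> g" g] assms(4) by simp_all
    then show ?thesis
      using g assms(2) by (auto simp: units_of_def Units_def ring_mat_simps intro!: bexI[of _ "\<rho> (inv\<^bsub>G\<^esub> g)"])
  qed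
qed (simp add: units_of_def ring_mat_simps assms(3))

lemma trace_mult_commute:
  assumes "X \<in> carrier_mat m n" "Y \<in> carrier_mat n m"
  shows "(\<Sum>k<m. (X * Y) $$ (k, k)) = (\<Sum>i<n. (Y * X) $$ (i, i) :: complex)"
proof -
  have "(\<Sum>k<m. (X * Y) $$ (k, k)) = (\<Sum>k<m. \<Sum>i<n. X $$ (k, i) * Y $$ (i, k))"
    using assms by (intro sum.cong refl) (simp add: scalar_prod_def atLeast0LessThan)
  also have "\<dots> = (\<Sum>i<n. \<Sum>k<m. Y $$ (i, k) * X $$ (k, i))"
    by (subst sum.swap) (simp add: mult.commute)
  also have "\<dots> = (\<Sum>i<n. (Y * X) $$ (i, i))"
    using assms by (intro sum.cong refl) (simp add: scalar_prod_def atLeast0LessThan)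
  finally show ?thesis .
qed

section \<open>Schur's lemma and joint eigenvectors\<close>

text \<open>The kernel and the image of the intertwiner \<open>P\<close> are invariant. As
  \<open>P\<close> is not zero, irreducibility makes the kernel zero and the image
  everything.\<close>

lemma schur_bijective:
  assumes G: "Group.group G" and \<sigma>: "irreducible_rep G n \<sigma>" and \<rho>: "irreducible_rep G m \<rho>"
    and P: "P \<in> carrier_mat m n" "\<And>g. g \<in> carrier G \<Longrightarrow> P * \<sigma> g = \<rho> g * P"
    and x0: "x0 \<in> carrier_vec n" "P *\<^sub>v x0 \<noteq> 0\<^sub>v m"
  shows "\<And>x. x \<in> carrier_vec n \<Longrightarrow> P *\<^sub>v x = 0\<^sub>v m \<Longrightarrow> x = 0\<^sub>v n"
    and "\<And>y. y \<in> carrier_vec m \<Longrightarrow> \<exists>x\<in>carrier_vec n. P *\<^sub>v x = y"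
proof -
  note s = rep_props[OF G, of n \<sigma>] and r = rep_props[OF G, of m \<rho>]
  have ms: "matrix_rep G n \<sigma>" and mr: "matrix_rep G m \<rho>" using \<sigma> \<rho> by (auto simp: irreducible_rep_def)
  have comm: "\<rho> g *\<^sub>v (P *\<^sub>v x) = P *\<^sub>v (\<sigma> g *\<^sub>v x)" if "g \<in> carrier G" "x \<in> carrier_vec n" for g x
    using P(2)[OF that(1)] s(1)[OF ms that(1)] r(1)[OF mr that(1)] P(1) that(2)
    by (metis assoc_mult_mat_vec)
  define K where "K = {x \<in> carrier_vec n. P *\<^sub>v x = 0\<^sub>v m}"
  have "invariant_subspace G n \<sigma> K"
    unfolding invariant_subspace_def subspace_module_vec_iff
  proof (intro conjI ballI allI)
    fix g x assume g: "g \<in> carrier G" and x: "x \<in> K"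
    have "P *\<^sub>v (\<sigma> g *\<^sub>v x) = \<rho> g *\<^sub>v 0\<^sub>v m" using comm[OF g, of x] x by (simp add: K_def)
    moreover have "\<rho> g *\<^sub>v 0\<^sub>v m = 0\<^sub>v m" using r(1)[OF mr g] by (intro eq_vecI) auto
    moreover have "\<sigma> g *\<^sub>v x \<in> carrier_vec n"
      using x s(1)[OF ms g] by (simp add: K_def)
    ultimately show "\<sigma> g *\<^sub>v x \<in> K" by (simp add: K_def)
  qed (use P(1) in \<open>auto simp: K_def mult_add_distrib_mat_vec mult_mat_vec\<close>)
  moreover have "K \<noteq> carrier_vec n" using x0 by (auto simp: K_def)
  ultimately have K: "K = {0\<^sub>v n}" using \<sigma> unfolding irreducible_rep_def by blast
  then show "\<And>x. x \<in> carrier_vec n \<Longrightarrow> P *\<^sub>v x = 0\<^sub>v m \<Longrightarrow> x = 0\<^sub>v n" by (auto simp: K_def)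
  define I where "I = (\<lambda>x. P *\<^sub>v x) ` carrier_vec n"
  have "invariant_subspace G m \<rho> I"
    unfolding invariant_subspace_def subspace_module_vec_iff
  proof (intro conjI ballI allI)
    show "I \<subseteq> carrier_vec m" using P(1) by (auto simp: I_def)
    have "0\<^sub>v m = P *\<^sub>v 0\<^sub>v n" using P(1) by auto
    then show "0\<^sub>v m \<in> I" unfolding I_def by (rule image_eqI) simp
    fix v assume "v \<in> I"
    then obtain x where x: "x \<in> carrier_vec n" "v = P *\<^sub>v x" by (auto simp: I_def)
    show "c \<cdot>\<^sub>v v \<in> I" for c
    proof -
      have "c \<cdot>\<^sub>v v = P *\<^sub>v (c \<cdot>\<^sub>v x)" using x P(1) by (simp add: mult_mat_vec)
      then show ?thesis unfolding I_def by (rule image_eqI) (use x in simp)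
    qed
    show "v + w \<in> I" if "w \<in> I" for w
    proof -
      from that obtain y where y: "y \<in> carrier_vec n" "w = P *\<^sub>v y" by (auto simp: I_def)
      have "v + w = P *\<^sub>v (x + y)" using x y P(1) by (simp add: mult_add_distrib_mat_vec)
      then show ?thesis unfolding I_def by (rule image_eqI) (use x y in simp)
    qed
    show "\<rho> g *\<^sub>v v \<in> I" if "g \<in> carrier G" for g
    proof -
      have "\<rho> g *\<^sub>v v = P *\<^sub>v (\<sigma> g *\<^sub>v x)" using comm[OF that x(1)] x(2) by simp
      then show ?thesis unfolding I_def by (rule image_eqI) (use x s(1)[OF ms that] in simp)
    qed
  qed
  moreover have "I \<noteq> {0\<^sub>v m}" using x0 by (auto simp: I_def)
  ultimately have "I = carrier_vec m" using \<rho> unfolding irreducible_rep_def by blast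
  then show "\<And>y. y \<in> carrier_vec m \<Longrightarrow> \<exists>x\<in>carrier_vec n. P *\<^sub>v x = y"
    unfolding I_def by (metis imageE)
qed

text \<open>With an inverse \<open>Q\<close> of \<open>P\<close>, the matrix \<open>\<rho> g\<close>
  equals \<open>P (\<sigma> g Q)\<close>, which has the trace of \<open>\<sigma> g\<close>.
  \<open>P\<close> is not known to be square, so \<open>P Q = 1\<close> and \<open>Q P = 1\<close>
  are both proved.\<close>

lemma schur_character_eq:
  assumes G: "Group.group G" and \<sigma>: "irreducible_rep G n \<sigma>" and \<rho>: "irreducible_rep G m \<rho>"
    and P: "P \<in> carrier_mat m n" "\<And>g. g \<in> carrier G \<Longrightarrow> P * \<sigma> g = \<rho> g * P"
    and x0: "x0 \<in> carrier_vec n" "P *\<^sub>v x0 \<noteq> 0\<^sub>v m"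
  shows "rep_character G m \<rho> = rep_character G n \<sigma>"
proof -
  note inj = schur_bijective(1)[OF assms] and surj = schur_bijective(2)[OF assms]
  have ms: "matrix_rep G n \<sigma>" and mr: "matrix_rep G m \<rho>" using \<sigma> \<rho> by (auto simp: irreducible_rep_def)
  note s = rep_props[OF G ms] and r = rep_props[OF G mr]
  have "\<forall>k. \<exists>x. x \<in> carrier_vec n \<and> P *\<^sub>v x = unit_vec m k" using surj by (meson unit_vec_carrier)
  then obtain x where x: "\<And>k. x k \<in> carrier_vec n" "\<And>k. P *\<^sub>v x k = unit_vec m k" by metis
  \<comment> \<open>The columns are preimages of the unit vectors under \<open>P\<close>.\<close>
  define Q where "Q = mat n m (\<lambda>(i, k). x k $ i)"
  have Q: "Q \<in> carrier_mat n m" by (simp add: Q_def)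
  have colQ: "col Q k = x k" if "k < m" for k
    using that x(1)[of k] by (intro eq_vecI) (auto simp: Q_def)
  have PQ: "P * Q = 1\<^sub>m m"
  proof (rule eq_matI)
    fix i k assume ik: "i < dim_row (1\<^sub>m m :: complex mat)" "k < dim_col (1\<^sub>m m :: complex mat)"
    then have "(P * Q) $$ (i, k) = (P *\<^sub>v x k) $ i" using P(1) Q colQ[of k] by simp
    then show "(P * Q) $$ (i, k) = 1\<^sub>m m $$ (i, k)" using x(2) ik by simp
  qed (use P(1) Q in auto)
  have QP: "Q * P = 1\<^sub>m n"
  proof (rule eq_matI)
    fix i j assume ij: "i < dim_row (1\<^sub>m n :: complex mat)" "j < dim_col (1\<^sub>m n :: complex mat)"
    let ?u = "unit_vec n j :: complex Matrix.vec"
    have u: "?u \<in> carrier_vec n" by simp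
    have QPc: "Q * P \<in> carrier_mat n n" using P(1) Q by simp
    have "P *\<^sub>v ((Q * P) *\<^sub>v ?u) = (P * (Q * P)) *\<^sub>v ?u"
      by (rule assoc_mult_mat_vec[symmetric, OF P(1) QPc u])
    also have "P * (Q * P) = P"
      using assoc_mult_mat[OF P(1) Q P(1)] PQ P(1) by simp
    \<comment> \<open>\<open>P\<close> kills \<open>Q P u - u\<close>, so this vector is zero by
      injectivity.\<close>
    finally have "P *\<^sub>v ((Q * P) *\<^sub>v ?u - ?u) = 0\<^sub>v m"
      using P(1) QPc u by (simp add: mult_minus_distrib_mat_vec)
    then have "(Q * P) *\<^sub>v ?u - ?u = 0\<^sub>v n" using QPc by (intro inj) auto
    then have "((Q * P) *\<^sub>v ?u - ?u) $ i = 0" using ij by simp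
    moreover have "((Q * P) *\<^sub>v ?u) $ i = (Q * P) $$ (i, j)"
      using ij QPc by (simp del: index_mult_mat)
    ultimately show "(Q * P) $$ (i, j) = 1\<^sub>m n $$ (i, j)"
      using ij QPc by (auto simp del: index_mult_mat)
  qed (use P(1) Q in auto)
  have "(\<Sum>k<m. \<rho> g $$ (k, k)) = (\<Sum>i<n. \<sigma> g $$ (i, i))" if g: "g \<in> carrier G" for g
  proof -
    note c = s(1)[OF g] r(1)[OF g]
    have "\<rho> g = \<rho> g * (P * Q)" using PQ c by simp
    also have "\<dots> = (P * \<sigma> g) * Q" using P(2)[OF g] assoc_mult_mat[OF c(2) P(1) Q] by simp
    also have "\<dots> = P * (\<sigma> g * Q)" by (rule assoc_mult_mat[OF P(1) c(1) Q])
    finally have "\<rho> g = P * (\<sigma> g * Q)" .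
    then have "(\<Sum>k<m. \<rho> g $$ (k, k)) = (\<Sum>i<n. ((\<sigma> g * Q) * P) $$ (i, i))"
      using trace_mult_commute[OF P(1), of "\<sigma> g * Q"] c Q by simp
    also have "(\<sigma> g * Q) * P = \<sigma> g" using assoc_mult_mat[OF c(1) Q P(1)] QP c by simp
    finally show ?thesis .
  qed
  then show ?thesis by (auto simp: rep_character_def restrict_def)
qed

text \<open>Commuting involutions are treated one at a time. If \<open>X v\<close> is not
  \<open>- v\<close>, then \<open>v + X v\<close> is a nonzero vector fixed by \<open>X\<close>, and
  the earlier matrices keep their signs on it because they commute with \<open>X\<close>.\<close>

lemma joint_eigenvector:
  assumes "finite M" "E \<subseteq> carrier_vec m" "v0 \<in> E" "v0 \<noteq> (0\<^sub>v m :: complex Matrix.vec)"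
    and "\<And>X. X \<in> M \<Longrightarrow> X \<in> carrier_mat m m"
    and "\<And>X v. X \<in> M \<Longrightarrow> v \<in> E \<Longrightarrow> X *\<^sub>v v \<in> E"
    and "\<And>v w. v \<in> E \<Longrightarrow> w \<in> E \<Longrightarrow> v + w \<in> E"
    and "\<And>X v. X \<in> M \<Longrightarrow> v \<in> E \<Longrightarrow> X *\<^sub>v (X *\<^sub>v v) = v"
    and "\<And>X Y v. X \<in> M \<Longrightarrow> Y \<in> M \<Longrightarrow> v \<in> E \<Longrightarrow> X *\<^sub>v (Y *\<^sub>v v) = Y *\<^sub>v (X *\<^sub>v v)"
  shows "\<exists>v\<in>E. v \<noteq> 0\<^sub>v m \<and> (\<forall>X\<in>M. X *\<^sub>v v = v \<or> X *\<^sub>v v = - v)"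
  using assms(1,5-9)
proof (induction M rule: finite_induct)
  case empty
  then show ?case using assms(3,4) by blast
next
  case (insert X M)
  have "\<exists>v\<in>E. v \<noteq> 0\<^sub>v m \<and> (\<forall>X\<in>M. X *\<^sub>v v = v \<or> X *\<^sub>v v = - v)"
    by (rule insert.IH) (use insert.prems in auto)
  then obtain v where v: "v \<in> E" "v \<noteq> 0\<^sub>v m" "\<forall>Y\<in>M. Y *\<^sub>v v = v \<or> Y *\<^sub>v v = - v" by blast
  have X: "X \<in> carrier_mat m m" by (rule insert.prems(1)) simp
  have Xv: "X *\<^sub>v v \<in> E" by (rule insert.prems(2)) (use v in auto)
  have vc: "v \<in> carrier_vec m" and Xvc: "X *\<^sub>v v \<in> carrier_vec m" using assms(2) v Xv by auto
  show ?case
  proof (cases "v + X *\<^sub>v v = 0\<^sub>v m")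
    case True
    have "X *\<^sub>v v = - v"
    proof (rule eq_vecI)
      fix i assume i: "i < dim_vec (- v)"
      then have "(v + X *\<^sub>v v) $ i = 0" using True vc by simp
      then show "(X *\<^sub>v v) $ i = (- v) $ i" using i vc Xvc X by (simp add: add_eq_0_iff)
    qed (use vc X in auto)
    then show ?thesis using v by auto
  next
    case False
    let ?w = "v + X *\<^sub>v v"
    have wE: "?w \<in> E" by (rule insert.prems(3)[OF v(1) Xv])
    have XX: "X *\<^sub>v (X *\<^sub>v v) = v" by (rule insert.prems(4)) (use v in auto)
    have "X *\<^sub>v ?w = ?w"
      using mult_add_distrib_mat_vec[OF X vc Xvc] XX comm_add_vec[OF vc Xvc] by simp
    moreover have "Y *\<^sub>v ?w = ?w \<or> Y *\<^sub>v ?w = - ?w" if Y: "Y \<in> M" for Y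
    proof -
      have Yc: "Y \<in> carrier_mat m m" by (rule insert.prems(1)) (use Y in simp)
      have YX: "Y *\<^sub>v (X *\<^sub>v v) = X *\<^sub>v (Y *\<^sub>v v)" by (rule insert.prems(5)) (use Y v in auto)
      have Yw: "Y *\<^sub>v ?w = Y *\<^sub>v v + X *\<^sub>v (Y *\<^sub>v v)"
        using mult_add_distrib_mat_vec[OF Yc vc Xvc] YX by simp
      show ?thesis
      proof (cases "Y *\<^sub>v v = v")
        case True
        then show ?thesis using Yw by simp
      next
        case False
        then have "Y *\<^sub>v v = - v" using v(3) Y by blast
        then have "Y *\<^sub>v ?w = - v + X *\<^sub>v (- v)" using Yw by simp
        also have "X *\<^sub>v (- v) = - (X *\<^sub>v v)" using carrier_vecD[OF vc] carrier_matD[OF X]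
          by (intro eq_vecI) (auto simp: scalar_prod_def sum_negf)
        also have "- v + - (X *\<^sub>v v) = - ?w"
          using carrier_vecD[OF vc] carrier_vecD[OF Xvc] carrier_matD[OF X] by (intro eq_vecI) auto
        finally show ?thesis by blast
      qed
    qed
    ultimately show ?thesis using wE False by blast
  qed
qed

section \<open>Monomial representations of \<open>B \<rtimes> V\<close>\<close>

declare add_bit_eq_xor [simp del] mult_bit_eq_and [simp del]

definition bit_sign :: "bit \<Rightarrow> complex" where
  "bit_sign b = (if b = 0 then 1 else - 1)"

lemma bit_sign_add: "bit_sign (a + b) = bit_sign a * bit_sign b"
  by (cases a; cases b) (simp_all add: bit_sign_def)

lemma bit_sign_square [simp]: "bit_sign a * bit_sign a = 1"
  by (simp add: bit_sign_def)

lemma bit_sign_0 [simp]: "bit_sign 0 = 1"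
  by (simp add: bit_sign_def)

text \<open>A subset of \<open>V\<close> is represented by its indicator function \<open>r\<close>; the linear character
  of \<open>B\<close> attached to it is \<open>base_char r\<close>.\<close>

definition base_char :: "('v \<Rightarrow> bit) \<Rightarrow> ('v \<Rightarrow> bit) \<Rightarrow> complex" where
  "base_char r f = (\<Prod>x\<in>UNIV. bit_sign (r x * f x))"

definition delta :: "'v \<Rightarrow> 'v \<Rightarrow> bit" where
  "delta y = (\<lambda>x. if x = y then 1 else 0)"

definition translates :: "('v::ab_group_add \<Rightarrow> bit) \<Rightarrow> ('v \<Rightarrow> bit) set" where
  "translates r = range (\<lambda>t. translate t r)"

text \<open>Translating \<open>r\<close> conjugates \<open>base_char r\<close>, so the inertia group
  of this character is \<open>B\<close> extended by the periods.\<close>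

definition periods :: "('v::ab_group_add \<Rightarrow> bit) \<Rightarrow> 'v set" where
  "periods r = {t. translate t r = r}"

text \<open>The character induced from the extension of \<open>base_char r\<close> by \<open>\<nu>\<close> to its inertia group.\<close>

definition induced_char :: "('v::ab_group_add \<Rightarrow> bit) \<Rightarrow> ('v \<Rightarrow> complex) \<Rightarrow> ('v \<Rightarrow> bit) \<times> 'v \<Rightarrow> complex" where
  "induced_char r \<nu> = (\<lambda>(f, t). if t \<in> periods r then \<nu> t * (\<Sum>R\<in>translates r. base_char R f) else 0)"

lemma base_char_add: "base_char r (\<lambda>x. f x + g x) = base_char r f * base_char r g"
  by (simp add: base_char_def distrib_left bit_sign_add prod.distrib)

lemma base_char_square [simp]: "base_char r f * base_char r f = 1"
  by (simp add: base_char_def flip: prod.distrib)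

lemma base_char_cases: "base_char r f = 1 \<or> base_char r f = - 1"
  using base_char_square[of r f] by (simp only: square_eq_1_iff)

lemma base_char_zero [simp]: "base_char r (\<lambda>x. 0) = 1"
  by (simp add: base_char_def)

lemma translate_translate: "translate s (translate t r) = translate (s + t) r"
  by (simp add: translate_def add.assoc)

lemma translate_0 [simp]: "translate 0 r = r"
  by (simp add: translate_def)

lemma semidirect_simps [simp]:
  "carrier semidirect_group = UNIV"
  "(f, t) \<otimes>\<^bsub>semidirect_group\<^esub> (g, s) = ((\<lambda>x. f x + translate t g x), t + s)"
  "\<one>\<^bsub>semidirect_group\<^esub> = ((\<lambda>x. 0), 0)"
  by (simp_all add: semidirect_group_def)

context F2_pair
begin

lemma finite_functions [simp]: "finite (S :: ('v \<Rightarrow> bit) set)"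
proof -
  have "finite (UNIV :: bit set)" by (rule finite_subset[of _ "{0, 1}"]) (auto intro: bit.exhaust)
  then have "finite (UNIV \<rightarrow>\<^sub>E UNIV :: ('v \<Rightarrow> bit) set)"
    using finite_V by (intro finite_PiE) simp_all
  then show ?thesis by (rule finite_subset[rotated]) (simp add: PiE_UNIV_domain)
qed

lemma bij_action: "a \<in> carrier A \<Longrightarrow> bij (\<phi> a)"
  using bij_prop0 by (simp add: Bij_def)

lemma translate_self [simp]: "translate t (translate t r) = (r :: 'v \<Rightarrow> bit)"
  by (simp add: translate_translate add_self)

lemma base_char_translate: "base_char (translate t r) f = base_char r (translate t f)" for f :: "'v \<Rightarrow> bit"
  unfolding base_char_def translate_def
  by (rule prod.reindex_bij_witness[of _ "\<lambda>x. x + t" "\<lambda>x. x + t"]) (simp_all add: add.assoc add_self)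

lemma base_char_action:
  assumes "a \<in> carrier A"
  shows "base_char (r \<circ> \<phi> a) (f \<circ> \<phi> a) = base_char r f"
  unfolding base_char_def comp_apply
  by (rule prod.reindex_bij_betw[OF bij_action[OF assms]])

lemma base_char_delta: "base_char r (delta y) = bit_sign (r y)" for r :: "'v \<Rightarrow> bit"
proof -
  have "base_char r (delta y) = (\<Prod>x\<in>UNIV. if x = y then bit_sign (r x) else 1)"
    unfolding base_char_def by (rule prod.cong) (simp_all add: delta_def)
  then show ?thesis by (simp add: finite_V)
qed

text \<open>At a point \<open>y\<close> where \<open>r\<close> and \<open>s\<close> differ, the
  substitution of \<open>f + delta y\<close> for \<open>f\<close> changes the sign of the
  sum.\<close>

lemma base_char_orthogonal:
  fixes r s :: "'v \<Rightarrow> bit"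
  shows "(\<Sum>f\<in>UNIV. base_char r f * base_char s f) = (if r = s then of_nat (card (UNIV :: ('v \<Rightarrow> bit) set)) else 0)"
proof (cases "r = s")
  case False
  then obtain y where y: "r y \<noteq> s y" by auto
  let ?h = "\<lambda>f x. f x + delta y x"
  have h: "?h (?h f) = f" for f :: "'v \<Rightarrow> bit"
  proof
    fix x show "?h (?h f) x = f x" by (cases "f x"; cases "delta y x") simp_all
  qed
  have sgn: "bit_sign (r y) * bit_sign (s y) = - 1"
    using y by (cases "r y"; cases "s y") (simp_all add: bit_sign_def)
  have "(\<Sum>f\<in>UNIV. base_char r f * base_char s f) = (\<Sum>f\<in>UNIV. base_char r (?h f) * base_char s (?h f))"
    by (rule sum.reindex_bij_witness[of _ ?h ?h]) (simp_all add: h)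
  also have "\<dots> = (\<Sum>f\<in>UNIV. (bit_sign (r y) * bit_sign (s y)) * (base_char r f * base_char s f))"
    by (rule sum.cong) (simp_all add: base_char_add base_char_delta mult_ac)
  also have "\<dots> = - (\<Sum>f\<in>UNIV. base_char r f * base_char s f)"
    by (simp only: sgn) (simp add: sum_negf)
  finally show ?thesis using False by simp
qed simp

lemma translates_refl: "r \<in> translates r"
  unfolding translates_def by (metis rangeI translate_0)

lemma translates_eq: "s \<in> translates r \<Longrightarrow> translates s = translates (r :: 'v \<Rightarrow> bit)"
proof -
  assume "s \<in> translates r"
  then obtain c where s: "s = translate c r" by (auto simp: translates_def)
  have "translate t s = translate (t + c) r" "translate t r = translate (t + c) s" for t
    by (simp_all add: s translate_translate add_self add.assoc)
  then show ?thesis unfolding translates_def by (metis (no_types, lifting) equalityI image_subsetI rangeI)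
qed

lemma periods_translates: "s \<in> translates r \<Longrightarrow> periods s = periods (r :: 'v \<Rightarrow> bit)"
proof -
  assume "s \<in> translates r"
  then obtain c where s: "s = translate c r" by (auto simp: translates_def)
  have "translate t s = translate c (translate t r)" for t by (simp add: s translate_translate add.commute)
  moreover have "translate c u = translate c v \<longleftrightarrow> u = v" for u v :: "'v \<Rightarrow> bit" by (metis translate_self)
  ultimately show ?thesis by (auto simp: periods_def s)
qed

lemma subspace_periods: "subspace (periods r)"
proof (rule subspaceI)
  show "v + w \<in> periods r" if "v \<in> periods r" "w \<in> periods r" for v w
    using that by (simp add: periods_def flip: translate_translate)
  show "scale c v \<in> periods r" if "v \<in> periods r" for c v
    using that by (cases "c = 0") (simp_all add: periods_def)
qed (simp add: periods_def)

text \<open>Every translate of \<open>r\<close> arises from exactly one coset of the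
  periods.\<close>

lemma sum_translates:
  "(\<Sum>v\<in>UNIV. h (translate v r)) = of_nat (card (periods r)) * (\<Sum>R\<in>translates r. h R)"
  for h :: "('v \<Rightarrow> bit) \<Rightarrow> complex"
proof -
  have "(\<Sum>v\<in>UNIV. h (translate v r)) = (\<Sum>R\<in>translates r. \<Sum>v | v \<in> UNIV \<and> translate v r = R. h (translate v r))"
    unfolding translates_def by (rule sum.image_gen) (simp add: finite_V)
  also have "\<dots> = (\<Sum>R\<in>translates r. of_nat (card (periods r)) * h R)"
  proof (rule sum.cong)
    fix R assume "R \<in> translates r"
    then obtain c where R: "R = translate c r" by (auto simp: translates_def)
    have "{v. v \<in> UNIV \<and> translate v r = R} = (+) c ` periods r"
    proof (intro equalityI subsetI)
      fix v assume "v \<in> {v. v \<in> UNIV \<and> translate v r = R}"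
      then have "translate (c + v) r = r" by (simp add: R flip: translate_translate)
      moreover have "v = c + (c + v)" by (simp add: add_self flip: add.assoc)
      ultimately show "v \<in> (+) c ` periods r" unfolding periods_def by blast
    next
      fix v assume "v \<in> (+) c ` periods r"
      then show "v \<in> {v. v \<in> UNIV \<and> translate v r = R}"
        by (auto simp: R periods_def simp flip: translate_translate)
    qed
    then have "card {v. v \<in> UNIV \<and> translate v r = R} = card (periods r)" by (simp add: card_image)
    moreover have "(\<Sum>v | v \<in> UNIV \<and> translate v r = R. h (translate v r)) = (\<Sum>v | v \<in> UNIV \<and> translate v r = R. h R)"
      by (rule sum.cong) auto
    ultimately show "(\<Sum>v | v \<in> UNIV \<and> translate v r = R. h (translate v r)) = of_nat (card (periods r)) * h R"
      by simp
  qed simp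
  finally show ?thesis by (simp add: sum_distrib_left)
qed

lemma group_semidirect: "Group.group (semidirect_group :: (('v \<Rightarrow> bit) \<times> 'v) monoid)"
proof (rule groupI)
  fix x y z :: "('v \<Rightarrow> bit) \<times> 'v"
  obtain f t where x: "x = (f, t)" by (cases x)
  obtain g s where y: "y = (g, s)" by (cases y)
  obtain h u where z: "z = (h, u)" by (cases z)
  show "x \<otimes>\<^bsub>semidirect_group\<^esub> y \<otimes>\<^bsub>semidirect_group\<^esub> z = x \<otimes>\<^bsub>semidirect_group\<^esub> (y \<otimes>\<^bsub>semidirect_group\<^esub> z)"
    by (simp add: x y z translate_def fun_eq_iff ac_simps)
  \<comment> \<open>Both \<open>V\<close> and \<open>bit\<close> have exponent 2, hence this left
    inverse.\<close>
  have "(translate t f, t) \<otimes>\<^bsub>semidirect_group\<^esub> x = \<one>\<^bsub>semidirect_group\<^esub>"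
  proof -
    have "b + b = 0" for b :: bit by (cases b) simp_all
    then show ?thesis by (simp add: x add_self)
  qed
  then show "\<exists>y\<in>carrier semidirect_group. y \<otimes>\<^bsub>semidirect_group\<^esub> x = \<one>\<^bsub>semidirect_group\<^esub>"
    by (metis UNIV_I semidirect_simps(1))
  show "\<one>\<^bsub>semidirect_group\<^esub> \<otimes>\<^bsub>semidirect_group\<^esub> x = x" by (simp add: x)
qed simp_all

end

section \<open>The induced representation in matrix form\<close>

text \<open>The basis is indexed by the translates of \<open>r\<close>, enumerated by
  \<open>e\<close>. Taking \<open>\<nu>\<close> to be a character of all of \<open>V\<close>, and
  not just of the periods, lets the matrices be written without coset representatives.\<close>

locale monomial_rep = F2_pair scale A \<phi>
  for scale :: "bit \<Rightarrow> 'v::ab_group_add \<Rightarrow> 'v" and A :: "'a monoid" and \<phi> :: "'a \<Rightarrow> 'v \<Rightarrow> 'v" +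
  fixes r :: "'v \<Rightarrow> bit" and n :: nat and e :: "nat \<Rightarrow> 'v \<Rightarrow> bit" and \<nu> :: "'v \<Rightarrow> complex"
  assumes bij_e: "bij_betw e {..<n} (translates r)"
    and \<nu>_add: "\<nu> (s + t) = \<nu> s * \<nu> t" and \<nu>_0 [simp]: "\<nu> 0 = 1"
begin

definition p :: "'v \<Rightarrow> nat \<Rightarrow> nat" where
  "p t i = the_inv_into {..<n} e (translate t (e i))"

definition \<sigma> :: "('v \<Rightarrow> bit) \<times> 'v \<Rightarrow> complex mat" where
  "\<sigma> = (\<lambda>(f, t). mat n n (\<lambda>(i, j). if j = p t i then \<nu> t * base_char (e i) f else 0))"

lemma inj_e: "i < n \<Longrightarrow> j < n \<Longrightarrow> e i = e j \<longleftrightarrow> i = j"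
  using bij_e by (auto simp: bij_betw_def inj_on_def)

lemma e_translates: "i < n \<Longrightarrow> e i \<in> translates r"
  using bij_e by (auto simp: bij_betw_def)

lemma \<nu>_square [simp]: "\<nu> t * \<nu> t = 1"
  using \<nu>_add[of t t] by (simp add: add_self)

lemma translate_e: "i < n \<Longrightarrow> translate t (e i) \<in> e ` {..<n}"
proof -
  assume "i < n"
  then have "translates (e i) = e ` {..<n}" using translates_eq[OF e_translates] bij_e by (simp add: bij_betw_def)
  then show ?thesis by (auto simp: translates_def)
qed

lemma p_lt [simp]: "i < n \<Longrightarrow> p t i < n"
  using the_inv_into_into[OF _ translate_e, of i "{..<n}" t] bij_e by (auto simp: p_def bij_betw_def)

lemma e_p [simp]: "i < n \<Longrightarrow> e (p t i) = translate t (e i)"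
  unfolding p_def by (rule f_the_inv_into_f[OF _ translate_e]) (use bij_e in \<open>auto simp: bij_betw_def\<close>)

lemma p_p: "i < n \<Longrightarrow> p s (p t i) = p (s + t) i"
  by (simp add: translate_translate flip: inj_e)

lemma p_0 [simp]: "i < n \<Longrightarrow> p 0 i = i"
  by (simp flip: inj_e)

lemma p_swap: "i < n \<Longrightarrow> j < n \<Longrightarrow> j = p t i \<longleftrightarrow> i = p t j"
  by (metis add_self p_0 p_p)

lemma n_pos: "0 < n"
  by (rule gr0I) (use bij_e translates_refl[of r] in \<open>auto simp: bij_betw_def\<close>)

lemma p_transitive: "i < n \<Longrightarrow> j < n \<Longrightarrow> \<exists>t. p t j = i"
proof -
  assume ij: "i < n" "j < n"
  have "e i \<in> translates (e j)" using translates_eq[OF e_translates[OF ij(2)]] e_translates[OF ij(1)] by simp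
  then obtain t where "e i = translate t (e j)" by (auto simp: translates_def)
  then have "p t j = i" using ij by (simp flip: inj_e)
  then show ?thesis by blast
qed

lemma \<sigma>_carrier: "\<sigma> g \<in> carrier_mat n n"
  by (simp add: \<sigma>_def split_beta)

lemma \<sigma>_mult_vec:
  assumes "v \<in> carrier_vec n" "i < n"
  shows "(\<sigma> (f, t) *\<^sub>v v) $ i = \<nu> t * base_char (e i) f * v $ p t i"
proof -
  have "(\<sigma> (f, t) *\<^sub>v v) $ i = (\<Sum>j<n. (if j = p t i then \<nu> t * base_char (e i) f else 0) * v $ j)"
    using assms by (simp add: \<sigma>_def scalar_prod_def atLeast0LessThan)
  also have "\<dots> = (\<Sum>j<n. if j = p t i then \<nu> t * base_char (e i) f * v $ j else 0)"
    by (rule sum.cong) auto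
  finally show ?thesis using assms by simp
qed

lemma matrix_rep_\<sigma>: "matrix_rep semidirect_group n \<sigma>"
proof (rule matrix_repI[OF group_semidirect])
  show "\<sigma> \<one>\<^bsub>semidirect_group\<^esub> = 1\<^sub>m n"
    by (rule eq_matI) (auto simp: \<sigma>_def)
  fix x y :: "('v \<Rightarrow> bit) \<times> 'v"
  obtain f t where x: "x = (f, t)" by (cases x)
  obtain g s where y: "y = (g, s)" by (cases y)
  show "\<sigma> (x \<otimes>\<^bsub>semidirect_group\<^esub> y) = \<sigma> x * \<sigma> y"
  proof (rule eq_matI)
    fix i j assume "i < dim_row (\<sigma> x * \<sigma> y)" "j < dim_col (\<sigma> x * \<sigma> y)"
    then have ij: "i < n" "j < n" using \<sigma>_carrier[of x] \<sigma>_carrier[of y] by auto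
    have "(\<sigma> x * \<sigma> y) $$ (i, j) = (\<sigma> x *\<^sub>v col (\<sigma> y) j) $ i"
      using ij \<sigma>_carrier[of x] \<sigma>_carrier[of y] by simp
    also have "\<dots> = \<nu> t * base_char (e i) f * (col (\<sigma> y) j) $ p t i"
      unfolding x by (rule \<sigma>_mult_vec) (use ij \<sigma>_carrier[of y] in auto)
    also have "(col (\<sigma> y) j) $ p t i = (if j = p s (p t i) then \<nu> s * base_char (e (p t i)) g else 0)"
      using ij by (simp add: \<sigma>_def y)
    finally show "\<sigma> (x \<otimes>\<^bsub>semidirect_group\<^esub> y) $$ (i, j) = (\<sigma> x * \<sigma> y) $$ (i, j)"
      using ij by (simp add: \<sigma>_def x y p_p \<nu>_add base_char_add base_char_translate add.commute)
  qed (use \<sigma>_carrier[of x] \<sigma>_carrier[of y] \<sigma>_carrier[of "x \<otimes>\<^bsub>semidirect_group\<^esub> y"] in auto)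
qed (rule \<sigma>_carrier)

text \<open>Applying \<open>1 \<plusminus> \<sigma> (\<delta>\<^sub>y, 0)\<close> shrinks the support of a vector until one coordinate is left.\<close>

lemma unit_vec_in_invariant_subspace:
  assumes W: "invariant_subspace semidirect_group n \<sigma> W"
  shows "v \<in> W \<Longrightarrow> i < n \<Longrightarrow> v $ i \<noteq> 0 \<Longrightarrow> unit_vec n i \<in> W"
proof (induction "card {j. j < n \<and> v $ j \<noteq> 0}" arbitrary: v rule: less_induct)
  case less
  have WI: "W \<subseteq> carrier_vec n" "\<And>v w. v \<in> W \<Longrightarrow> w \<in> W \<Longrightarrow> v + w \<in> W" "\<And>c v. v \<in> W \<Longrightarrow> c \<cdot>\<^sub>v v \<in> W"
    "\<And>g v. v \<in> W \<Longrightarrow> \<sigma> g *\<^sub>v v \<in> W"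
    using W unfolding invariant_subspace_def subspace_module_vec_iff by auto
  have v: "v \<in> carrier_vec n" using less.prems WI by blast
  show ?case
  proof (cases "\<exists>j<n. j \<noteq> i \<and> v $ j \<noteq> 0")
    case True
    then obtain j where j: "j < n" "j \<noteq> i" "v $ j \<noteq> 0" by blast
    then have "e i \<noteq> e j" using less.prems(2) by (simp add: inj_e)
    then obtain y where y: "e i y \<noteq> e j y" by auto
    \<comment> \<open>The sign is chosen so that coordinate \<open>i\<close> is doubled while
      coordinate \<open>j\<close> is cancelled.\<close>
    define w where "w = v + bit_sign (e i y) \<cdot>\<^sub>v (\<sigma> (delta y, 0) *\<^sub>v v)"
    have wW: "w \<in> W" unfolding w_def using less.prems(1) WI by blast
    have wk: "w $ k = (1 + bit_sign (e i y) * bit_sign (e k y)) * v $ k" if "k < n" for k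
    proof -
      have "w $ k = v $ k + bit_sign (e i y) * (\<sigma> (delta y, 0) *\<^sub>v v) $ k"
        unfolding w_def using that v \<sigma>_carrier[of "(delta y, 0)"] by simp
      then show ?thesis using that by (simp add: \<sigma>_mult_vec[OF v that] base_char_delta algebra_simps)
    qed
    have "bit_sign (e i y) * bit_sign (e j y) = - 1"
      using y by (cases "e i y"; cases "e j y") (simp_all add: bit_sign_def)
    then have wj: "w $ j = 0" using wk[OF j(1)] by simp
    have wi: "w $ i \<noteq> 0" using wk[OF less.prems(2)] less.prems(3) by simp
    have "v $ k \<noteq> 0" if "k < n" "w $ k \<noteq> 0" for k
      using wk[OF that(1)] that(2) by (metis mult_zero_right)
    moreover have "j \<in> {k. k < n \<and> v $ k \<noteq> 0}" "j \<notin> {k. k < n \<and> w $ k \<noteq> 0}"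
      using wj j by simp_all
    ultimately have "{k. k < n \<and> w $ k \<noteq> 0} \<subset> {k. k < n \<and> v $ k \<noteq> 0}"
      by blast
    then have "card {k. k < n \<and> w $ k \<noteq> 0} < card {k. k < n \<and> v $ k \<noteq> 0}"
      by (intro psubset_card_mono) auto
    then show ?thesis using less.hyps[OF _ wW less.prems(2) wi] by blast
  next
    case False
    have "unit_vec n i = (1 / v $ i) \<cdot>\<^sub>v v"
      using False v less.prems(2,3) by (intro eq_vecI) auto
    then show ?thesis using WI(3)[OF less.prems(1)] by metis
  qed
qed

text \<open>A nonzero invariant subspace contains one unit vector; since \<open>V\<close> permutes
  the translates transitively, it contains all of them.\<close>

lemma irreducible_\<sigma>: "irreducible_rep semidirect_group n \<sigma>"
  unfolding irreducible_rep_def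
proof (intro conjI allI impI matrix_rep_\<sigma> n_pos)
  fix W assume W: "invariant_subspace semidirect_group n \<sigma> W"
  have WI: "W \<subseteq> carrier_vec n" "0\<^sub>v n \<in> W" "\<And>v w. v \<in> W \<Longrightarrow> w \<in> W \<Longrightarrow> v + w \<in> W" "\<And>c v. v \<in> W \<Longrightarrow> c \<cdot>\<^sub>v v \<in> W"
    "\<And>g v. v \<in> W \<Longrightarrow> \<sigma> g *\<^sub>v v \<in> W"
    using W unfolding invariant_subspace_def subspace_module_vec_iff by auto
  show "W = {0\<^sub>v n} \<or> W = carrier_vec n"
  proof (cases "W = {0\<^sub>v n}")
    case False
    then obtain v where v: "v \<in> W" "v \<noteq> 0\<^sub>v n" using WI(2) by blast
    have vc: "v \<in> carrier_vec n" using v WI(1) by blast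
    have "\<exists>i<n. v $ i \<noteq> 0"
    proof (rule ccontr)
      assume "\<not> ?thesis"
      then have "v = 0\<^sub>v n" using vc by (intro eq_vecI) auto
      then show False using v(2) by blast
    qed
    then obtain i where i: "i < n" "v $ i \<noteq> 0" by blast
    have ui: "unit_vec n i \<in> W" by (rule unit_vec_in_invariant_subspace[OF W v(1) i])
    have uj: "unit_vec n j \<in> W" if j: "j < n" for j
    proof -
      obtain t where t: "p t j = i" using p_transitive[OF i(1) j] by blast
      let ?w = "\<sigma> ((\<lambda>x. 0), t) *\<^sub>v unit_vec n i"
      have "?w $ j = \<nu> t" using j i t \<sigma>_mult_vec[of "unit_vec n i" j] by simp
      moreover have "\<nu> t \<noteq> 0" using \<nu>_square[of t] by (metis mult_zero_left zero_neq_one)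
      ultimately have "?w $ j \<noteq> 0" by simp
      then show ?thesis by (rule unit_vec_in_invariant_subspace[OF W WI(5)[OF ui] j])
    qed
    have "x \<in> W" if x: "x \<in> carrier_vec n" for x
    proof -
      \<comment> \<open>Truncations of \<open>x\<close> to the first \<open>m\<close> coordinates,
        built up one coordinate at a time.\<close>
      have "Matrix.vec n (\<lambda>j. if j < m then x $ j else 0) \<in> W" if "m \<le> n" for m
        using that
      proof (induction m)
        case 0
        have "Matrix.vec n (\<lambda>j. if j < 0 then x $ j else 0) = 0\<^sub>v n" by (intro eq_vecI) auto
        then show ?case using WI(2) by simp
      next
        case (Suc m)
        have "Matrix.vec n (\<lambda>j. if j < Suc m then x $ j else 0) =
            Matrix.vec n (\<lambda>j. if j < m then x $ j else 0) + x $ m \<cdot>\<^sub>v unit_vec n m"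
          using Suc.prems by (intro eq_vecI) (auto simp: less_Suc_eq)
        then show ?case using WI(3)[OF Suc.IH WI(4)[OF uj]] Suc.prems by simp
      qed
      from this[of n] have "Matrix.vec n (\<lambda>j. if j < n then x $ j else 0) \<in> W" by simp
      moreover have "Matrix.vec n (\<lambda>j. if j < n then x $ j else 0) = x" using x by (intro eq_vecI) auto
      ultimately show ?thesis by simp
    qed
    then show ?thesis using WI(1) by blast
  qed blast
qed

text \<open>A diagonal entry can be nonzero only if \<open>t\<close> fixes the corresponding
  translate. All translates have the same periods because \<open>V\<close> is commutative, so either
  all diagonal entries survive or none.\<close>

lemma rep_character_\<sigma>: "rep_character semidirect_group n \<sigma> = induced_char r \<nu>"
proof
  fix g :: "('v \<Rightarrow> bit) \<times> 'v"
  obtain f t where g: "g = (f, t)" by (cases g)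
  have "i = p t i \<longleftrightarrow> t \<in> periods r" if "i < n" for i
  proof -
    have "i = p t i \<longleftrightarrow> e i = translate t (e i)" using inj_e[OF that p_lt[OF that]] that by simp
    also have "\<dots> \<longleftrightarrow> t \<in> periods (e i)" by (auto simp: periods_def)
    finally show ?thesis using periods_translates[OF e_translates[OF that]] by simp
  qed
  then have "rep_character semidirect_group n \<sigma> g = (\<Sum>i<n. if t \<in> periods r then \<nu> t * base_char (e i) f else 0)"
    unfolding rep_character_def g by (simp add: \<sigma>_def cong: sum.cong_simp)
  also have "(\<Sum>i<n. base_char (e i) f) = (\<Sum>R\<in>translates r. base_char R f)"
    by (rule sum.reindex_bij_betw[OF bij_e])
  then have "(\<Sum>i<n. if t \<in> periods r then \<nu> t * base_char (e i) f else 0) = induced_char r \<nu> g"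
    by (simp add: induced_char_def g flip: sum_distrib_left)
  finally show "rep_character semidirect_group n \<sigma> g = induced_char r \<nu> g" .
qed

end

section \<open>Irreducible characters of \<open>B \<rtimes> V\<close>\<close>

lemma bit_add_self [simp]: "b + b = (0 :: bit)"
  by (cases b) simp_all

lemma translate_zero [simp]: "translate t (\<lambda>x. 0) = (\<lambda>x. 0)"
  by (simp add: translate_def)

lemma smult_vec_cancel:
  assumes "v \<in> carrier_vec n" "v \<noteq> 0\<^sub>v n" "c \<cdot>\<^sub>v v = d \<cdot>\<^sub>v (v :: complex Matrix.vec)"
  shows "c = d"
proof -
  have "\<exists>i<n. v $ i \<noteq> 0"
  proof (rule ccontr)
    assume "\<not> ?thesis"
    then have "v = 0\<^sub>v n" using assms(1) by (intro eq_vecI) auto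
    then show False using assms(2) by blast
  qed
  then obtain i where i: "i < n" "v $ i \<noteq> 0" by blast
  have "(c \<cdot>\<^sub>v v) $ i = (d \<cdot>\<^sub>v v) $ i" using assms(3) by simp
  then show ?thesis using i assms(1) by simp
qed

context F2_pair
begin

lemma translate_eq_iff: "translate s r = translate t r \<longleftrightarrow> s + t \<in> periods (r :: 'v \<Rightarrow> bit)"
proof -
  have "translate s r = translate t r \<longleftrightarrow> translate t (translate s r) = r" by (metis translate_self)
  then show ?thesis by (simp add: periods_def translate_translate add.commute)
qed

section \<open>Clifford theory: every irreducible character is induced\<close>

text \<open>The images of \<open>B\<close> are commuting involutions and have a joint eigenvector.
  Its signs at the functions \<open>delta x\<close> define \<open>r\<close>, and these functions
  generate \<open>B\<close>.\<close>

lemma base_character_exists: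
  assumes "irreducible_rep semidirect_group m \<rho>"
  obtains r v where "v \<in> carrier_vec m" "v \<noteq> 0\<^sub>v m"
    "\<And>f. \<rho> (f, 0 :: 'v) *\<^sub>v v = base_char r f \<cdot>\<^sub>v v"
proof -
  have mr: "matrix_rep semidirect_group m \<rho>" and m: "0 < m"
    using assms by (auto simp: irreducible_rep_def)
  note R = rep_props[OF group_semidirect mr]
  have carr: "\<rho> g \<in> carrier_mat m m" for g by (rule R(1)) simp
  have mult: "\<rho> (f, 0) *\<^sub>v (\<rho> (g, 0) *\<^sub>v v) = \<rho> (\<lambda>x. f x + g x, 0) *\<^sub>v v" if "v \<in> carrier_vec m" for f g v
    using assoc_mult_mat_vec[OF carr carr that, of "(f, 0)" "(g, 0)"] R(2)[of "(f, 0)" "(g, 0)"] by simp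
  have one: "\<rho> (\<lambda>x. 0, 0) = 1\<^sub>m m" using R(3) by simp
  have closed [simp]: "\<rho> g *\<^sub>v v \<in> carrier_vec m" if "v \<in> carrier_vec m" for g v
    by (rule mult_mat_vec_carrier[OF carr that])
  have "\<exists>v\<in>carrier_vec m. v \<noteq> 0\<^sub>v m \<and> (\<forall>X\<in>\<rho> ` ((\<lambda>f. (f, 0)) ` UNIV). X *\<^sub>v v = v \<or> X *\<^sub>v v = - v)"
  proof (rule joint_eigenvector)
    show "unit_vec m 0 \<in> carrier_vec m" "unit_vec m 0 \<noteq> (0\<^sub>v m :: complex Matrix.vec)" using m by auto
    fix X and v :: "complex Matrix.vec" assume X: "X \<in> \<rho> ` ((\<lambda>f. (f, 0)) ` UNIV)" and v: "v \<in> carrier_vec m"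
    then obtain f where f: "X = \<rho> (f, 0)" by blast
    show "X *\<^sub>v v \<in> carrier_vec m" using carr v f by simp
    show "X *\<^sub>v (X *\<^sub>v v) = v" using v by (simp add: f mult one)
    fix Y assume "Y \<in> \<rho> ` ((\<lambda>f. (f, 0)) ` UNIV)"
    then obtain g where g: "Y = \<rho> (g, 0)" by blast
    show "X *\<^sub>v (Y *\<^sub>v v) = Y *\<^sub>v (X *\<^sub>v v)" using v by (simp add: f g mult add.commute)
  qed (use carr in auto)
  then obtain v where v: "v \<in> carrier_vec m" "v \<noteq> 0\<^sub>v m"
    and ev: "\<And>f. \<rho> (f, 0) *\<^sub>v v = v \<or> \<rho> (f, 0) *\<^sub>v v = - v" by auto
  define r where "r x = (if \<rho> (delta x, 0) *\<^sub>v v = v then 0 else 1 :: bit)" for x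
  have rd: "\<rho> (delta x, 0) *\<^sub>v v = bit_sign (r x) \<cdot>\<^sub>v v" for x
    using ev[of "delta x"] v(1) by (auto simp: r_def bit_sign_def)
  have ind: "\<rho> (\<lambda>x. if x \<in> X then 1 else 0, 0) *\<^sub>v v = base_char r (\<lambda>x. if x \<in> X then 1 else 0) \<cdot>\<^sub>v v" for X
  proof -
    have "finite X" by simp
    then show ?thesis
    proof (induction X rule: finite_induct)
      case empty
      then show ?case using v(1) by (simp add: one)
    next
      case (insert y X)
      let ?f = "\<lambda>x. if x \<in> X then 1 else 0 :: bit"
      have eq: "(\<lambda>x. if x \<in> insert y X then 1 else 0) = (\<lambda>x. ?f x + delta y x)"
        using insert.hyps by (auto simp: delta_def fun_eq_iff)
      have "\<rho> (\<lambda>x. ?f x + delta y x, 0) *\<^sub>v v = \<rho> (?f, 0) *\<^sub>v (bit_sign (r y) \<cdot>\<^sub>v v)"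
        using mult[OF v(1), of ?f "delta y"] rd by simp
      also have "\<dots> = bit_sign (r y) \<cdot>\<^sub>v (base_char r ?f \<cdot>\<^sub>v v)"
        using mult_mat_vec[OF carr v(1)] insert.IH by simp
      finally show ?case
        unfolding eq base_char_add base_char_delta by (simp add: smult_smult_assoc mult.commute)
    qed
  qed
  have "\<rho> (f, 0) *\<^sub>v v = base_char r f \<cdot>\<^sub>v v" for f
  proof -
    have "f = (\<lambda>x. if x \<in> {x. f x = 1} then 1 else 0)" by (auto simp: fun_eq_iff)
    then show ?thesis using ind[of "{x. f x = 1}"] by metis
  qed
  then show ?thesis using that v by blast
qed

text \<open>A linear projection of \<open>V\<close> onto \<open>T\<close> is composed with
  \<open>\<mu>\<close>.\<close>

lemma extend_character:
  fixes \<mu> :: "'v \<Rightarrow> complex"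
  assumes T: "subspace T" and "\<And>s t. s \<in> T \<Longrightarrow> t \<in> T \<Longrightarrow> \<mu> (s + t) = \<mu> s * \<mu> t" "\<mu> 0 = 1"
  obtains \<nu> where "\<And>s t. \<nu> (s + t) = \<nu> s * \<nu> t" "\<nu> 0 = 1" "\<And>t. t \<in> T \<Longrightarrow> \<nu> t = \<mu> t"
proof -
  interpret vector_space_pair scale scale by unfold_locales
  have "\<exists>g. g ` UNIV \<subseteq> T \<and> Vector_Spaces.linear scale scale g \<and> (\<forall>v\<in>T. g (id v) = v)"
    by (rule linear_exists_left_inverse_on[OF linear_id T]) simp
  then obtain g where g: "range g \<subseteq> T" "Vector_Spaces.linear scale scale g" "\<And>v. v \<in> T \<Longrightarrow> g v = v" by auto
  have add: "g (s + t) = g s + g t" for s t using g(2) by (simp add: Vector_Spaces.linear_iff)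
  show ?thesis
  proof (rule that[of "\<lambda>t. \<mu> (g t)"])
    show "\<mu> (g (s + t)) = \<mu> (g s) * \<mu> (g t)" for s t
      unfolding add by (rule assms(2)) (use g(1) in auto)
    show "\<mu> (g 0) = 1" using g(3)[OF subspace_0[OF T]] assms(3) by simp
  qed (simp add: g(3))
qed

text \<open>The periods preserve the eigenspace \<open>E\<close> of \<open>base_char r\<close> and
  act on it by commuting involutions. A joint eigenvector gives a character of the periods, which is
  then extended to \<open>V\<close>.\<close>

lemma inertia_eigenvector:
  assumes "irreducible_rep semidirect_group m \<rho>"
  obtains r \<nu> w where "\<And>s t. \<nu> (s + t) = \<nu> s * \<nu> t" "\<nu> 0 = 1"
    "w \<in> carrier_vec m" "w \<noteq> 0\<^sub>v m"
    "\<And>f. \<rho> (f, 0 :: 'v) *\<^sub>v w = base_char r f \<cdot>\<^sub>v w"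
    "\<And>t. t \<in> periods r \<Longrightarrow> \<rho> (\<lambda>x. 0, t) *\<^sub>v w = \<nu> t \<cdot>\<^sub>v w"
proof -
  have mr: "matrix_rep semidirect_group m \<rho>"
    using assms by (auto simp: irreducible_rep_def)
  note R = rep_props[OF group_semidirect mr]
  have carr: "\<rho> g \<in> carrier_mat m m" for g by (rule R(1)) simp
  have mult: "\<rho> g *\<^sub>v (\<rho> h *\<^sub>v v) = \<rho> (g \<otimes>\<^bsub>semidirect_group\<^esub> h) *\<^sub>v v" if "v \<in> carrier_vec m" for g h v
    using assoc_mult_mat_vec[OF carr carr that, of g h] R(2)[of g h] by simp
  have one: "\<rho> (\<lambda>x. 0, 0) = 1\<^sub>m m" using R(3) by simp
  have closed [simp]: "\<rho> g *\<^sub>v v \<in> carrier_vec m" if "v \<in> carrier_vec m" for g v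
    by (rule mult_mat_vec_carrier[OF carr that])
  obtain r v where v: "v \<in> carrier_vec m" "v \<noteq> 0\<^sub>v m" "\<And>f. \<rho> (f, 0) *\<^sub>v v = base_char r f \<cdot>\<^sub>v v"
    by (rule base_character_exists[OF assms]) (rule that; assumption)
  define E where "E = {w \<in> carrier_vec m. \<forall>f. \<rho> (f, 0) *\<^sub>v w = base_char r f \<cdot>\<^sub>v w}"
  have "\<exists>w\<in>E. w \<noteq> 0\<^sub>v m \<and> (\<forall>X\<in>\<rho> ` ((\<lambda>t. (\<lambda>x. 0, t)) ` periods r). X *\<^sub>v w = w \<or> X *\<^sub>v w = - w)"
  proof (rule joint_eigenvector)
    show "v \<in> E" "v \<noteq> 0\<^sub>v m" using v by (auto simp: E_def)
    show "w + w' \<in> E" if "w \<in> E" "w' \<in> E" for w w'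
      using that mult_add_distrib_mat_vec[OF carr] by (auto simp: E_def smult_add_distrib_vec)
    fix X w assume X: "X \<in> \<rho> ` ((\<lambda>t. (\<lambda>x. 0, t)) ` periods r)" and w: "w \<in> E"
    then obtain t where t: "X = \<rho> (\<lambda>x. 0, t)" "t \<in> periods r" by blast
    have wc: "w \<in> carrier_vec m" using w by (simp add: E_def)
    show "X *\<^sub>v w \<in> E"
    proof -
      \<comment> \<open>Moving \<open>f\<close> past \<open>t\<close> replaces it by a translate,
        and \<open>base_char r\<close> takes the same value there because \<open>t\<close> is a
        period.\<close>
      have "\<rho> (f, 0) *\<^sub>v (X *\<^sub>v w) = base_char r f \<cdot>\<^sub>v (X *\<^sub>v w)" for f
      proof -
        have "\<rho> (f, 0) *\<^sub>v (X *\<^sub>v w) = X *\<^sub>v (\<rho> (translate t f, 0) *\<^sub>v w)"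
          using wc by (simp add: t(1) mult)
        also have "\<dots> = X *\<^sub>v (base_char r (translate t f) \<cdot>\<^sub>v w)" using w by (simp add: E_def)
        also have "base_char r (translate t f) = base_char r f"
          using t(2) base_char_translate[of t r f] by (simp add: periods_def)
        finally show ?thesis using mult_mat_vec[OF carr wc] by (simp add: t(1))
      qed
      then show ?thesis using carr wc by (simp add: E_def t(1))
    qed
    show "X *\<^sub>v (X *\<^sub>v w) = w" using wc by (simp add: t(1) mult one add_self)
    fix Y assume "Y \<in> \<rho> ` ((\<lambda>t. (\<lambda>x. 0, t)) ` periods r)"
    then obtain s where s: "Y = \<rho> (\<lambda>x. 0, s)" by blast
    show "X *\<^sub>v (Y *\<^sub>v w) = Y *\<^sub>v (X *\<^sub>v w)" using wc by (simp add: s t(1) mult add.commute)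
  qed (use carr in \<open>auto simp: E_def\<close>)
  then obtain w where w: "w \<in> E" "w \<noteq> 0\<^sub>v m"
    and ev0: "\<forall>X\<in>\<rho> ` ((\<lambda>t. (\<lambda>x. 0, t)) ` periods r). X *\<^sub>v w = w \<or> X *\<^sub>v w = - w" by blast
  have ev: "\<And>t. t \<in> periods r \<Longrightarrow> \<rho> (\<lambda>x. 0, t) *\<^sub>v w = w \<or> \<rho> (\<lambda>x. 0, t) *\<^sub>v w = - w"
    using ev0 by blast
  have wc: "w \<in> carrier_vec m" using w by (simp add: E_def)
  define \<mu> where "\<mu> t = (if \<rho> (\<lambda>x. 0, t) *\<^sub>v w = w then 1 else - 1 :: complex)" for t
  have \<mu>: "\<rho> (\<lambda>x. 0, t) *\<^sub>v w = \<mu> t \<cdot>\<^sub>v w" if "t \<in> periods r" for t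
    using ev[OF that] wc by (auto simp: \<mu>_def)
  \<comment> \<open>Multiplicativity is read off from the action on \<open>w\<close>, which is
    nonzero and can be cancelled.\<close>
  have "\<mu> (s + t) = \<mu> s * \<mu> t" if "s \<in> periods r" "t \<in> periods r" for s t
  proof -
    have "\<mu> (s + t) \<cdot>\<^sub>v w = \<rho> (\<lambda>x. 0, s + t) *\<^sub>v w"
      using \<mu>[OF subspace_add[OF subspace_periods that]] by simp
    also have "\<dots> = \<rho> (\<lambda>x. 0, s) *\<^sub>v (\<mu> t \<cdot>\<^sub>v w)"
      using mult[OF wc, of "(\<lambda>x. 0, s)" "(\<lambda>x. 0, t)"] \<mu>[OF that(2)] by simp
    also have "\<dots> = (\<mu> s * \<mu> t) \<cdot>\<^sub>v w"
      using mult_mat_vec[OF carr wc] \<mu>[OF that(1)] by (simp add: smult_smult_assoc mult.commute)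
    finally show ?thesis by (rule smult_vec_cancel[OF wc w(2)])
  qed
  moreover have "\<mu> 0 = 1" using wc by (simp add: \<mu>_def one)
  ultimately obtain \<nu> where \<nu>: "\<And>s t. \<nu> (s + t) = \<nu> s * \<nu> t" "\<nu> 0 = 1" "\<And>t. t \<in> periods r \<Longrightarrow> \<nu> t = \<mu> t"
    using extend_character[OF subspace_periods, of r \<mu>] by blast
  show ?thesis
    by (rule that[OF \<nu>(1,2) wc w(2)]) (use w \<mu> \<nu>(3) in \<open>auto simp: E_def\<close>)
qed

text \<open>The images of the eigenvector \<open>w\<close> under representatives of the translates
  are permuted up to scalars as in \<open>M.\<sigma>\<close>. As columns they form a nonzero
  intertwiner, so Schur's lemma identifies the characters.\<close>

lemma irreducible_character:
  assumes "irreducible_rep semidirect_group m \<rho>"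
  obtains r \<nu> where "\<And>s t. \<nu> (s + t) = \<nu> s * \<nu> t" "\<nu> (0 :: 'v) = 1"
    "rep_character semidirect_group m \<rho> = induced_char r \<nu>"
proof -
  have mr: "matrix_rep semidirect_group m \<rho>"
    using assms by (auto simp: irreducible_rep_def)
  note R = rep_props[OF group_semidirect mr]
  have carr: "\<rho> g \<in> carrier_mat m m" for g by (rule R(1)) simp
  have mult: "\<rho> g *\<^sub>v (\<rho> h *\<^sub>v v) = \<rho> (g \<otimes>\<^bsub>semidirect_group\<^esub> h) *\<^sub>v v" if "v \<in> carrier_vec m" for g h v
    using assoc_mult_mat_vec[OF carr carr that, of g h] R(2)[of g h] by simp
  have one: "\<rho> (\<lambda>x. 0, 0) = 1\<^sub>m m" using R(3) by simp
  have closed [simp]: "\<rho> g *\<^sub>v v \<in> carrier_vec m" if "v \<in> carrier_vec m" for g v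
    by (rule mult_mat_vec_carrier[OF carr that])
  obtain r \<nu> w where \<nu>: "\<And>s t. \<nu> (s + t) = \<nu> s * \<nu> t" "\<nu> 0 = 1"
    and w: "w \<in> carrier_vec m" "w \<noteq> 0\<^sub>v m" "\<And>f. \<rho> (f, 0) *\<^sub>v w = base_char r f \<cdot>\<^sub>v w"
    and wT: "\<And>t. t \<in> periods r \<Longrightarrow> \<rho> (\<lambda>x. 0, t) *\<^sub>v w = \<nu> t \<cdot>\<^sub>v w"
    by (rule inertia_eigenvector[OF assms]) (rule that; assumption)
  define n where "n = card (translates r)"
  obtain e where e: "bij_betw e {..<n} (translates r)"
    using ex_bij_betw_nat_finite[of "translates r"] by (auto simp: n_def lessThan_atLeast0)
  interpret M: monomial_rep scale A \<phi> r n e \<nu>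
    by unfold_locales (use e \<nu> in auto)
  have "\<forall>i. \<exists>c. i < n \<longrightarrow> e i = translate c r"
    using M.e_translates unfolding translates_def by blast
  then obtain u where u: "\<And>i. i < n \<Longrightarrow> e i = translate (u i) r" by metis
  \<comment> \<open>The factor \<open>\<nu> (u i)\<close> makes the vector independent of the
    representative: changing \<open>u i\<close> by a period changes both factors by the same
    sign.\<close>
  define W where "W i = \<nu> (u i) \<cdot>\<^sub>v (\<rho> (\<lambda>x. 0, u i) *\<^sub>v w)" for i
  have Wc: "W i \<in> carrier_vec m" for i using carr w(1) by (simp add: W_def)
  have act: "\<rho> (f, t) *\<^sub>v W j = (\<nu> t * base_char (e (M.p t j)) f) \<cdot>\<^sub>v W (M.p t j)" if j: "j < n" for f t j
  proof -
    let ?k = "M.p t j"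
    \<comment> \<open>The discrepancy between \<open>t + u j\<close> and the chosen representative
      of the same translate; it is a period, so \<open>w\<close> is an eigenvector for it.\<close>
    define q where "q = t + u j + u ?k"
    have tu: "t + u j = u ?k + q" by (simp add: q_def ac_simps add_self)
    have "translate (u ?k) r = translate (t + u j) r"
      using u[of ?k] u[OF j] j by (simp add: translate_translate)
    then have q: "q \<in> periods r" by (simp add: translate_eq_iff q_def ac_simps)
    have \<nu>eq: "\<nu> (u j) * \<nu> q = \<nu> t * \<nu> (u ?k)"
    proof -
      have "u j + q = t + u ?k + (u j + u j)" by (simp add: q_def ac_simps)
      then show ?thesis by (simp add: add_self flip: \<nu>(1))
    qed
    have prod: "(f, t) \<otimes>\<^bsub>semidirect_group\<^esub> (\<lambda>x. 0, u j) =
        (\<lambda>x. 0, u ?k) \<otimes>\<^bsub>semidirect_group\<^esub> ((translate (u ?k) f, 0) \<otimes>\<^bsub>semidirect_group\<^esub> (\<lambda>x. 0, q))"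
      by (simp add: tu)
    have bc: "base_char r (translate (u ?k) f) = base_char (e ?k) f"
      using u[of ?k] j by (simp add: base_char_translate)
    have "\<rho> (f, t) *\<^sub>v W j = \<nu> (u j) \<cdot>\<^sub>v (\<rho> (f, t) *\<^sub>v (\<rho> (\<lambda>x. 0, u j) *\<^sub>v w))"
      unfolding W_def by (rule mult_mat_vec[OF carr]) (use carr w(1) in simp)
    also have "\<rho> (f, t) *\<^sub>v (\<rho> (\<lambda>x. 0, u j) *\<^sub>v w) =
        \<rho> (\<lambda>x. 0, u ?k) *\<^sub>v (\<rho> (translate (u ?k) f, 0) *\<^sub>v (\<rho> (\<lambda>x. 0, q) *\<^sub>v w))"
      by (simp only: mult[OF w(1)] prod)
    also have "\<dots> = (\<nu> q * base_char (e ?k) f) \<cdot>\<^sub>v (\<rho> (\<lambda>x. 0, u ?k) *\<^sub>v w)"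
      using mult_mat_vec[OF carr w(1)] by (simp add: wT[OF q] w(3) bc smult_smult_assoc)
    finally have "\<rho> (f, t) *\<^sub>v W j = (\<nu> (u j) * \<nu> q * base_char (e ?k) f) \<cdot>\<^sub>v (\<rho> (\<lambda>x. 0, u ?k) *\<^sub>v w)"
      by (simp add: smult_smult_assoc mult.assoc)
    then show ?thesis unfolding \<nu>eq W_def by (simp add: smult_smult_assoc mult_ac)
  qed
  define P where "P = mat m n (\<lambda>(k, j). W j $ k)"
  have P: "P \<in> carrier_mat m n" by (simp add: P_def)
  have colP: "col P j = W j" if "j < n" for j
    using that Wc[of j] by (intro eq_vecI) (auto simp: P_def)
  have comm: "P * M.\<sigma> g = \<rho> g * P" for g
  proof (rule eq_matI)
    fix k j assume "k < dim_row (\<rho> g * P)" "j < dim_col (\<rho> g * P)"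
    then have k: "k < m" and j: "j < n" using carr[of g] P by auto
    obtain f t where g: "g = (f, t)" by (cases g)
    have "(\<rho> g * P) $$ (k, j) = (\<rho> g *\<^sub>v W j) $ k"
      using k j carr[of g] P colP[OF j] by simp
    also have "\<dots> = \<nu> t * base_char (e (M.p t j)) f * W (M.p t j) $ k"
      using k Wc[of "M.p t j"] by (simp add: g act[OF j])
    also have "\<dots> = (\<Sum>i<n. if i = M.p t j then \<nu> t * base_char (e i) f * W i $ k else 0)"
      using j by simp
    also have "\<dots> = (\<Sum>i<n. W i $ k * (if j = M.p t i then \<nu> t * base_char (e i) f else 0))"
      by (rule sum.cong) (use j M.p_swap[OF j] in auto)
    also have "\<dots> = (P * M.\<sigma> g) $$ (k, j)"
      using k j by (simp add: P_def M.\<sigma>_def g scalar_prod_def atLeast0LessThan)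
    finally show "(P * M.\<sigma> g) $$ (k, j) = (\<rho> g * P) $$ (k, j)" by simp
  qed (use carr[of g] M.\<sigma>_carrier[of g] P in auto)
  \<comment> \<open>Applying the involution of \<open>u 0\<close> to the first column returns a
    nonzero multiple of \<open>w\<close>.\<close>
  have nz: "P *\<^sub>v unit_vec n 0 \<noteq> 0\<^sub>v m"
  proof
    assume "P *\<^sub>v unit_vec n 0 = 0\<^sub>v m"
    moreover have "P *\<^sub>v unit_vec n 0 = col P 0"
      using P M.n_pos by (intro eq_vecI) auto
    ultimately have W0: "W 0 = 0\<^sub>v m" using colP M.n_pos by simp
    have "\<rho> (\<lambda>x. 0, u 0) *\<^sub>v W 0 = \<nu> (u 0) \<cdot>\<^sub>v (\<rho> (\<lambda>x. 0, u 0) *\<^sub>v (\<rho> (\<lambda>x. 0, u 0) *\<^sub>v w))"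
      unfolding W_def by (rule mult_mat_vec[OF carr]) (use carr w(1) in simp)
    also have "\<dots> = \<nu> (u 0) \<cdot>\<^sub>v w" using w(1) by (simp add: mult add_self one)
    also have "\<rho> (\<lambda>x. 0, u 0) *\<^sub>v W 0 = 0 \<cdot>\<^sub>v w"
      unfolding W0 using carr[of "(\<lambda>x. 0, u 0)"] w(1) by (intro eq_vecI) auto
    finally have "\<nu> (u 0) \<cdot>\<^sub>v w = 0 \<cdot>\<^sub>v w" by simp
    then have "\<nu> (u 0) = 0" by (rule smult_vec_cancel[OF w(1,2)])
    then show False using M.\<nu>_square[of "u 0"] by simp
  qed
  have "rep_character semidirect_group m \<rho> = rep_character semidirect_group n M.\<sigma>"
    by (rule schur_character_eq[OF group_semidirect M.irreducible_\<sigma> assms P _ _ nz]) (simp_all add: comm)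
  then show ?thesis using that \<nu> M.rep_character_\<sigma> by metis
qed

end

section \<open>Invariant characters\<close>

context F2_pair
begin

section \<open>Averaging over \<open>A\<close>\<close>

lemma action_inv2: "a \<in> carrier A \<Longrightarrow> \<phi> a (\<phi> (inv\<^bsub>A\<^esub> a) v) = v"
  using action_inv[of "inv\<^bsub>A\<^esub> a" v] group.inv_inv[OF group_A] group.inv_closed[OF group_A] by simp

lemma action_sum: "a \<in> carrier A \<Longrightarrow> \<phi> a (\<Sum>x\<in>X. h x) = (\<Sum>x\<in>X. \<phi> a (h x))"
  by (induction X rule: infinite_finite_induct) (simp_all add: action_zero action_add)

lemma sum_action_inv: "(\<Sum>a\<in>carrier A. \<phi> (inv\<^bsub>A\<^esub> a) t) = (\<Sum>a\<in>carrier A. \<phi> a t)"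
  using group.inv_closed[OF group_A] group.inv_inv[OF group_A]
  by (intro sum.reindex_bij_witness[of _ "\<lambda>a. inv\<^bsub>A\<^esub> a" "\<lambda>a. inv\<^bsub>A\<^esub> a"]) auto

lemma sum_action_shift:
  assumes b: "b \<in> carrier A"
  shows "(\<Sum>a\<in>carrier A. h (a \<otimes>\<^bsub>A\<^esub> b)) = (\<Sum>a\<in>carrier A. h a)"
proof -
  interpret group A by (rule group_A)
  show ?thesis
    by (rule sum.reindex_bij_witness[of _ "\<lambda>a. a \<otimes>\<^bsub>A\<^esub> inv\<^bsub>A\<^esub> b" "\<lambda>a. a \<otimes>\<^bsub>A\<^esub> b"])
       (use b in \<open>auto simp: m_assoc\<close>)
qed

text \<open>The sum is fixed by \<open>A\<close>, and only 0 is.\<close>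

lemma sum_action_zero: "(\<Sum>a\<in>carrier A. \<phi> a t) = 0"
proof -
  let ?s = "\<Sum>a\<in>carrier A. \<phi> (inv\<^bsub>A\<^esub> a) t"
  interpret group A by (rule group_A)
  have "\<phi> (inv\<^bsub>A\<^esub> b) ?s = ?s" if b: "b \<in> carrier A" for b
  proof -
    have "\<phi> (inv\<^bsub>A\<^esub> b) ?s = (\<Sum>a\<in>carrier A. \<phi> (inv\<^bsub>A\<^esub> (a \<otimes>\<^bsub>A\<^esub> b)) t)"
      using b by (auto simp: action_sum composition_rule inv_mult_group intro!: sum.cong)
    also have "\<dots> = ?s" by (rule sum_action_shift[OF b])
    finally show ?thesis .
  qed
  then have "\<forall>b\<in>carrier A. \<phi> b ?s = ?s" by (metis inv_closed inv_inv)
  then have "?s = 0" using fixed_points_trivial by auto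
  then show ?thesis by (simp add: sum_action_inv)
qed

text \<open>An odd number of copies in characteristic 2 leaves one; averages over \<open>A\<close>
  therefore need no division.\<close>

lemma sum_carrier_const: "(\<Sum>a\<in>carrier A. c) = (c :: 'v)"
proof -
  have "(\<Sum>x\<in>X. c) = (if odd (card X) then c else 0)" if "finite X" for X :: "'a set"
    using that by (induction X rule: finite_induct) (simp_all add: add_self)
  then show ?thesis using finite_A odd_A by (simp add: Coset.order_def)
qed

text \<open>Indicator functions of the stable subsets, the common parameters for the invariant
  characters and for the fixed elements.\<close>

definition stable_functions :: "('v \<Rightarrow> bit) set" where
  "stable_functions = {S. \<forall>a\<in>carrier A. S \<circ> \<phi> a = S}"

lemma stable_functions_inv:
  "S \<in> stable_functions \<longleftrightarrow> (\<forall>a\<in>carrier A. S \<circ> \<phi> (inv\<^bsub>A\<^esub> a) = S)"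
proof -
  interpret group A by (rule group_A)
  have "(\<forall>a\<in>carrier A. S \<circ> \<phi> a = S) \<longleftrightarrow> (\<forall>a\<in>carrier A. S \<circ> \<phi> (inv\<^bsub>A\<^esub> a) = S)"
    by (metis inv_closed inv_inv)
  then show ?thesis by (simp add: stable_functions_def)
qed

lemma translate_action:
  assumes "b \<in> carrier A"
  shows "translate t r \<circ> \<phi> b = translate (\<phi> (inv\<^bsub>A\<^esub> b) t) (r \<circ> \<phi> b)"
  using assms by (simp add: translate_def fun_eq_iff action_add action_inv2)

lemma base_char_action_inv:
  assumes "a \<in> carrier A"
  shows "base_char R (f \<circ> \<phi> (inv\<^bsub>A\<^esub> a)) = base_char (R \<circ> \<phi> a) f"
proof -
  have "(f \<circ> \<phi> (inv\<^bsub>A\<^esub> a)) \<circ> \<phi> a = f" using assms by (simp add: fun_eq_iff action_inv)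
  then show ?thesis using base_char_action[OF assms, of R "f \<circ> \<phi> (inv\<^bsub>A\<^esub> a)"] by simp
qed

text \<open>Pairing both sides with \<open>base_char s\<close> gives a positive number on the right,
  and 0 on the left unless \<open>s\<close> occurs there.\<close>

lemma base_char_sum_eq_imp:
  fixes X Y :: "('v \<Rightarrow> bit) set"
  assumes "\<And>f. (\<Sum>R\<in>X. base_char (h R) f) = (\<Sum>R\<in>Y. base_char R f)" "s \<in> Y"
  shows "\<exists>R\<in>X. h R = s"
proof (rule ccontr)
  assume none: "\<not> ?thesis"
  let ?N = "of_nat (card (UNIV :: ('v \<Rightarrow> bit) set)) :: complex"
  have "(\<Sum>f\<in>UNIV. base_char s f * (\<Sum>R\<in>X. base_char (h R) f)) = (\<Sum>R\<in>X. \<Sum>f\<in>UNIV. base_char s f * base_char (h R) f)"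
    by (subst sum.swap) (simp add: sum_distrib_left)
  also have "\<dots> = 0" using none by (auto simp: base_char_orthogonal intro!: sum.neutral)
  finally have "(\<Sum>f\<in>UNIV. base_char s f * (\<Sum>R\<in>Y. base_char R f)) = 0" by (simp add: assms(1))
  moreover have "(\<Sum>f\<in>UNIV. base_char s f * (\<Sum>R\<in>Y. base_char R f)) = (\<Sum>R\<in>Y. \<Sum>f\<in>UNIV. base_char s f * base_char R f)"
    by (subst sum.swap) (simp add: sum_distrib_left)
  moreover have "\<dots> = ?N" using assms(2) by (simp add: base_char_orthogonal)
  ultimately have "card (UNIV :: ('v \<Rightarrow> bit) set) = 0" by simp
  then show False by simp
qed

lemma translates_stable:
  assumes "S \<in> stable_functions" "a \<in> carrier A"
  shows "bij_betw (\<lambda>R. R \<circ> \<phi> a) (translates S) (translates S)"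
proof (rule bij_betw_byWitness[where f' = "\<lambda>R. R \<circ> \<phi> (inv\<^bsub>A\<^esub> a)"])
  have sub: "R \<circ> \<phi> b \<in> translates S" if R: "R \<in> translates S" and b: "b \<in> carrier A" for R b
  proof -
    obtain t where "R = translate t S" using R by (auto simp: translates_def)
    then have "R \<circ> \<phi> b = translate (\<phi> (inv\<^bsub>A\<^esub> b) t) S"
      using b assms(1) by (simp add: translate_action stable_functions_def)
    then show ?thesis by (simp add: translates_def)
  qed
  show "(\<lambda>R. R \<circ> \<phi> a) ` translates S \<subseteq> translates S" using sub assms(2) by blast
  show "(\<lambda>R. R \<circ> \<phi> (inv\<^bsub>A\<^esub> a)) ` translates S \<subseteq> translates S"
    using sub group.inv_closed[OF group_A assms(2)] by blast
qed (use assms(2) in \<open>simp_all add: fun_eq_iff action_inv action_inv2\<close>)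

lemma periods_stable:
  assumes "S \<in> stable_functions" "a \<in> carrier A" "t \<in> periods S"
  shows "\<phi> a t \<in> periods S"
proof -
  interpret group A by (rule group_A)
  have "translate (\<phi> a t) S = translate t S \<circ> \<phi> (inv\<^bsub>A\<^esub> a)"
    using translate_action[of "inv\<^bsub>A\<^esub> a" t S] assms(1,2) by (simp add: stable_functions_def)
  also have "\<dots> = S" using assms by (simp add: periods_def stable_functions_def)
  finally show ?thesis by (simp add: periods_def)
qed

lemma induced_char_invariant:
  assumes "S \<in> stable_functions" "a \<in> carrier A"
  shows "induced_char S (\<lambda>_. 1) (induced_action A \<phi> a g) = induced_char S (\<lambda>_. 1) g"
proof -
  obtain f t where g: "g = (f, t)" by (cases g)
  have "\<phi> a t \<in> periods S \<longleftrightarrow> t \<in> periods S"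
    using periods_stable[OF assms(1)] assms(2) group.inv_closed[OF group_A assms(2)] action_inv by metis
  moreover have "(\<Sum>R\<in>translates S. base_char R (f \<circ> \<phi> (inv\<^bsub>A\<^esub> a))) = (\<Sum>R\<in>translates S. base_char (R \<circ> \<phi> a) f)"
    by (simp add: base_char_action_inv[OF assms(2)])
  moreover have "\<dots> = (\<Sum>R\<in>translates S. base_char R f)"
    by (rule sum.reindex_bij_betw[OF translates_stable[OF assms]])
  ultimately show ?thesis by (simp add: g induced_char_def induced_action_def)
qed

lemma induced_char_irreducible: "induced_char S (\<lambda>_. 1) \<in> irr_chars semidirect_group" for S :: "'v \<Rightarrow> bit"
proof -
  obtain e where e: "bij_betw e {..<card (translates S)} (translates S)"
    using ex_bij_betw_nat_finite[of "translates S"] by (auto simp: lessThan_atLeast0)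
  interpret M: monomial_rep scale A \<phi> S "card (translates S)" e "\<lambda>_. 1"
    by unfold_locales (use e in auto)
  show ?thesis
    unfolding irr_chars_def mem_Collect_eq
    by (rule exI, rule exI, rule conjI[OF M.rep_character_\<sigma>[symmetric] M.irreducible_\<sigma>])
qed

text \<open>Glauberman's argument: \<open>a \<mapsto> c a\<close> is a cocycle modulo the periods, and since \<open>|A|\<close> is odd
  summing it over \<open>A\<close> gives a translate fixed by \<open>A\<close>.\<close>

lemma stable_translate:
  assumes "\<And>a. a \<in> carrier A \<Longrightarrow> r \<circ> \<phi> a \<in> translates r"
  obtains S where "S \<in> stable_functions" "S \<in> translates r"
proof -
  have "\<forall>a. \<exists>c. a \<in> carrier A \<longrightarrow> r \<circ> \<phi> a = translate c r"
    using assms unfolding translates_def by blast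
  then obtain c where c: "\<And>a. a \<in> carrier A \<Longrightarrow> r \<circ> \<phi> a = translate (c a) r" by metis
  interpret group A by (rule group_A)
  define s where "s = (\<Sum>a\<in>carrier A. c a)"
  have "translate s r \<circ> \<phi> b = translate s r" if b: "b \<in> carrier A" for b
  proof -
    \<comment> \<open>The cocycle identity, obtained by computing the translate for a product in two
      ways.\<close>
    have "c (a \<otimes>\<^bsub>A\<^esub> b) + (\<phi> (inv\<^bsub>A\<^esub> b) (c a) + c b) \<in> periods r" if a: "a \<in> carrier A" for a
    proof -
      have "translate (c (a \<otimes>\<^bsub>A\<^esub> b)) r = r \<circ> \<phi> a \<circ> \<phi> b"
        using c[of "a \<otimes>\<^bsub>A\<^esub> b"] a b by (simp add: fun_eq_iff composition_rule)
      also have "\<dots> = translate (\<phi> (inv\<^bsub>A\<^esub> b) (c a) + c b) r"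
        using c[OF a] c[OF b] by (simp add: translate_action[OF b] translate_translate)
      finally show ?thesis by (simp add: translate_eq_iff)
    qed
    then have "(\<Sum>a\<in>carrier A. c (a \<otimes>\<^bsub>A\<^esub> b) + (\<phi> (inv\<^bsub>A\<^esub> b) (c a) + c b)) \<in> periods r"
      by (intro subspace_sum[OF subspace_periods])
    \<comment> \<open>The first terms sum to \<open>s\<close> after a shift of the index, and the
      odd number of copies of \<open>c b\<close> leaves a single one.\<close>
    also have "(\<Sum>a\<in>carrier A. c (a \<otimes>\<^bsub>A\<^esub> b) + (\<phi> (inv\<^bsub>A\<^esub> b) (c a) + c b)) = s + (\<phi> (inv\<^bsub>A\<^esub> b) s + c b)"
      using sum_action_shift[OF b, of c] b by (simp add: sum.distrib action_sum sum_carrier_const s_def)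
    finally have "translate (\<phi> (inv\<^bsub>A\<^esub> b) s + c b) r = translate s r"
      unfolding translate_eq_iff by (simp add: ac_simps)
    then show ?thesis using c[OF b] by (simp add: translate_action[OF b] translate_translate)
  qed
  then have "translate s r \<in> stable_functions" by (simp add: stable_functions_def)
  then show ?thesis using that by (auto simp: translates_def)
qed

text \<open>If both sets are stable, \<open>\<phi> (inv a) t + t\<close> is a period for every
  \<open>a\<close>. Summed over \<open>A\<close> the first terms vanish and the second leave
  \<open>t\<close>, which is thus a period.\<close>

lemma stable_translate_unique:
  assumes "S \<in> stable_functions" "S' \<in> stable_functions" "S' \<in> translates S"
  shows "S' = S"
proof -
  interpret group A by (rule group_A)
  obtain t where t: "S' = translate t S" using assms(3) by (auto simp: translates_def)
  have "\<phi> (inv\<^bsub>A\<^esub> a) t + t \<in> periods S" if a: "a \<in> carrier A" for a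
  proof -
    have "translate (\<phi> (inv\<^bsub>A\<^esub> a) t) S = translate t S \<circ> \<phi> a"
      using translate_action[OF a, of t S] assms(1) a by (simp add: stable_functions_def)
    also have "\<dots> = translate t S" using assms(2) a t by (simp add: stable_functions_def)
    finally show ?thesis by (simp add: translate_eq_iff)
  qed
  then have "(\<Sum>a\<in>carrier A. \<phi> (inv\<^bsub>A\<^esub> a) t + t) \<in> periods S"
    by (intro subspace_sum[OF subspace_periods])
  then have "t \<in> periods S" by (simp add: sum.distrib sum_action_inv sum_action_zero sum_carrier_const)
  then show ?thesis by (simp add: t periods_def)
qed

text \<open>Restriction to \<open>B\<close> shows that \<open>A\<close> maps \<open>r\<close> to
  translates of itself, so some translate \<open>S\<close> is stable. It remains to see that
  \<open>\<nu>\<close> is trivial on the periods.\<close>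

lemma invariant_character:
  assumes \<nu>: "\<And>s t. \<nu> (s + t) = \<nu> s * \<nu> t" "\<nu> (0 :: 'v) = 1"
    and inv: "\<And>a g. a \<in> carrier A \<Longrightarrow> induced_char r \<nu> (induced_action A \<phi> a g) = induced_char r \<nu> g"
  shows "\<exists>S\<in>stable_functions. induced_char r \<nu> = induced_char S (\<lambda>_. 1)"
proof -
  interpret group A by (rule group_A)
  have "r \<circ> \<phi> a \<in> translates r" if a: "a \<in> carrier A" for a
  proof -
    have ia: "inv\<^bsub>A\<^esub> a \<in> carrier A" using a by simp
    have "(\<Sum>R\<in>translates r. base_char (R \<circ> \<phi> (inv\<^bsub>A\<^esub> a)) f) = (\<Sum>R\<in>translates r. base_char R f)" for f
      using inv[OF ia, of "(f, 0)"] subspace_0[OF subspace_periods, of r] ia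
      by (simp add: induced_char_def induced_action_def action_zero \<nu>(2) base_char_action_inv[OF ia])
    from base_char_sum_eq_imp[OF this translates_refl]
    obtain R where R: "R \<in> translates r" "R \<circ> \<phi> (inv\<^bsub>A\<^esub> a) = r" by blast
    have "r (\<phi> a x) = R x" for x
      using fun_cong[OF R(2), of "\<phi> a x"] by (simp add: action_inv[OF a])
    then have "r \<circ> \<phi> a = R" by auto
    then show ?thesis using R(1) by simp
  qed
  then obtain S where S: "S \<in> stable_functions" "S \<in> translates r" using stable_translate by blast
  have eq: "translates S = translates r" "periods S = periods r"
    using translates_eq[OF S(2)] periods_translates[OF S(2)] by auto
  \<comment> \<open>\<open>\<nu>\<close> is constant on the \<open>A\<close>-orbit of
    \<open>t\<close>, so its power with exponent the order of \<open>A\<close> is the value at a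
    vanishing sum, namely 1. A sign with an odd power equal to 1 is 1.\<close>
  have one: "\<nu> t = 1" if t: "t \<in> periods r" for t
  proof -
    have "\<nu> (\<phi> a t) = \<nu> t" if a: "a \<in> carrier A" for a
    proof -
      \<comment> \<open>At an element with zero function part the character is \<open>\<nu>\<close>
        times this nonzero number, which can be cancelled.\<close>
      have ct: "card (translates r) \<noteq> 0" using translates_refl[of r] by auto
      have "\<phi> a t \<in> periods r" using periods_stable[OF S(1) a] t eq(2) by simp
      then show ?thesis using inv[OF a, of "(\<lambda>x. 0, t)"] t ct
        by (simp add: induced_char_def induced_action_def comp_def)
    qed
    then have "(\<Prod>a\<in>carrier A. \<nu> (\<phi> a t)) = \<nu> t ^ Coset.order A" by (simp add: Coset.order_def)
    moreover have "\<nu> (\<Sum>a\<in>X. \<phi> a t) = (\<Prod>a\<in>X. \<nu> (\<phi> a t))" for X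
      by (induction X rule: infinite_finite_induct) (simp_all add: \<nu>)
    ultimately have "\<nu> t ^ Coset.order A = 1" by (metis sum_action_zero \<nu>(2))
    moreover have "\<nu> t = 1 \<or> \<nu> t = - 1"
      using \<nu>(1)[of t t] \<nu>(2) by (simp add: add_self square_eq_1_iff[symmetric])
    ultimately show ?thesis using odd_A by auto
  qed
  have "induced_char r \<nu> = induced_char S (\<lambda>_. 1)"
    unfolding induced_char_def eq using one by (auto simp: fun_eq_iff)
  then show ?thesis using S(1) by blast
qed

lemma invariant_irr_chars_eq:
  "invariant_irr_chars A semidirect_group (induced_action A \<phi>) = (\<lambda>S. induced_char S (\<lambda>_. 1)) ` stable_functions"
proof (intro equalityI subsetI)
  fix \<psi> assume \<psi>: "\<psi> \<in> invariant_irr_chars A semidirect_group (induced_action A \<phi>)"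
  then obtain n \<rho> where \<rho>: "irreducible_rep semidirect_group n \<rho>" "\<psi> = rep_character semidirect_group n \<rho>"
    by (auto simp: invariant_irr_chars_def irr_chars_def)
  show "\<psi> \<in> (\<lambda>S. induced_char S (\<lambda>_. 1)) ` stable_functions"
  proof (rule irreducible_character[OF \<rho>(1)])
    fix r \<nu> assume \<nu>: "\<And>s t. \<nu> (s + t) = \<nu> s * \<nu> t" "\<nu> (0 :: 'v) = 1"
      "rep_character semidirect_group n \<rho> = induced_char r \<nu>"
    have "\<exists>S\<in>stable_functions. induced_char r \<nu> = induced_char S (\<lambda>_. 1)"
      by (rule invariant_character[OF \<nu>(1,2)]) (use \<psi> \<rho>(2) \<nu>(3) in \<open>auto simp: invariant_irr_chars_def\<close>)
    then show ?thesis using \<rho>(2) \<nu>(3) by auto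
  qed
next
  fix \<psi> assume "\<psi> \<in> (\<lambda>S. induced_char S (\<lambda>_. 1)) ` stable_functions"
  then show "\<psi> \<in> invariant_irr_chars A semidirect_group (induced_action A \<phi>)"
    by (auto simp: invariant_irr_chars_def induced_char_irreducible induced_char_invariant)
qed

text \<open>Equal restrictions to \<open>B\<close> force the two sets to be translates of each
  other, and a stable translate is unique.\<close>

lemma inj_on_induced_char: "inj_on (\<lambda>S. induced_char S (\<lambda>_. 1)) stable_functions"
proof (rule inj_onI)
  fix S S' assume S: "S \<in> stable_functions" "S' \<in> stable_functions"
    and eq: "induced_char S (\<lambda>_. 1) = induced_char S' (\<lambda>_. 1)"
  have "(\<Sum>R\<in>translates S. base_char (id R) f) = (\<Sum>R\<in>translates S'. base_char R f)" for f
    using fun_cong[OF eq, of "(f, 0)"] subspace_0[OF subspace_periods, of S] subspace_0[OF subspace_periods, of S']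
    by (simp add: induced_char_def)
  from base_char_sum_eq_imp[OF this translates_refl] have "S' \<in> translates S" by auto
  then show "S = S'" using stable_translate_unique[OF S] by simp
qed

text \<open>The \<open>V\<close>-component of a fixed element is a fixed vector, hence 0.\<close>

lemma fixed_subgroup_eq:
  "fixed_subgroup A semidirect_group (induced_action A \<phi>) = (\<lambda>f. (f, 0)) ` stable_functions"
proof (intro equalityI subsetI)
  fix g assume "g \<in> fixed_subgroup A semidirect_group (induced_action A \<phi>)"
  then have g: "\<forall>a\<in>carrier A. induced_action A \<phi> a g = g" by (simp add: fixed_subgroup_def)
  obtain f t where ft: "g = (f, t)" by (cases g)
  have "\<forall>a\<in>carrier A. \<phi> a t = t" "\<forall>a\<in>carrier A. f \<circ> \<phi> (inv\<^bsub>A\<^esub> a) = f"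
    using g by (auto simp: ft induced_action_def)
  then have "t = 0" "f \<in> stable_functions"
    using fixed_points_trivial by (auto simp: stable_functions_inv)
  then show "g \<in> (\<lambda>f. (f, 0)) ` stable_functions" by (simp add: ft)
next
  fix g assume "g \<in> (\<lambda>f. (f, 0 :: 'v)) ` stable_functions"
  then show "g \<in> fixed_subgroup A semidirect_group (induced_action A \<phi>)"
    by (auto simp: fixed_subgroup_def induced_action_def stable_functions_inv action_zero)
qed

text \<open>The fixed subgroup lies in the abelian group \<open>B\<close>, so its derived subgroup
  is trivial and the cosets are singletons.\<close>

lemma order_fixed_abelianization:
  "Coset.order (fixed_abelianization A semidirect_group (induced_action A \<phi>)) = card stable_functions"
proof -
  let ?G = "semidirect_group :: (('v \<Rightarrow> bit) \<times> 'v) monoid"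
  let ?F = "fixed_subgroup A ?G (induced_action A \<phi>)"
  interpret G: group ?G by (rule group_semidirect)
  have "derived ?G ?F = {\<one>\<^bsub>?G\<^esub>}"
  proof -
    have "h1 \<otimes>\<^bsub>?G\<^esub> h2 \<otimes>\<^bsub>?G\<^esub> inv\<^bsub>?G\<^esub> h1 \<otimes>\<^bsub>?G\<^esub> inv\<^bsub>?G\<^esub> h2 = \<one>\<^bsub>?G\<^esub>" if "h1 \<in> ?F" "h2 \<in> ?F" for h1 h2
    proof -
      have "h1 \<otimes>\<^bsub>?G\<^esub> h2 = h2 \<otimes>\<^bsub>?G\<^esub> h1"
        using that by (auto simp: fixed_subgroup_eq add.commute)
      then have "h1 \<otimes>\<^bsub>?G\<^esub> h2 \<otimes>\<^bsub>?G\<^esub> inv\<^bsub>?G\<^esub> h1 = h2"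
        by (metis G.inv_closed G.m_assoc G.r_inv G.r_one UNIV_I semidirect_simps(1))
      then show ?thesis by (metis G.r_inv UNIV_I semidirect_simps(1))
    qed
    then have "derived_set ?G ?F \<subseteq> {\<one>\<^bsub>?G\<^esub>}" by blast
    then have "derived ?G ?F \<subseteq> {\<one>\<^bsub>?G\<^esub>}"
      unfolding derived_def by (rule G.generate_subgroup_incl[OF _ G.triv_subgroup])
    moreover have "\<one>\<^bsub>?G\<^esub> \<in> derived ?G ?F" unfolding derived_def by (rule generate.one)
    ultimately show ?thesis by blast
  qed
  then have "carrier (fixed_abelianization A ?G (induced_action A \<phi>)) = (\<lambda>g. {g}) ` ?F"
    unfolding fixed_abelianization_def FactGroup_def RCOSETS_def r_coset_def by (auto simp: split_beta)
  then show ?thesis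
    by (simp add: Coset.order_def card_image inj_on_def fixed_subgroup_eq)
qed

section \<open>Zeros of invariant characters and balanced pairs\<close>

text \<open>The factor \<open>card (periods S)\<close> turns the sum over translates into a sum of
  signs over all of \<open>V\<close>, and each sign -1 lowers the total by 2.\<close>

lemma induced_char_fixed:
  "of_nat (card (periods S)) * induced_char S (\<lambda>_. 1) (f, 0) =
    of_nat (card (UNIV :: 'v set)) - 2 * (of_nat (card {v. base_char (translate v S) f = - 1}) :: complex)"
  for S :: "'v \<Rightarrow> bit"
proof -
  let ?D = "{v. base_char (translate v S) f = - 1}"
  have "of_nat (card (periods S)) * induced_char S (\<lambda>_. 1) (f, 0) = (\<Sum>v\<in>UNIV. base_char (translate v S) f)"
    using sum_translates[of "\<lambda>R. base_char R f" S] subspace_0[OF subspace_periods, of S]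
    by (simp add: induced_char_def)
  also have "\<dots> = (\<Sum>v\<in>UNIV. 1 - (if v \<in> ?D then 2 else 0))"
  proof (rule sum.cong)
    show "base_char (translate v S) f = 1 - (if v \<in> ?D then 2 else 0)" for v
      using base_char_cases[of "translate v S" f] by auto
  qed simp
  also have "\<dots> = of_nat (card (UNIV :: 'v set)) - (\<Sum>v\<in>UNIV. if v \<in> ?D then 2 else 0)"
    by (simp add: sum_subtractf)
  also have "(\<Sum>v\<in>UNIV. if v \<in> ?D then 2 else 0) = (\<Sum>v\<in>?D. 2 :: complex)"
    by (simp add: sum.If_cases finite_V)
  finally show ?thesis by (simp add: mult.commute)
qed

lemma induced_char_vanishes_iff:
  "induced_char S (\<lambda>_. 1) (f, 0) = 0 \<longleftrightarrow> 2 * card {v. base_char (translate v S) f = - 1} = card (UNIV :: 'v set)"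
  for S :: "'v \<Rightarrow> bit"
proof -
  have "card (periods S) \<noteq> 0" using subspace_0[OF subspace_periods, of S] by auto
  then have "induced_char S (\<lambda>_. 1) (f, 0) = 0 \<longleftrightarrow>
      of_nat (card (periods S)) * induced_char S (\<lambda>_. 1) (f, 0) = 0" by simp
  also have "\<dots> \<longleftrightarrow> of_nat (2 * card {v. base_char (translate v S) f = - 1}) = (of_nat (card (UNIV :: 'v set)) :: complex)"
    unfolding induced_char_fixed by auto
  finally show ?thesis by (simp only: of_nat_eq_iff)
qed

text \<open>There are as many invariant characters as fixed elements, so the counts differ exactly
  when some invariant character vanishes at some fixed element.\<close>

lemma nonvanishing_count_iff_balanced:
  "card (nonvanishing_chars A semidirect_group (induced_action A \<phi>))
      \<noteq> Coset.order (fixed_abelianization A semidirect_group (induced_action A \<phi>)) \<longleftrightarrow> balanced A \<phi>"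
proof -
  let ?I = "invariant_irr_chars A semidirect_group (induced_action A \<phi>)"
  let ?N = "nonvanishing_chars A semidirect_group (induced_action A \<phi>)"
  have cI: "card ?I = card stable_functions"
    unfolding invariant_irr_chars_eq by (rule card_image[OF inj_on_induced_char])
  have finI: "finite ?I" unfolding invariant_irr_chars_eq by simp
  have NI: "?N \<subseteq> ?I" by (auto simp: nonvanishing_chars_def)
  have "card ?N \<noteq> card ?I \<longleftrightarrow> ?N \<noteq> ?I"
    using card_subset_eq[OF finI NI] by auto
  also have "\<dots> \<longleftrightarrow> (\<exists>S\<in>stable_functions. \<exists>f\<in>stable_functions. induced_char S (\<lambda>_. 1) (f, 0) = 0)"
    using NI unfolding nonvanishing_chars_def fixed_subgroup_eq unfolding invariant_irr_chars_eq by auto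
  also have "\<dots> \<longleftrightarrow> balanced A \<phi>"
  proof
    assume "\<exists>S\<in>stable_functions. \<exists>f\<in>stable_functions. induced_char S (\<lambda>_. 1) (f, 0) = 0"
    then obtain S f where S: "S \<in> stable_functions" and f: "f \<in> stable_functions"
      and zero: "induced_char S (\<lambda>_. 1) (f, 0) = 0" by blast
    let ?D = "{v. base_char (translate v S) f = - 1}"
    \<comment> \<open>The set is stable because \<open>S\<close> and \<open>f\<close> are, and
      vanishing of the character makes it a half of \<open>V\<close>.\<close>
    have "\<phi> a v \<in> ?D" if a: "a \<in> carrier A" and v: "v \<in> ?D" for a v
    proof -
      have "translate (\<phi> a v) S \<circ> \<phi> a = translate v S"
        using S a by (simp add: translate_action action_inv stable_functions_def)
      moreover have "f \<circ> \<phi> a = f" using f a by (simp add: stable_functions_def)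
      ultimately have "base_char (translate (\<phi> a v) S) f = base_char (translate v S) f"
        using base_char_action[OF a, of "translate (\<phi> a v) S" f] by simp
      then show ?thesis using v by simp
    qed
    moreover have "2 * card ?D = card (UNIV :: 'v set)" using zero by (simp add: induced_char_vanishes_iff)
    ultimately show "balanced A \<phi>" unfolding balanced_def by (intro exI[of _ ?D]) blast
  next
    assume "balanced A \<phi>"
    then obtain T where T: "\<forall>a\<in>carrier A. \<phi> a ` T \<subseteq> T" "2 * card T = card (UNIV :: 'v set)"
      unfolding balanced_def by blast
    define S where "S v = (if v \<in> T then 1 else 0 :: bit)" for v
    have "\<phi> a v \<in> T \<longleftrightarrow> v \<in> T" if a: "a \<in> carrier A" for a v
      using T(1) a action_inv[OF a, of v] group.inv_closed[OF group_A a] by (metis image_subset_iff)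
    then have S: "S \<in> stable_functions" by (simp add: stable_functions_def S_def fun_eq_iff)
    have "\<phi> a v = 0 \<longleftrightarrow> v = 0" if a: "a \<in> carrier A" for a v
      using action_zero[OF a] action_inv[OF a, of v] action_zero[OF group.inv_closed[OF group_A a]] by metis
    then have d: "delta 0 \<in> stable_functions" by (simp add: stable_functions_def delta_def fun_eq_iff)
    \<comment> \<open>For the fixed element \<open>delta 0\<close> the set of negative signs is the
      given half \<open>T\<close> itself.\<close>
    have "base_char (translate v S) (delta 0) = - 1 \<longleftrightarrow> v \<in> T" for v
      by (simp add: base_char_delta translate_def S_def bit_sign_def)
    then have "induced_char S (\<lambda>_. 1) (delta 0, 0) = 0" by (simp add: induced_char_vanishes_iff T(2))
    then show "\<exists>S\<in>stable_functions. \<exists>f\<in>stable_functions. induced_char S (\<lambda>_. 1) (f, 0) = 0"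
      using S d by blast
  qed
  finally show ?thesis by (simp add: cI order_fixed_abelianization)
qed

lemma order_semidirect:
  "Coset.order (semidirect_group :: (('v \<Rightarrow> bit) \<times> 'v) monoid) = 2 ^ (2 ^ dim UNIV + dim UNIV)"
proof -
  have "card (UNIV :: ('v \<Rightarrow> bit) set) = 2 ^ card (UNIV :: 'v set)"
    using card_PiE[OF finite_V, of "\<lambda>_. UNIV :: bit set"] by (simp add: PiE_UNIV_domain)
  then have "card (UNIV :: (('v \<Rightarrow> bit) \<times> 'v) set) = 2 ^ (2 ^ dim UNIV) * 2 ^ dim UNIV"
    by (simp add: card_V card_cartesian_product flip: UNIV_Times_UNIV)
  then show ?thesis by (simp add: Coset.order_def power_add)
qed

end

section \<open>The three minima\<close>

theorem corollary3p6:
  shows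
    "((\<exists>(A :: nat monoid) (\<phi> :: nat \<Rightarrow> bit ^ 7 \<Rightarrow> bit ^ 7).
         F2_pair (*s) A \<phi> \<and> balanced A \<phi> \<and>
         vector_space.dim ((*s) :: bit \<Rightarrow> bit ^ 7 \<Rightarrow> bit ^ 7) UNIV = 7) \<and>
      (\<forall>(scale :: bit \<Rightarrow> 'v::ab_group_add \<Rightarrow> 'v) (A :: 'a monoid) (\<phi> :: 'a \<Rightarrow> 'v \<Rightarrow> 'v).
         F2_pair scale A \<phi> \<and> balanced A \<phi> \<longrightarrow>
         7 \<le> vector_space.dim scale UNIV))
     \<and>
     ((\<exists>(A :: nat monoid) (\<phi> :: nat \<Rightarrow> bit ^ 7 \<Rightarrow> bit ^ 7).
         F2_pair (*s) A \<phi> \<and>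
         card (nonvanishing_chars A semidirect_group (induced_action A \<phi>))
           \<noteq> Coset.order (fixed_abelianization A semidirect_group (induced_action A \<phi>)) \<and>
         Coset.order (semidirect_group :: ((bit ^ 7 \<Rightarrow> bit) \<times> (bit ^ 7)) monoid) = 2 ^ 135) \<and>
      (\<forall>(scale :: bit \<Rightarrow> 'v \<Rightarrow> 'v) (A :: 'a monoid) (\<phi> :: 'a \<Rightarrow> 'v \<Rightarrow> 'v).
         F2_pair scale A \<phi> \<and>
         card (nonvanishing_chars A semidirect_group (induced_action A \<phi>))
           \<noteq> Coset.order (fixed_abelianization A semidirect_group (induced_action A \<phi>)) \<longrightarrow>
         2 ^ 135 \<le> Coset.order (semidirect_group :: (('v \<Rightarrow> bit) \<times> 'v) monoid)))
     \<and>
     ((\<exists>(A :: nat monoid) (\<phi> :: nat \<Rightarrow> bit ^ 8 \<Rightarrow> bit ^ 8).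
         F2_pair (*s) A \<phi> \<and> balanced A \<phi> \<and> Coset.order A = 15 \<and>
         vector_space.dim ((*s) :: bit \<Rightarrow> bit ^ 8 \<Rightarrow> bit ^ 8) UNIV = 8) \<and>
      (\<forall>(scale :: bit \<Rightarrow> 'v \<Rightarrow> 'v) (A :: 'a monoid) (\<phi> :: 'a \<Rightarrow> 'v \<Rightarrow> 'v).
         F2_pair scale A \<phi> \<and> balanced A \<phi> \<longrightarrow> 15 \<le> Coset.order A))"
proof -
  have part2: "2 ^ 135 \<le> Coset.order (semidirect_group :: (('v \<Rightarrow> bit) \<times> 'v) monoid)"
    if "F2_pair scale A \<phi>"
      "card (nonvanishing_chars A semidirect_group (induced_action A \<phi>))
        \<noteq> Coset.order (fixed_abelianization A semidirect_group (induced_action A \<phi>))"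
    for scale :: "bit \<Rightarrow> 'v \<Rightarrow> 'v" and A :: "'a monoid" and \<phi>
  proof -
    interpret F2_pair scale A \<phi> by (rule that(1))
    have "balanced A \<phi>" using that(2) nonvanishing_count_iff_balanced by blast
    then have d: "7 \<le> dim UNIV" by (rule balanced_dim_ge_7)
    have "2 ^ 7 \<le> (2 :: nat) ^ dim UNIV" using d by (intro power_increasing) simp_all
    \<comment> \<open>The exponent \<open>2 ^ d + d\<close> grows with \<open>d\<close>, and 135 is
      its value at \<open>d = 7\<close>.\<close>
    then have "135 \<le> 2 ^ dim UNIV + dim UNIV" using d by simp
    then show ?thesis unfolding order_semidirect by (intro power_increasing) simp_all
  qed
  obtain A \<phi> where ex7: "F2_pair ((*s) :: bit \<Rightarrow> bit ^ 7 \<Rightarrow> bit ^ 7) (A :: nat monoid) \<phi>" "balanced A \<phi>"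
    using balanced_pair_7 by blast
  obtain A' \<phi>' where ex8: "F2_pair ((*s) :: bit \<Rightarrow> bit ^ 8 \<Rightarrow> bit ^ 8) (A' :: nat monoid) \<phi>'" "balanced A' \<phi>'"
    "Coset.order A' = 15"
    using balanced_pair_8 by blast
  \<comment> \<open>The dimension is recovered from the number of vectors, which is 2 to that
    power.\<close>
  have d7: "vector_space.dim ((*s) :: bit \<Rightarrow> bit ^ 7 \<Rightarrow> bit ^ 7) UNIV = 7"
    using power_inject_exp[of "2 :: nat" "vec.dim (UNIV :: (bit ^ 7) set)" 7] F2_pair.card_V[OF ex7(1)]
    by (simp del: vec.dim_UNIV power_inject_exp)
  have d8: "vector_space.dim ((*s) :: bit \<Rightarrow> bit ^ 8 \<Rightarrow> bit ^ 8) UNIV = 8"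
    using power_inject_exp[of "2 :: nat" "vec.dim (UNIV :: (bit ^ 8) set)" 8] F2_pair.card_V[OF ex8(1)]
    by (simp del: vec.dim_UNIV power_inject_exp)
  have order7: "Coset.order (semidirect_group :: ((bit ^ 7 \<Rightarrow> bit) \<times> (bit ^ 7)) monoid) = 2 ^ 135"
    using F2_pair.order_semidirect[OF ex7(1)] by (simp add: d7 del: vec.dim_UNIV)
  show ?thesis
  proof (intro conjI)
    show "\<exists>(A :: nat monoid) (\<phi> :: nat \<Rightarrow> bit ^ 7 \<Rightarrow> bit ^ 7). F2_pair (*s) A \<phi> \<and> balanced A \<phi> \<and>
         vector_space.dim ((*s) :: bit \<Rightarrow> bit ^ 7 \<Rightarrow> bit ^ 7) UNIV = 7"
      using ex7 d7 by blast
    show "\<forall>(scale :: bit \<Rightarrow> 'v::ab_group_add \<Rightarrow> 'v) (A :: 'a monoid) (\<phi> :: 'a \<Rightarrow> 'v \<Rightarrow> 'v).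
         F2_pair scale A \<phi> \<and> balanced A \<phi> \<longrightarrow> 7 \<le> vector_space.dim scale UNIV"
      using F2_pair.balanced_dim_ge_7 by blast
    show "\<exists>(A :: nat monoid) (\<phi> :: nat \<Rightarrow> bit ^ 7 \<Rightarrow> bit ^ 7).
         F2_pair (*s) A \<phi> \<and>
         card (nonvanishing_chars A semidirect_group (induced_action A \<phi>))
           \<noteq> Coset.order (fixed_abelianization A semidirect_group (induced_action A \<phi>)) \<and>
         Coset.order (semidirect_group :: ((bit ^ 7 \<Rightarrow> bit) \<times> (bit ^ 7)) monoid) = 2 ^ 135"
      using ex7 order7 F2_pair.nonvanishing_count_iff_balanced[OF ex7(1)] by blast
    show "\<exists>(A :: nat monoid) (\<phi> :: nat \<Rightarrow> bit ^ 8 \<Rightarrow> bit ^ 8).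
         F2_pair (*s) A \<phi> \<and> balanced A \<phi> \<and> Coset.order A = 15 \<and>
         vector_space.dim ((*s) :: bit \<Rightarrow> bit ^ 8 \<Rightarrow> bit ^ 8) UNIV = 8"
      using ex8 d8 by blast
    show "\<forall>(scale :: bit \<Rightarrow> 'v \<Rightarrow> 'v) (A :: 'a monoid) (\<phi> :: 'a \<Rightarrow> 'v \<Rightarrow> 'v).
         F2_pair scale A \<phi> \<and> balanced A \<phi> \<longrightarrow> 15 \<le> Coset.order A"
      using F2_pair.order_ge_15 by blast
  qed (use part2 in blast)
qed

end
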